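(* Let $k\ge 1$ be an integer, let $n\ge 144k^4$, and let $G$ be a simple planar graph of order $n$ which does not contain $k$ pairwise edge-disjoint cycles. Then $\rho(G)\le \rho(K_1\nabla H)$, with equality if and only if $G\cong K_1\nabla H$, where $H$ is the disjoint union of the friendship graph $F_{k-1}$ and $n-2k$ isolated vertices.
   Context: $\rho(G)$ denotes the spectral radius (largest eigenvalue) of the adjacency matrix of $G$. For vertex-disjoint graphs $G_1,G_2$, the join $G_1\nabla G_2$ is obtained from their disjoint union by joining every vertex of $G_1$ to every vertex of $G_2$. The friendship graph $F_m$ ($m\ge1$) is the graph consisting of $m$ triangles sharing exactly one common vertex (so it has $2m+1$ vertices); $F_0$ is a single isolated vertex. *)

theory Defs
  imports "HOL-Analysis.Analysis"
begin

type_synonym 'a graph = "'a set \<times> 'a set set"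

definition verts :: "'a graph \<Rightarrow> 'a set" where "verts G = fst G"
definition edges :: "'a graph \<Rightarrow> 'a set set" where "edges G = snd G"

definition simple_graph :: "'a graph \<Rightarrow> bool" where
  "simple_graph G \<longleftrightarrow> finite (verts G) \<and>
     (\<forall>e\<in>edges G. \<exists>u v. e = {u, v} \<and> u \<noteq> v \<and> u \<in> verts G \<and> v \<in> verts G)"

definition adj :: "'a graph \<Rightarrow> 'a \<Rightarrow> 'a \<Rightarrow> bool" where
  "adj G u v \<longleftrightarrow> {u, v} \<in> edges G"

definition adj_mat :: "'a graph \<Rightarrow> 'a \<Rightarrow> 'a \<Rightarrow> real" where
  "adj_mat G u v = (if adj G u v then 1 else 0)"

text \<open>Eigenvalues of the (real symmetric) adjacency matrix, indexed by the vertex set.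
  Since the matrix is real symmetric, all its eigenvalues are real and have real eigenvectors.\<close>
definition adj_eigenvalue :: "'a graph \<Rightarrow> real \<Rightarrow> bool" where
  "adj_eigenvalue G mu \<longleftrightarrow> (\<exists>x :: 'a \<Rightarrow> real. (\<exists>v\<in>verts G. x v \<noteq> 0) \<and>
      (\<forall>u\<in>verts G. (\<Sum>v\<in>verts G. adj_mat G u v * x v) = mu * x u))"

definition spectral_radius :: "'a graph \<Rightarrow> real" where
  "spectral_radius G = Max {mu. adj_eigenvalue G mu}"

definition graph_iso :: "'a graph \<Rightarrow> 'b graph \<Rightarrow> bool" where
  "graph_iso G H \<longleftrightarrow> (\<exists>f. bij_betw f (verts G) (verts H) \<and>
      (\<forall>u\<in>verts G. \<forall>v\<in>verts G. adj G u v \<longleftrightarrow> adj H (f u) (f v)))"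

definition disj_union :: "'a graph \<Rightarrow> 'b graph \<Rightarrow> ('a + 'b) graph" where
  "disj_union G H = (Inl ` verts G \<union> Inr ` verts H,
      (\<lambda>e. Inl ` e) ` edges G \<union> (\<lambda>e. Inr ` e) ` edges H)"

definition graph_join :: "'a graph \<Rightarrow> 'b graph \<Rightarrow> ('a + 'b) graph" where
  "graph_join G H = (Inl ` verts G \<union> Inr ` verts H,
      (\<lambda>e. Inl ` e) ` edges G \<union> (\<lambda>e. Inr ` e) ` edges H \<union>
      {{Inl u, Inr v} | u v. u \<in> verts G \<and> v \<in> verts H})"

text \<open>K_1, the graph with r isolated vertices, and the friendship graph F_m
  (vertex 0 is the common vertex; the triangles are {0, 2j-1, 2j}, j = 1..m).
  F_0 is a single isolated vertex.\<close>
definition K1 :: "unit graph" where "K1 = ({()}, {})"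

definition empty_graph :: "nat \<Rightarrow> nat graph" where
  "empty_graph r = ({0..<r}, {})"

definition friendship :: "nat \<Rightarrow> nat graph" where
  "friendship m = ({0..2*m},
      {{0, i} | i. 1 \<le> i \<and> i \<le> 2*m} \<union> {{2*j - 1, 2*j} | j. 1 \<le> j \<and> j \<le> m})"

definition is_cycle :: "'a graph \<Rightarrow> 'a list \<Rightarrow> bool" where
  "is_cycle G c \<longleftrightarrow> length c \<ge> 3 \<and> distinct c \<and> set c \<subseteq> verts G \<and>
     (\<forall>i<length c. adj G (c ! i) (c ! ((i + 1) mod length c)))"

definition cycle_edges :: "'a list \<Rightarrow> 'a set set" where
  "cycle_edges c = {{c ! i, c ! ((i + 1) mod length c)} | i. i < length c}"

definition has_k_edge_disjoint_cycles :: "'a graph \<Rightarrow> nat \<Rightarrow> bool" where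
  "has_k_edge_disjoint_cycles G k \<longleftrightarrow> (\<exists>C :: nat \<Rightarrow> 'a list.
      (\<forall>i<k. is_cycle G (C i)) \<and>
      (\<forall>i<k. \<forall>j<k. i \<noteq> j \<longrightarrow> cycle_edges (C i) \<inter> cycle_edges (C j) = {}))"

definition planar :: "'a graph \<Rightarrow> bool" where
  "planar G \<longleftrightarrow> (\<exists>(p :: 'a \<Rightarrow> complex) (\<gamma> :: 'a set \<Rightarrow> real \<Rightarrow> complex).
      inj_on p (verts G) \<and>
      (\<forall>e\<in>edges G. arc (\<gamma> e) \<and> {pathstart (\<gamma> e), pathfinish (\<gamma> e)} = p ` e) \<and>
      (\<forall>e\<in>edges G. \<forall>e'\<in>edges G. e \<noteq> e' \<longrightarrow>
          path_image (\<gamma> e) \<inter> path_image (\<gamma> e') \<subseteq> p ` (e \<inter> e')) \<and>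
      (\<forall>e\<in>edges G. \<forall>v\<in>verts G. v \<notin> e \<longrightarrow> p v \<notin> path_image (\<gamma> e)))"

end

theory Submission
  imports Defs
begin

text \<open>
  Assume that \<open>G\<close> has at least the spectral radius of the extremal graph; then \<open>G\<close> is isomorphic to it,
  for the following reasons.

  Removing at most \<open>k - 1\<close> edge-disjoint cycles leaves a forest whose spectral radius is smaller by at
  most \<open>2 * (k - 1)\<close>. A forest with spectral radius close to \<open>sqrt n\<close> has a vertex \<open>a\<close> of degree close to \<open>n\<close>,
  and two-step walks show that all other entries of the Perron vector of \<open>G\<close> are of order \<open>1 / sqrt n\<close>
  relative to the entry at \<open>a\<close>. A non-neighbour of \<open>a\<close> would then cost more than it can contribute.

  Planarity enters only through the exclusion of a subdivided \<open>K\<^bsub>3,3\<^esub>\<close>: the graph \<open>H\<close> induced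
  on the neighbours of \<open>a\<close> has no theta subgraph with three paths of length at least two. A triangle-free graph of this kind has
  an edge with degree sum at most four or two leaves at a common vertex. Peeling off such pieces,
  or triangles of \<open>H\<close>, costs at most three edges for every cycle gained, so \<open>H\<close> has at most \<open>3 * (k - 1)\<close>
  edges. In the case of equality \<open>H\<close> is a union of edge-disjoint triangles, however one peels.

  Finally, counting walks in \<open>H\<close> determines \<open>\<rho>\<^sup>2\<close> up to lower-order terms by the number of
  edges and the sum of the squared degrees of \<open>H\<close>. For \<open>k - 1\<close> edge-disjoint triangles the latter is largest when they pairwise
  meet, and then they share a vertex.
\<close>

section \<open>Crossing chords of a Jordan curve\<close>

text \<open>Both claims of the theorem come from one implication: if \<rho>(G) is at least the
  extremal value, the graphs are isomorphic, and isomorphic graphs have equal radii. The obstacle is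
  the size of the error terms. The hub of the forest part may miss up to
  \<open>5 * (k - 1) * \<rho>\<close> vertices, and another vertex may share
  \<open>4 * k - 3\<close> neighbours with it; a non-neighbour is excluded only once \<rho> exceeds
  about \<open>10 * k\<^sup>2\<close>. The bound n \<ge> 144k^4 makes \<rho> nearly
  \<open>12 * k\<^sup>2\<close>. In the final comparison one missing edge of H costs about
  \<open>2 * \<rho>\<close> in \<open>\<rho>\<^sup>2 * (\<rho>\<^sup>2 - (n - 1))\<close>, while two
  disjoint triangles cost only 8. This suffices because the remainder, about
  \<open>36 * (k - 1)\<^sup>2 / \<rho>\<close>, stays below 8. Squared degrees cannot tell triangles
  through one vertex from triangles that meet pairwise in different points. The freedom in peeling
  rules out the latter: exchanging three such triangles for the one they enclose spoils the covering
  of H.\<close>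

lemma connected_arc_interior:
  fixes g :: "real \<Rightarrow> complex"
  assumes "arc g" shows "connected (path_image g - {pathstart g, pathfinish g})"
  by (simp add: arc_imp_simple_path assms connected_simple_path_endless)

text \<open>An end of a chord is a limit of the open chord, so it lies in the closure of any face
  that contains the open chord. This is how faces are told apart below.\<close>

lemma arc_ends_in_closure:
  fixes g :: "real \<Rightarrow> complex"
  assumes "arc g"
  shows "pathstart g \<in> closure (path_image g - {pathstart g, pathfinish g})"
    and "pathfinish g \<in> closure (path_image g - {pathstart g, pathfinish g})"
proof -
  have eq: "path_image g - {pathstart g, pathfinish g} = g ` {0<..<1}"
    using simple_path_endless arc_imp_simple_path assms by blast
  have "continuous_on (closure {0<..<1}) g"
    using assms arc_imp_path by (auto simp: path_def)
  then have "g ` closure {0<..<1} \<subseteq> closure (g ` {0<..<1})"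
    by (rule image_closure_subset) (auto simp: closure_subset)
  then have "g ` {0..1} \<subseteq> closure (g ` {0<..<1})" by simp
  then show "pathstart g \<in> closure (path_image g - {pathstart g, pathfinish g})"
    and "pathfinish g \<in> closure (path_image g - {pathstart g, pathfinish g})"
    unfolding eq by (auto simp: pathstart_def pathfinish_def)
qed

lemma jordan_two_arcs:
  fixes c1 c2 :: "real \<Rightarrow> complex"
  assumes "arc c1" "arc c2" "pathstart c1 = u" "pathfinish c1 = v" "pathstart c2 = u" "pathfinish c2 = v"
    and "path_image c1 \<inter> path_image c2 = {u, v}"
  defines "C \<equiv> path_image c1 \<union> path_image c2"
  shows "inside C \<noteq> {}" "open (inside C)" "connected (inside C)" "open (outside C)"
    "connected (outside C)" "\<not> bounded (outside C)" "frontier (inside C) = C" "inside C \<inter> outside C = {}"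
    "inside C \<union> outside C = - C" "bounded (inside C)"
proof -
  have "simple_path (c1 +++ reversepath c2)" "pathfinish (c1 +++ reversepath c2) = pathstart (c1 +++ reversepath c2)"
    using assms by (auto simp: simple_path_join_loop_eq arc_imp_simple_path arc_reversepath)
  moreover have "path_image (c1 +++ reversepath c2) = C"
    using assms by (simp add: path_image_join)
  ultimately show "inside C \<noteq> {}" "open (inside C)" "connected (inside C)" "open (outside C)"
    "connected (outside C)" "\<not> bounded (outside C)" "frontier (inside C) = C" "inside C \<inter> outside C = {}"
    "inside C \<union> outside C = - C" "bounded (inside C)"
    using Jordan_inside_outside[of "c1 +++ reversepath c2"] by auto
qed

text \<open>The chord \<open>l\<close> cuts the inside into two faces, one along \<open>c1\<close>
  and one along \<open>c2\<close>. The open chord \<open>e\<close> is connected and misses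
  \<open>l\<close>, so it stays in one face, whose closure lacks one of the two ends of
  \<open>e\<close>. The connected set \<open>W\<close> off the curve expresses that both chords lie
  on the same side, without naming the side.\<close>

lemma chords_inside_cross:
  fixes c1 c2 l e :: "real \<Rightarrow> complex"
  assumes arcs: "arc c1" "arc c2" "arc l" "arc e"
    and ends: "pathstart c1 = u" "pathfinish c1 = v" "pathstart c2 = u" "pathfinish c2 = v"
      "pathstart l = u" "pathfinish l = v" "pathstart e = x" "pathfinish e = y"
    and int: "path_image c1 \<inter> path_image c2 = {u, v}" "path_image c1 \<inter> path_image l = {u, v}"
      "path_image c2 \<inter> path_image l = {u, v}" "path_image e \<inter> path_image l = {}"
      "path_image e \<inter> (path_image c1 \<union> path_image c2) = {x, y}"
    and xy: "x \<in> path_image c1" "y \<in> path_image c2"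
    and W: "connected W" "W \<inter> (path_image c1 \<union> path_image c2) = {}"
      "path_image l - {u, v} \<subseteq> W" "path_image e - {x, y} \<subseteq> W"
    and inn: "W \<inter> inside (path_image c1 \<union> path_image c2) \<noteq> {}"
  shows False
proof -
  define C where "C = path_image c1 \<union> path_image c2"
  note J = jordan_two_arcs[OF arcs(1,2) ends(1-4) int(1), folded C_def]
  have uv: "u \<noteq> v" using arcs(1) ends(1,2) arc_distinct_ends by blast
  have WI: "W \<subseteq> inside C"
  proof (rule ccontr)
    assume "\<not> W \<subseteq> inside C"
    then have "W \<inter> outside C \<noteq> {}" using J(9) W(2) C_def by blast
    moreover have "W \<subseteq> inside C \<union> outside C" using J(9) W(2) C_def by blast
    ultimately show False
      using connectedD[OF W(1) J(2) J(4)] J(8) inn C_def by auto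
  qed
  have lne: "path_image l - {u,v} \<noteq> {}"
    using arc_ends_in_closure(1)[OF arcs(3)] ends by (metis closure_empty empty_iff)
  have ne: "path_image l \<inter> inside (path_image c1 \<union> path_image c2) \<noteq> {}"
    using lne W(3) WI C_def by blast
  obtain spl: "inside (path_image c1 \<union> path_image l) \<inter> inside (path_image c2 \<union> path_image l) = {}"
     "inside (path_image c1 \<union> path_image l) \<union> inside (path_image c2 \<union> path_image l) \<union>
           (path_image l - {u,v}) = inside C"
    using split_inside_simple_closed_curve[OF _ ends(1,2) _ ends(3,4) _ ends(5,6) uv int(1-3) ne] arcs arc_imp_simple_path C_def
    by metis
  have J1: "open (inside (path_image c1 \<union> path_image l))"
     "frontier (inside (path_image c1 \<union> path_image l)) = path_image c1 \<union> path_image l"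
    using jordan_two_arcs[OF arcs(1,3) ends(1,2,5,6) int(2)] by auto
  have J2: "open (inside (path_image c2 \<union> path_image l))"
     "frontier (inside (path_image c2 \<union> path_image l)) = path_image c2 \<union> path_image l"
    using jordan_two_arcs[OF arcs(2,3) ends(3,4,5,6) int(3)] by auto
  let ?E = "path_image e - {x, y}"
  have Ec: "connected ?E" using connected_arc_interior[OF arcs(4)] ends by simp
  have cl: "x \<in> closure ?E" "y \<in> closure ?E" using arc_ends_in_closure[OF arcs(4)] ends by auto
  have EI: "?E \<subseteq> inside (path_image c1 \<union> path_image l) \<union> inside (path_image c2 \<union> path_image l)"
    using spl(2) W(4) WI int(4) by blast
  have xyl: "x \<notin> path_image l" "y \<notin> path_image l"
    using int(4) ends(7,8) pathstart_in_path_image[of e] pathfinish_in_path_image[of e] by auto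
  have "inside C \<inter> C = {}" by (rule inside_no_overlap)
  then have "x \<notin> inside C" "y \<notin> inside C" using xy unfolding C_def by blast+
  \<comment> \<open>\<open>c1\<close> and \<open>c2\<close> share only \<open>u\<close> and
    \<open>v\<close>, and both of these lie on \<open>l\<close>, which \<open>e\<close>
    avoids.\<close>
  moreover have "x \<notin> path_image c2" "y \<notin> path_image c1"
  proof -
    have "x \<in> {u, v}" if "x \<in> path_image c2" using int(1) xy(1) that by blast
    then show "x \<notin> path_image c2" using int(2) xyl(1) by blast
    have "y \<in> {u, v}" if "y \<in> path_image c1" using int(1) xy(2) that by blast
    then show "y \<notin> path_image c1" using int(2) xyl(2) by blast
  qed
  moreover have "closure (inside (path_image c1 \<union> path_image l)) = inside (path_image c1 \<union> path_image l) \<union> (path_image c1 \<union> path_image l)"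
    "closure (inside (path_image c2 \<union> path_image l)) = inside (path_image c2 \<union> path_image l) \<union> (path_image c2 \<union> path_image l)"
    using J1 J2 by (simp_all only: closure_Un_frontier)
  ultimately have nin: "y \<notin> closure (inside (path_image c1 \<union> path_image l))" "x \<notin> closure (inside (path_image c2 \<union> path_image l))"
    using xyl spl(2) by blast+
  have "?E \<subseteq> inside (path_image c1 \<union> path_image l) \<or> ?E \<subseteq> inside (path_image c2 \<union> path_image l)"
    using connectedD[OF Ec J1(1) J2(1)] spl(1) EI by blast
  then show False
  proof
    assume "?E \<subseteq> inside (path_image c1 \<union> path_image l)"
    then show False using closure_mono cl(2) nin(1) by blast
  next
    assume "?E \<subseteq> inside (path_image c2 \<union> path_image l)"
    then show False using closure_mono cl(1) nin(2) by blast
  qed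
qed

lemma arc_continuous_injective_image:
  fixes f :: "complex \<Rightarrow> complex"
  assumes "arc g" "continuous_on S f" "inj_on f S" "path_image g \<subseteq> S"
  shows "arc (f \<circ> g)"
  unfolding arc_def
proof
  show "path (f \<circ> g)"
    using assms by (intro path_continuous_image) (auto simp: arc_def intro: continuous_on_subset)
  show "inj_on (f \<circ> g) {0..1}"
    using assms by (intro comp_inj_on) (auto simp: arc_def path_image_def intro: inj_on_subset)
qed

text \<open>The splitting of a region by a chord is used for the inside of a curve only. If
  \<open>W\<close> is outside, the previous lemma is applied a second time, to the image of the
  whole configuration under \<open>f\<close>.\<close>

lemma chords_cross:
  fixes c1 c2 l e :: "real \<Rightarrow> complex"
  assumes arcs: "arc c1" "arc c2" "arc l" "arc e"
    and ends: "pathstart c1 = u" "pathfinish c1 = v" "pathstart c2 = u" "pathfinish c2 = v"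
      "pathstart l = u" "pathfinish l = v" "pathstart e = x" "pathfinish e = y"
    and int: "path_image c1 \<inter> path_image c2 = {u, v}" "path_image c1 \<inter> path_image l = {u, v}"
      "path_image c2 \<inter> path_image l = {u, v}" "path_image e \<inter> path_image l = {}"
      "path_image e \<inter> (path_image c1 \<union> path_image c2) = {x, y}"
    and xy: "x \<in> path_image c1" "y \<in> path_image c2"
    and W: "connected W" "W \<inter> (path_image c1 \<union> path_image c2) = {}"
      "path_image l - {u, v} \<subseteq> W" "path_image e - {x, y} \<subseteq> W"
  shows False
proof -
  define C where "C = path_image c1 \<union> path_image c2"
  note J = jordan_two_arcs[OF arcs(1,2) ends(1-4) int(1), folded C_def]
  have notin: "W \<inter> inside C = {}"
    using chords_inside_cross[OF arcs ends int xy W] C_def by blast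
  have lne: "path_image l - {u,v} \<noteq> {}"
    using arc_ends_in_closure(1)[OF arcs(3)] ends by (metis closure_empty empty_iff)
  then have Wne: "W \<noteq> {}" using W(3) by blast
  have Wout: "W \<subseteq> outside C" using notin W(2) J(9) C_def by blast
  obtain z0 where z0: "z0 \<in> inside C" using J(1) by blast
  define f where "f = (\<lambda>z::complex. inverse (z - z0))"
  have cf: "continuous_on (- {z0}) f" unfolding f_def by (intro continuous_intros) auto
  \<comment> \<open>As \<open>inverse 0 = 0\<close>, the map is injective on the whole plane,
    \<open>z0\<close> included, so images commute with intersections without side
    conditions.\<close>
  have injf: "inj f" unfolding f_def by (auto simp: inj_on_def)
  then have inj: "inj_on f (-{z0})" by (rule inj_on_subset) auto
  have Csub: "C \<subseteq> - {z0}" "W \<subseteq> - {z0}" using z0 inside_no_overlap[of C] notin by blast+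
  have sub: "path_image c1 \<subseteq> -{z0}" "path_image c2 \<subseteq> -{z0}" "path_image l \<subseteq> -{z0}" "path_image e \<subseteq> -{z0}"
  proof -
    show "path_image c1 \<subseteq> -{z0}" "path_image c2 \<subseteq> -{z0}" using Csub C_def by auto
    have "{u,v} \<subseteq> C" "{x,y} \<subseteq> C" using int(1) xy C_def by auto
    then show "path_image l \<subseteq> -{z0}" "path_image e \<subseteq> -{z0}" using Csub W(3,4) by blast+
  qed
  have arcs': "arc (f \<circ> c1)" "arc (f \<circ> c2)" "arc (f \<circ> l)" "arc (f \<circ> e)"
    using arc_continuous_injective_image[OF _ cf inj] arcs sub by auto
  have ends': "pathstart (f \<circ> c1) = f u" "pathfinish (f \<circ> c1) = f v" "pathstart (f \<circ> c2) = f u" "pathfinish (f \<circ> c2) = f v"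
      "pathstart (f \<circ> l) = f u" "pathfinish (f \<circ> l) = f v" "pathstart (f \<circ> e) = f x" "pathfinish (f \<circ> e) = f y"
    using ends by (auto simp: pathstart_compose pathfinish_compose)
  have int': "path_image (f \<circ> c1) \<inter> path_image (f \<circ> c2) = {f u, f v}" "path_image (f \<circ> c1) \<inter> path_image (f \<circ> l) = {f u, f v}"
      "path_image (f \<circ> c2) \<inter> path_image (f \<circ> l) = {f u, f v}" "path_image (f \<circ> e) \<inter> path_image (f \<circ> l) = {}"
      "path_image (f \<circ> e) \<inter> (path_image (f \<circ> c1) \<union> path_image (f \<circ> c2)) = {f x, f y}"
    unfolding path_image_compose image_Un[symmetric] image_Int[OF injf, symmetric] using int by auto
  have xy': "f x \<in> path_image (f \<circ> c1)" "f y \<in> path_image (f \<circ> c2)"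
    using xy by (auto simp: path_image_compose)
  have W': "connected (f ` W)" "f ` W \<inter> (path_image (f \<circ> c1) \<union> path_image (f \<circ> c2)) = {}"
      "path_image (f \<circ> l) - {f u, f v} \<subseteq> f ` W" "path_image (f \<circ> e) - {f x, f y} \<subseteq> f ` W"
  proof -
    show "connected (f ` W)" using W(1) Csub(2) cf connected_continuous_image continuous_on_subset by blast
    show "f ` W \<inter> (path_image (f \<circ> c1) \<union> path_image (f \<circ> c2)) = {}"
      unfolding path_image_compose image_Un[symmetric] image_Int[OF injf, symmetric] using W(2) by auto
    show "path_image (f \<circ> l) - {f u, f v} \<subseteq> f ` W" "path_image (f \<circ> e) - {f x, f y} \<subseteq> f ` W"
      using W(3,4) by (auto simp: path_image_compose)
  qed
  define C' where "C' = path_image (f \<circ> c1) \<union> path_image (f \<circ> c2)"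
  have C': "C' = f ` C" by (simp add: C'_def C_def path_image_compose image_Un)
  note J' = jordan_two_arcs[OF arcs'(1,2) ends'(1-4) int'(1), folded C'_def]
  have notin': "f ` W \<inter> inside C' = {}"
    using chords_inside_cross[OF arcs' ends' int' xy' W'] C'_def by blast
  \<comment> \<open>The inversion about an inside point of \<open>C\<close> swaps the two sides, so both would have to lie outside \<open>C'\<close>.\<close>
  have fI: "connected (f ` (inside C - {z0}))"
    by (metis Diff_eq Int_lower2 J(2,3) cf connected_continuous_image connected_open_delete continuous_on_subset DIM_complex order.refl)
  have fO: "connected (f ` outside C)"
  proof (rule connected_continuous_image[OF continuous_on_subset[OF cf] J(5)])
    show "outside C \<subseteq> - {z0}" using z0 J(8) by blast
  qed
  have disjI: "f ` (inside C - {z0}) \<inter> C' = {}" "f ` outside C \<inter> C' = {}"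
    unfolding C' image_Int[OF injf, symmetric] using J(9) inside_no_overlap[of C] by blast+
  obtain r where r: "r > 0" "ball z0 r \<subseteq> inside C" using J(2) z0 openE by blast
  have unb: "\<not> bounded (f ` (inside C - {z0}))"
  proof
    assume "bounded (f ` (inside C - {z0}))"
    then obtain B where B: "B > 0" "\<And>z. z \<in> inside C - {z0} \<Longrightarrow> norm (f z) \<le> B"
      unfolding bounded_pos by (metis imageI)
    \<comment> \<open>\<open>r/2\<close> keeps the point inside \<open>C\<close>, and
      \<open>1/(2*B)\<close> forces \<open>f\<close> to have norm at least \<open>2 * B\<close>
      there.\<close>
    define d where "d = min (r/2) (1/(2*B))"
    have d: "d > 0" "d < r" using r B by (auto simp: d_def min_def)
    have "z0 + of_real d \<in> inside C - {z0}" using d r(2) by (auto simp: dist_norm subset_eq)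
    then have "norm (f (z0 + of_real d)) \<le> B" by (rule B(2))
    then have "1 / d \<le> B" using d by (simp add: f_def norm_inverse divide_inverse)
    then have "1 \<le> B * d" using d by (simp add: field_simps)
    also have "B * d \<le> B * (1/(2*B))" using B(1) by (intro mult_left_mono) (auto simp: d_def)
    also have "\<dots> = 1/2" using B(1) by simp
    finally show False by simp
  qed
  have fIout: "f ` (inside C - {z0}) \<subseteq> outside C'"
  proof (rule ccontr)
    assume "\<not> ?thesis"
    then have "f ` (inside C - {z0}) \<inter> inside C' \<noteq> {}" using disjI J'(9) by blast
    moreover have "f ` (inside C - {z0}) \<subseteq> inside C' \<union> outside C'" using disjI J'(9) by blast
    ultimately have "f ` (inside C - {z0}) \<subseteq> inside C'"
      using connectedD[OF fI J'(2) J'(4)] J'(8) by blast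
    then show False using unb J'(10) bounded_subset by blast
  qed
  have "f ` W \<subseteq> outside C'" using notin' W'(2) J'(9) C'_def by blast
  then have "f ` outside C \<inter> outside C' \<noteq> {}" using Wne Wout by blast
  moreover have "f ` outside C \<subseteq> inside C' \<union> outside C'" using disjI J'(9) by blast
  ultimately have fOout: "f ` outside C \<subseteq> outside C'"
    using connectedD[OF fO J'(4) J'(2)] J'(8) by blast
  \<comment> \<open>Every nonzero \<open>w\<close> is \<open>f z\<close> for
    \<open>z = z0 + inverse w\<close>, and inside, outside and curve are all mapped off the inside
    of \<open>C'\<close>. Only 0 remains, which cannot fill a nonempty open set.\<close>
  have "inside C' \<subseteq> {0}"
  proof
    fix w assume w: "w \<in> inside C'"
    show "w \<in> {0}"
    proof (rule ccontr)
      assume w0: "w \<notin> {0}"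
      define z where "z = z0 + inverse w"
      have "f z = w" "z \<noteq> z0" using w0 by (auto simp: f_def z_def)
      moreover have "z \<in> inside C \<union> outside C \<union> C" unfolding J(9) by simp
      ultimately have "w \<in> f ` (inside C - {z0}) \<or> w \<in> f ` outside C \<or> w \<in> f ` C" by (metis Un_iff Diff_iff imageI singletonD)
      then have "w \<in> outside C' \<or> w \<in> C'" using subsetD[OF fIout, of w] subsetD[OF fOout, of w] unfolding C' by argo
      moreover have "w \<notin> outside C'" "w \<notin> C'" using w J'(8) inside_no_overlap[of C'] by (metis IntI emptyE)+
      ultimately show False by argo
    qed
  qed
  moreover have "infinite (inside C')"
    using finite_imp_not_open[OF _ J'(2)] J'(1) by metis
  ultimately show False using finite_subset[of "inside C'" "{0}"] by simp
qed

section \<open>Plane drawings\<close>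

fun walk_edges :: "'a list \<Rightarrow> 'a set set" where
  "walk_edges (x # y # r) = insert {x, y} (walk_edges (y # r))"
| "walk_edges _ = {}"

lemma Union_walk_edges_subset: "\<Union>(walk_edges q) \<subseteq> set q"
  by (induction q rule: walk_edges.induct) auto

lemma walk_edges_card2: "distinct q \<Longrightarrow> e \<in> walk_edges q \<Longrightarrow> \<exists>u v. u \<noteq> v \<and> e = {u,v}"
  by (induction q rule: walk_edges.induct) auto

lemma walk_edges_subset_iff:
  "walk_edges q \<subseteq> E \<longleftrightarrow> successively (\<lambda>u v. {u,v} \<in> E) q"
  by (induction q rule: walk_edges.induct) auto

locale plane_drawing =
  fixes G :: "'a graph" and p :: "'a \<Rightarrow> complex" and \<gamma> :: "'a set \<Rightarrow> real \<Rightarrow> complex"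
  assumes simple: "simple_graph G"
    and inj: "inj_on p (verts G)"
    and arcs: "e \<in> edges G \<Longrightarrow> arc (\<gamma> e) \<and> {pathstart (\<gamma> e), pathfinish (\<gamma> e)} = p ` e"
    and inter: "e \<in> edges G \<Longrightarrow> e' \<in> edges G \<Longrightarrow> e \<noteq> e' \<Longrightarrow> path_image (\<gamma> e) \<inter> path_image (\<gamma> e') \<subseteq> p ` (e \<inter> e')"
begin

definition drawn :: "'a set set \<Rightarrow> complex set" where
  "drawn E = (\<Union>e\<in>E. path_image (\<gamma> e))"

lemma edge_verts: "e \<in> edges G \<Longrightarrow> e \<subseteq> verts G"
  using simple unfolding simple_graph_def by fastforce

lemma ends_drawn: "E \<subseteq> edges G \<Longrightarrow> p ` \<Union>E \<subseteq> drawn E"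
proof -
  assume E: "E \<subseteq> edges G"
  have "p ` e \<subseteq> path_image (\<gamma> e)" if "e \<in> E" for e
  proof -
    have "p ` e = {pathstart (\<gamma> e), pathfinish (\<gamma> e)}" using arcs[of e] that E by auto
    then show ?thesis by (simp add: pathstart_in_path_image pathfinish_in_path_image)
  qed
  then show ?thesis unfolding drawn_def by blast
qed

text \<open>Turns each intersection of drawn walks into a computation with vertex sets. Having no
  common edge suffices, because distinct edges meet only in images of common vertices.\<close>

lemma drawn_Int:
  assumes "E \<subseteq> edges G" "E' \<subseteq> edges G" "E \<inter> E' = {}"
  shows "drawn E \<inter> drawn E' = p ` (\<Union>E \<inter> \<Union>E')"
proof
  show "drawn E \<inter> drawn E' \<subseteq> p ` (\<Union>E \<inter> \<Union>E')"
  proof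
    fix z assume "z \<in> drawn E \<inter> drawn E'"
    then obtain e e' where e: "e \<in> E" "e' \<in> E'" "z \<in> path_image (\<gamma> e)" "z \<in> path_image (\<gamma> e')"
      unfolding drawn_def by blast
    then have "e \<noteq> e'" using assms(3) by blast
    then have "z \<in> p ` (e \<inter> e')" using inter[of e e'] e assms by blast
    then show "z \<in> p ` (\<Union>E \<inter> \<Union>E')" using e by blast
  qed
  show "p ` (\<Union>E \<inter> \<Union>E') \<subseteq> drawn E \<inter> drawn E'"
    using ends_drawn[OF assms(1)] ends_drawn[OF assms(2)] by blast
qed

lemma edge_arc:
  assumes "{u, v} \<in> edges G" "u \<noteq> v"
  shows "\<exists>g. arc g \<and> pathstart g = p u \<and> pathfinish g = p v \<and> path_image g = path_image (\<gamma> {u,v})"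
proof -
  have a: "arc (\<gamma> {u,v})" "{pathstart (\<gamma> {u,v}), pathfinish (\<gamma> {u,v})} = {p u, p v}"
    using arcs[OF assms(1)] by auto
  show ?thesis
  proof (cases "pathstart (\<gamma> {u,v}) = p u")
    case True
    then show ?thesis using a by (metis arc_distinct_ends doubleton_eq_iff)
  next
    case False
    then have "pathstart (reversepath (\<gamma> {u,v})) = p u" "pathfinish (reversepath (\<gamma> {u,v})) = p v"
      using a(2) by (auto simp: doubleton_eq_iff)
    then show ?thesis using a(1) arc_reversepath path_image_reversepath by metis
  qed
qed

lemma walk_arc:
  assumes "distinct q" "walk_edges q \<subseteq> edges G" "length q \<ge> 2"
  shows "\<exists>g. arc g \<and> pathstart g = p (hd q) \<and> pathfinish g = p (last q) \<and> path_image g = drawn (walk_edges q)"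
  using assms
proof (induction q rule: walk_edges.induct)
  case (1 x y r)
  have xy: "{x,y} \<in> edges G" "x \<noteq> y" using 1 by auto
  obtain g where g: "arc g" "pathstart g = p x" "pathfinish g = p y" "path_image g = path_image (\<gamma> {x,y})"
    using edge_arc[OF xy] by blast
  show ?case
  proof (cases "r = []")
    case True
    then show ?thesis using g by (auto simp: drawn_def)
  next
    case False
    then have "2 \<le> length (y # r)" by (cases r) auto
    then obtain h where h: "arc h" "pathstart h = p y" "pathfinish h = p (last (y # r))"
      "path_image h = drawn (walk_edges (y # r))"
      using 1 by auto
    have nin: "x \<notin> \<Union>(walk_edges (y # r))" using Union_walk_edges_subset[of "y # r"] 1 by auto
    have "path_image g \<inter> path_image h = drawn {{x,y}} \<inter> drawn (walk_edges (y # r))"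
      using g h by (simp add: drawn_def)
    also have "\<dots> = p ` (\<Union>{{x,y}} \<inter> \<Union>(walk_edges (y # r)))"
      using 1 xy nin by (intro drawn_Int) auto
    also have "\<dots> \<subseteq> {p y}" using nin by auto
    finally have "arc (g +++ h)" using g h by (intro arc_join) auto
    moreover have "path_image (g +++ h) = drawn (walk_edges (x # y # r))"
      using g h by (simp add: path_image_join drawn_def)
    ultimately show ?thesis using g h False
      by (intro exI[of _ "g +++ h"]) auto
  qed
qed auto

lemma successively_imp_walk_edges:
  "successively (adj G) q \<Longrightarrow> walk_edges q \<subseteq> edges G"
  unfolding walk_edges_subset_iff adj_def .

lemma Union_walk_edges: "length q \<ge> 2 \<Longrightarrow> \<Union>(walk_edges q) = set q"
proof (induction q rule: walk_edges.induct)
  case (1 x y r) then show ?case by (cases r) (simp_all add: insert_commute)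
qed auto

lemma drawn_connected:
  assumes "{u, v} \<in> edges G" shows "connected (drawn {{u, v}})"
  using arcs[OF assms] connected_path_image[OF arc_imp_path] by (auto simp: drawn_def)

text \<open>The branch vertices are \<open>a\<close>, \<open>x\<close>, \<open>y\<close> on one side
  and the heads \<open>m1\<close>, \<open>m2\<close>, \<open>m3\<close> of the paths on the other;
  only the connections to \<open>y\<close> are subdivided. The walks \<open>q1\<close> through
  \<open>x\<close> and \<open>q2\<close> through \<open>y\<close> form a closed curve through
  \<open>m1\<close> and \<open>m2\<close>; \<open>ql\<close> through \<open>a\<close> and
  \<open>qe\<close> along the third path are chords whose ends alternate on it. The remaining edge
  \<open>{a, m3}\<close> joins the chords off the curve, so they lie on the same side.\<close>

lemma no_subdivided_K33:
  assumes d: "distinct [a, x, y]" "distinct (P1 @ P2 @ P3)" "{a, x, y} \<inter> set (P1 @ P2 @ P3) = {}"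
    and ne: "P1 \<noteq> []" "P2 \<noteq> []" "P3 \<noteq> []"
    and walks: "successively (adj G) P1" "successively (adj G) P2" "successively (adj G) P3"
    and adjs: "\<And>P. P \<in> {P1, P2, P3} \<Longrightarrow> adj G x (hd P) \<and> adj G a (hd P) \<and> adj G (last P) y"
  shows False
proof -
  obtain m1 m2 m3 where m: "hd P1 = m1" "hd P2 = m2" "hd P3 = m3" by blast
  define q1 where "q1 = [m1, x, m2]"
  define q2 where "q2 = P1 @ y # rev P2"
  define ql where "ql = [m1, a, m2]"
  define qe where "qe = x # P3 @ [y]"
  have min: "m1 \<in> set P1" "m2 \<in> set P2" "m3 \<in> set P3" using ne m by auto
  have sym: "adj G u v \<longleftrightarrow> adj G v u" for u v by (simp add: adj_def insert_commute)
  have ad: "adj G x m1" "adj G x m2" "adj G x m3" "adj G a m1" "adj G a m2" "adj G a m3"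
    using adjs m by auto
  have la: "adj G (last P1) y" "adj G (last P2) y" "adj G (last P3) y" using adjs by auto
  have symf: "(\<lambda>u v. adj G v u) = adj G" using sym by blast
  have rv: "successively (adj G) (rev P2)" using walks(2) unfolding successively_rev symf .
  have hr: "hd (rev P2) = last P2" using ne by (simp add: hd_rev)
  have suc: "successively (adj G) q1" "successively (adj G) q2" "successively (adj G) ql" "successively (adj G) qe"
  proof -
    have "adj G m1 x" "adj G m1 a" "adj G y (last P2)" using ad la sym by blast+
    then show "successively (adj G) q1" "successively (adj G) q2" "successively (adj G) ql" "successively (adj G) qe"
      using ad la walks ne m rv hr
      by (simp_all add: q1_def q2_def ql_def qe_def successively_append_iff successively_Cons del: successively_rev)
  qed
  have dist: "distinct q1" "distinct q2" "distinct ql" "distinct qe"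
    using d min by (auto simp: q1_def q2_def ql_def qe_def)
  have len: "length q1 \<ge> 2" "length q2 \<ge> 2" "length ql \<ge> 2" "length qe \<ge> 2"
    using ne by (auto simp: q1_def q2_def ql_def qe_def neq_Nil_conv)
  have E: "walk_edges q1 \<subseteq> edges G" "walk_edges q2 \<subseteq> edges G" "walk_edges ql \<subseteq> edges G" "walk_edges qe \<subseteq> edges G"
    using suc successively_imp_walk_edges by auto
  have sets: "set q1 = {m1, x, m2}" "set q2 = set P1 \<union> {y} \<union> set P2" "set ql = {m1, a, m2}" "set qe = {x, y} \<union> set P3"
    by (auto simp: q1_def q2_def ql_def qe_def)
  have hl: "hd q1 = m1" "last q1 = m2" "hd q2 = m1" "last q2 = m2" "hd ql = m1" "last ql = m2" "hd qe = x" "last qe = y"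
    using ne m by (auto simp: q1_def q2_def ql_def qe_def last_rev)
  obtain c1 c2 l e where
    c1: "arc c1" "pathstart c1 = p m1" "pathfinish c1 = p m2" "path_image c1 = drawn (walk_edges q1)" and
    c2: "arc c2" "pathstart c2 = p m1" "pathfinish c2 = p m2" "path_image c2 = drawn (walk_edges q2)" and
    l: "arc l" "pathstart l = p m1" "pathfinish l = p m2" "path_image l = drawn (walk_edges ql)" and
    e: "arc e" "pathstart e = p x" "pathfinish e = p y" "path_image e = drawn (walk_edges qe)"
    using walk_arc[OF dist(1) E(1) len(1)] walk_arc[OF dist(2) E(2) len(2)]
      walk_arc[OF dist(3) E(3) len(3)] walk_arc[OF dist(4) E(4) len(4)] unfolding hl by metis
  define s where "s = drawn {{a, m3}}"
  have sE: "{{a,m3}} \<subseteq> edges G" using ad by (simp add: adj_def)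
  have di: "drawn (walk_edges q) \<inter> drawn E' = p ` (set q \<inter> \<Union>E')"
    if "q \<in> {q1, q2, ql, qe}" "E' \<subseteq> edges G" "walk_edges q \<inter> E' = {}" for q E'
  proof -
    have "walk_edges q \<subseteq> edges G" "\<Union>(walk_edges q) = set q" using that(1) E len Union_walk_edges[of q] by auto
    then show ?thesis using drawn_Int[of "walk_edges q" E'] that(2,3) by simp
  qed
  have e1: "walk_edges q1 = {{m1,x},{x,m2}}" and el: "walk_edges ql = {{m1,a},{a,m2}}"
    by (auto simp: q1_def ql_def)
  have U: "\<Union>(walk_edges q1) = {m1,x,m2}" "\<Union>(walk_edges q2) = set P1 \<union> {y} \<union> set P2"
    "\<Union>(walk_edges ql) = {m1,a,m2}" "\<Union>(walk_edges qe) = {x,y} \<union> set P3"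
    unfolding Union_walk_edges[OF len(1)] Union_walk_edges[OF len(2)] Union_walk_edges[OF len(3)] Union_walk_edges[OF len(4)] by (fact sets)+
  have disjE: "walk_edges q1 \<inter> walk_edges q2 = {}" "walk_edges q1 \<inter> walk_edges ql = {}"
    "walk_edges q2 \<inter> walk_edges ql = {}" "walk_edges qe \<inter> walk_edges ql = {}"
    "walk_edges qe \<inter> walk_edges q1 = {}" "walk_edges qe \<inter> walk_edges q2 = {}"
    "walk_edges q1 \<inter> {{a,m3}} = {}" "walk_edges q2 \<inter> {{a,m3}} = {}" 
  proof -
    have disj: "A \<inter> B = {}" if "w \<notin> \<Union>A" "\<forall>e\<in>B. w \<in> e" for w :: 'a and A B using that by blast
    have nx: "x \<notin> \<Union>(walk_edges q2)" "x \<notin> \<Union>(walk_edges ql)" "a \<notin> \<Union>(walk_edges q2)" "a \<notin> \<Union>(walk_edges qe)"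
      "a \<notin> \<Union>(walk_edges q1)"
      "m1 \<notin> \<Union>(walk_edges qe)" "m2 \<notin> \<Union>(walk_edges qe)"
      using d min by (auto simp: U)
    show "walk_edges q1 \<inter> walk_edges q2 = {}" using disj[OF nx(1), of "walk_edges q1"] by (auto simp: e1)
    show "walk_edges q1 \<inter> walk_edges ql = {}" using disj[OF nx(2), of "walk_edges q1"] by (auto simp: e1)
    show "walk_edges q2 \<inter> walk_edges ql = {}" by (rule disj[OF nx(3)]) (simp add: el)
    show "walk_edges qe \<inter> walk_edges ql = {}" by (rule disj[OF nx(4)]) (simp add: el)
    have "{m1,x} \<notin> walk_edges qe" "{x,m2} \<notin> walk_edges qe" using nx(6,7) by blast+
    then show "walk_edges qe \<inter> walk_edges q1 = {}" by (simp add: e1)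
    show "walk_edges q1 \<inter> {{a,m3}} = {}" by (rule disj[OF nx(5)]) simp
    show "walk_edges q2 \<inter> {{a,m3}} = {}" by (rule disj[OF nx(3)]) simp
    \<comment> \<open>The two walks share only the vertex \<open>y\<close>, too little for a common
      edge.\<close>
    show "walk_edges qe \<inter> walk_edges q2 = {}"
    proof (rule ccontr)
      assume "\<not> ?thesis"
      then obtain f where f: "f \<in> walk_edges qe" "f \<in> walk_edges q2" by blast
      then obtain u v where "u \<noteq> v" "f = {u,v}" using walk_edges_card2 dist by metis
      moreover have "f \<subseteq> \<Union>(walk_edges qe) \<inter> \<Union>(walk_edges q2)" using f by blast
      then have "f \<subseteq> {y}" unfolding U using d by auto
      ultimately show False by auto
    qed
  qed
  define W where "W = (path_image l - {p m1, p m2}) \<union> s \<union> (path_image e - {p x, p y})"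
  have V: "{a,x,y} \<union> set P1 \<union> set P2 \<union> set P3 \<subseteq> verts G"
  proof -
    have "\<Union>E' \<subseteq> verts G" if "E' \<subseteq> edges G" for E' using that by (meson Sup_least edge_verts subsetD)
    from this[OF E(1)] this[OF E(2)] this[OF E(3)] this[OF E(4)] show ?thesis unfolding U by auto
  qed
  have pinj: "p u = p v \<longleftrightarrow> u = v" if "u \<in> {a,x,y} \<union> set P1 \<union> set P2 \<union> set P3" "v \<in> {a,x,y} \<union> set P1 \<union> set P2 \<union> set P3" for u v
    using inj V that by (meson inj_onD subsetD)
  have "set q1 \<inter> \<Union>(walk_edges q2) = {m1, m2}" unfolding U sets using d min by auto
  then have I12: "path_image c1 \<inter> path_image c2 = {p m1, p m2}"
    unfolding c1(4) c2(4) using di[of q1 "walk_edges q2", OF _ E(2) disjE(1)] by simp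
  have "set q1 \<inter> \<Union>(walk_edges ql) = {m1, m2}" unfolding U sets using d min by auto
  then have I1l: "path_image c1 \<inter> path_image l = {p m1, p m2}"
    unfolding c1(4) l(4) using di[of q1 "walk_edges ql", OF _ E(3) disjE(2)] by simp
  have "set q2 \<inter> \<Union>(walk_edges ql) = {m1, m2}" unfolding U sets using d min by auto
  then have I2l: "path_image c2 \<inter> path_image l = {p m1, p m2}"
    unfolding c2(4) l(4) using di[of q2 "walk_edges ql", OF _ E(3) disjE(3)] by simp
  have "set qe \<inter> \<Union>(walk_edges ql) = {}" unfolding U sets using d min by auto
  then have Iel: "path_image e \<inter> path_image l = {}"
    unfolding e(4) l(4) using di[of qe "walk_edges ql", OF _ E(3) disjE(4)] by simp
  have "set qe \<inter> \<Union>(walk_edges q1) = {x}" unfolding U sets using d min by auto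
  then have Ie1: "path_image e \<inter> path_image c1 = {p x}"
    unfolding e(4) c1(4) using di[of qe "walk_edges q1", OF _ E(1) disjE(5)] by simp
  have "set qe \<inter> \<Union>(walk_edges q2) = {y}" unfolding U sets using d min by auto
  then have Ie2: "path_image e \<inter> path_image c2 = {p y}"
    unfolding e(4) c2(4) using di[of qe "walk_edges q2", OF _ E(2) disjE(6)] by simp
  have "set q1 \<inter> \<Union>{{a,m3}} = {}" unfolding sets using d min by auto
  then have Is1: "path_image c1 \<inter> s = {}"
    unfolding c1(4) s_def using di[of q1 "{{a,m3}}", OF _ sE disjE(7)] by simp
  have "set q2 \<inter> \<Union>{{a,m3}} = {}" unfolding sets using d min by auto
  then have Is2: "path_image c2 \<inter> s = {}"
    unfolding c2(4) s_def using di[of q2 "{{a,m3}}", OF _ sE disjE(8)] by simp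
  have ps: "p a \<in> s" "p m3 \<in> s" using ends_drawn[OF sE] by (auto simp: s_def)
  have pa: "p a \<in> path_image l - {p m1, p m2}"
  proof -
    have "p a \<in> path_image l" using ends_drawn[OF E(3)] unfolding U l(4) by auto
    moreover have "p a \<noteq> p m1" "p a \<noteq> p m2" using pinj[of a m1] pinj[of a m2] d(3) min by auto
    ultimately show ?thesis by simp
  qed
  have pm: "p m3 \<in> path_image e - {p x, p y}"
  proof -
    have "p m3 \<in> path_image e" using ends_drawn[OF E(4)] min unfolding U e(4) by auto
    moreover have "p m3 \<noteq> p x" "p m3 \<noteq> p y" using pinj[of m3 x] pinj[of m3 y] d(3) min by auto
    ultimately show ?thesis by simp
  qed
  have cW: "connected W"
  proof -
    have 1: "connected (path_image l - {p m1, p m2})" using connected_arc_interior[OF l(1)] l by simp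
    have 2: "connected (path_image e - {p x, p y})" using connected_arc_interior[OF e(1)] e by simp
    have 3: "connected s" unfolding s_def using drawn_connected sE by auto
    have "connected ((path_image l - {p m1, p m2}) \<union> s)"
      by (rule connected_Un[OF 1 3]) (use ps(1) pa in blast)
    then show ?thesis unfolding W_def
      by (rule connected_Un[OF _ 2]) (use ps(2) pm in blast)
  qed
  show False
  proof (rule chords_cross[OF c1(1) c2(1) l(1) e(1) c1(2,3) c2(2,3) l(2,3) e(2,3) I12 I1l I2l Iel _ _ _ cW])
    show "path_image e \<inter> (path_image c1 \<union> path_image c2) = {p x, p y}" using Ie1 Ie2 by blast
    show "p x \<in> path_image c1" "p y \<in> path_image c2" using Ie1 Ie2 by auto
    show "W \<inter> (path_image c1 \<union> path_image c2) = {}"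
      unfolding W_def using I1l I2l Ie1 Ie2 Is1 Is2 by blast
  qed (auto simp: W_def)
qed

end

lemma planar_no_subdivided_K33:
  fixes G :: "'a graph"
  assumes "simple_graph G" "planar G"
    and d: "distinct [a, x, y]" "distinct (P1 @ P2 @ P3)" "{a, x, y} \<inter> set (P1 @ P2 @ P3) = {}"
    and ne: "P1 \<noteq> []" "P2 \<noteq> []" "P3 \<noteq> []"
    and walks: "successively (adj G) P1" "successively (adj G) P2" "successively (adj G) P3"
    and adjs: "\<And>P. P \<in> {P1, P2, P3} \<Longrightarrow> adj G x (hd P) \<and> adj G a (hd P) \<and> adj G (last P) y"
  shows False
proof -
  obtain p :: "'a \<Rightarrow> complex" and \<gamma> :: "'a set \<Rightarrow> real \<Rightarrow> complex" where pg: "inj_on p (verts G) \<and>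
      (\<forall>e\<in>edges G. arc (\<gamma> e) \<and> {pathstart (\<gamma> e), pathfinish (\<gamma> e)} = p ` e) \<and>
      (\<forall>e\<in>edges G. \<forall>e'\<in>edges G. e \<noteq> e' \<longrightarrow>
          path_image (\<gamma> e) \<inter> path_image (\<gamma> e') \<subseteq> p ` (e \<inter> e')) \<and>
      (\<forall>e\<in>edges G. \<forall>v\<in>verts G. v \<notin> e \<longrightarrow> p v \<notin> path_image (\<gamma> e))"
    using assms(2) unfolding planar_def by (elim exE) (rule that)
  interpret plane_drawing G p \<gamma>
    by unfold_locales (use assms(1) pg in simp_all)
  show False by (rule no_subdivided_K33[OF d ne walks adjs])
qed

section \<open>Triangle-free graphs without long theta subgraphs\<close>

definition edge_set :: "'a set set \<Rightarrow> bool" where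
  "edge_set E \<longleftrightarrow> finite E \<and> (\<forall>e\<in>E. \<exists>u v. u \<noteq> v \<and> e = {u, v})"

definition nb :: "'a set set \<Rightarrow> 'a \<Rightarrow> 'a set" where
  "nb E v = {u. {v, u} \<in> E}"

definition triangle_free :: "'a set set \<Rightarrow> bool" where
  "triangle_free E \<longleftrightarrow> \<not> (\<exists>u v w. {u, v} \<in> E \<and> {v, w} \<in> E \<and> {u, w} \<in> E)"

definition conn :: "'a set set \<Rightarrow> 'a set \<Rightarrow> bool" where
  "conn E A \<longleftrightarrow> (\<forall>u\<in>A. \<forall>v\<in>A. (\<lambda>x y. x \<in> A \<and> y \<in> A \<and> {x, y} \<in> E)\<^sup>*\<^sup>* u v)"

definition links :: "'a set set \<Rightarrow> 'a \<Rightarrow> 'a \<Rightarrow> 'a set \<Rightarrow> bool" where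
  "links E x y A \<longleftrightarrow> conn E A \<and> x \<notin> A \<and> y \<notin> A \<and> (\<exists>u\<in>A. {x, u} \<in> E) \<and> (\<exists>u\<in>A. {y, u} \<in> E)"

text \<open>A subdivision of \<open>K\<^bsub>2,3\<^esub>\<close>, with the three paths given only up to their connected vertex sets.\<close>
definition long_theta :: "'a set set \<Rightarrow> bool" where
  "long_theta E \<longleftrightarrow> (\<exists>x y A1 A2 A3. x \<noteq> y \<and> links E x y A1 \<and> links E x y A2 \<and> links E x y A3 \<and>
     A1 \<inter> A2 = {} \<and> A1 \<inter> A3 = {} \<and> A2 \<inter> A3 = {})"

definition cyc :: "'a set set \<Rightarrow> 'a list \<Rightarrow> bool" where
  "cyc E c \<longleftrightarrow> length c \<ge> 3 \<and> distinct c \<and> successively (\<lambda>u v. {u, v} \<in> E) c \<and> {last c, hd c} \<in> E"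

section \<open>Walks, connected sets and rotated cycles\<close>

lemma nb_sym: "u \<in> nb E v \<longleftrightarrow> v \<in> nb E u"
  by (simp add: nb_def insert_commute)

lemma edge_set_neq: "edge_set E \<Longrightarrow> {u, v} \<in> E \<Longrightarrow> u \<noteq> v"
  unfolding edge_set_def by (metis doubleton_eq_iff insert_absorb2)

lemma finite_nb: "edge_set E \<Longrightarrow> finite (nb E v)"
proof -
  assume E: "edge_set E"
  have "nb E v \<subseteq> \<Union>E" by (auto simp: nb_def)
  moreover have "finite (\<Union>E)" using E by (auto simp: edge_set_def)
  ultimately show ?thesis by (rule finite_subset)
qed

text \<open>Loops are cut off as the walk grows at its front. The last conjunct lets callers confine
  the path to what is reachable from \<open>u\<close>.\<close>

lemma rtranclp_distinct_path:
  assumes "R\<^sup>*\<^sup>* u v"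
  shows "\<exists>p. p \<noteq> [] \<and> hd p = u \<and> last p = v \<and> distinct p \<and> successively R p \<and> (\<forall>z\<in>set p. R\<^sup>*\<^sup>* u z)"
  using assms
proof (induction rule: converse_rtranclp_induct)
  case base
  then show ?case by (intro exI[of _ "[v]"]) auto
next
  case (step u u')
  then obtain p where p: "p \<noteq> []" "hd p = u'" "last p = v" "distinct p" "successively R p" "\<forall>z\<in>set p. R\<^sup>*\<^sup>* u' z" by blast
  show ?case
  proof (cases "u \<in> set p")
    case True
    then obtain p1 p2 where "p = p1 @ u # p2" by (meson split_list)
    then show ?thesis using p step(1)
      by (intro exI[of _ "u # p2"]) (auto simp: successively_append_iff intro: converse_rtranclp_into_rtranclp)
  next
    case False
    then show ?thesis using p step(1)
      by (intro exI[of _ "u # p"]) (auto simp: successively_Cons intro: converse_rtranclp_into_rtranclp)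
  qed
qed

lemma walk_reaches:
  assumes "successively (\<lambda>x y. {x, y} \<in> E) q" "q \<noteq> []" "set q \<subseteq> A" "v \<in> set q"
  shows "(\<lambda>x y. x \<in> A \<and> y \<in> A \<and> {x, y} \<in> E)\<^sup>*\<^sup>* (hd q) v"
  using assms
proof (induction q)
  case (Cons x q)
  show ?case
  proof (cases "v = x")
    case False
    then have q: "q \<noteq> []" "v \<in> set q" using Cons.prems by auto
    then have "{x, hd q} \<in> E" "hd q \<in> set q" using Cons.prems by (auto simp: successively_Cons)
    then show ?thesis using Cons q
      by (auto simp: successively_Cons intro!: converse_rtranclp_into_rtranclp[of _ x "hd q"])
  qed simp
qed simp

lemma walk_conn:
  assumes "successively (\<lambda>x y. {x, y} \<in> E) q"
  shows "conn E (set q)"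
proof (cases "q = []")
  case False
  let ?R = "\<lambda>x y. x \<in> set q \<and> y \<in> set q \<and> {x, y} \<in> E"
  have 1: "?R\<^sup>*\<^sup>* (hd q) v" if "v \<in> set q" for v
    using walk_reaches[OF assms False _ that] by blast
  have "symp ?R" by (auto simp: symp_def insert_commute)
  then have "?R\<^sup>*\<^sup>* v (hd q)" if "v \<in> set q" for v
    using 1[OF that] by (meson sympD symp_rtranclp)
  then show ?thesis using 1 unfolding conn_def by (meson rtranclp_trans)
qed (simp add: conn_def)

lemma cyc_rotate:
  assumes "cyc E (xs @ ys)" shows "cyc E (ys @ xs)"
proof (cases "xs = [] \<or> ys = []")
  case False
  then show ?thesis using assms by (auto simp: cyc_def successively_append_iff)
qed (use assms in auto)

lemma cyc_rotate_to:
  assumes "cyc E c" "w \<in> set c"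
  obtains c' where "cyc E (w # c')" "set (w # c') = set c" "length (w # c') = length c"
proof -
  obtain a b where "c = a @ w # b" using assms(2) by (meson split_list)
  then show ?thesis using assms(1) cyc_rotate[of E a "w # b"] that[of "b @ a"] by auto
qed

lemma long_thetaI:
  assumes "x \<noteq> y" "distinct (q1 @ q2 @ q3)" "x \<notin> set (q1 @ q2 @ q3)" "y \<notin> set (q1 @ q2 @ q3)"
    and "successively (\<lambda>u v. {u, v} \<in> E) q1" "successively (\<lambda>u v. {u, v} \<in> E) q2" "successively (\<lambda>u v. {u, v} \<in> E) q3"
    and "\<exists>u\<in>set q1. {x, u} \<in> E" "\<exists>u\<in>set q1. {y, u} \<in> E"
      "\<exists>u\<in>set q2. {x, u} \<in> E" "\<exists>u\<in>set q2. {y, u} \<in> E" "\<exists>u\<in>set q3. {x, u} \<in> E" "\<exists>u\<in>set q3. {y, u} \<in> E"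
  shows "long_theta E"
proof -
  have "links E x y (set q1)" "links E x y (set q2)" "links E x y (set q3)"
    using assms walk_conn unfolding links_def by auto
  moreover have "set q1 \<inter> set q2 = {}" "set q1 \<inter> set q3 = {}" "set q2 \<inter> set q3 = {}" using assms(2) by auto
  ultimately show ?thesis using assms(1) unfolding long_theta_def by blast
qed

text \<open>A cycle with two crossing chords is a subdivided K_4, which alone is not enough: all
  three paths of the theta need inner vertices. \<open>length B \<ge> 2\<close> gives
  \<open>m\<close> a further vertex of \<open>B\<close> on the side of \<open>x\<close> or of
  \<open>y\<close>, and the theta then joins \<open>m\<close> to \<open>x\<close> or to
  \<open>y\<close> respectively.\<close>

lemma crossing_chords_long_theta:
  assumes c: "cyc E (x # B @ y # Q)" and xy: "{x, y} \<in> E" and m: "m \<in> set B" and h: "h \<in> set Q"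
    and mh: "{m, h} \<in> E" and B: "length B \<ge> 2"
  shows "long_theta E"
proof -
  let ?R = "\<lambda>u v. {u, v} \<in> E"
  obtain B1 B2 where B12: "B = B1 @ m # B2" using m by (meson split_list)
  have d: "distinct (x # B1 @ m # B2 @ y # Q)" and s: "successively ?R (x # B1 @ m # B2 @ y # Q)"
    and l: "{last (x # B @ y # Q), x} \<in> E"
    using c by (auto simp: cyc_def B12)
  have Q: "Q \<noteq> []" using h by auto
  have lQ: "{x, last Q} \<in> E" "last Q \<in> set Q" using l Q by (auto simp: insert_commute)
  have hQ: "{y, hd Q} \<in> E" "hd Q \<in> set Q" using s Q by (auto simp: successively_append_iff successively_Cons)
  have sQ: "successively ?R Q" "successively ?R B1" "successively ?R B2"
    using s by (auto simp: successively_append_iff successively_Cons)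
  show ?thesis
  proof (cases "B1 = []")
    case False
    have s2: "successively ?R (B2 @ [y])" using s by (auto simp: successively_append_iff successively_Cons)
    have b1: "{x, hd B1} \<in> E" "{last B1, m} \<in> E" using s False by (auto simp: successively_append_iff successively_Cons)
    have b2: "{m, hd (B2 @ [y])} \<in> E" "hd (B2 @ [y]) \<in> set (B2 @ [y])"
      using s by (cases B2; auto simp: successively_append_iff successively_Cons)+
    show ?thesis
    proof (rule long_thetaI[of m x B1 "B2 @ [y]" Q])
      show "\<exists>u\<in>set B1. {m, u} \<in> E" "\<exists>u\<in>set B1. {x, u} \<in> E"
        using b1 False hd_in_set last_in_set by (metis insert_commute)+
      show "\<exists>u\<in>set (B2 @ [y]). {m, u} \<in> E" using b2 by (rule bexI)
      show "\<exists>u\<in>set (B2 @ [y]). {x, u} \<in> E" using xy by auto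
      show "\<exists>u\<in>set Q. {m, u} \<in> E" "\<exists>u\<in>set Q. {x, u} \<in> E" using h mh lQ by blast+
    qed (use d sQ s2 in auto)
  next
    case True
    then have B2: "B2 \<noteq> []" using B B12 by auto
    have b: "{m, hd B2} \<in> E" "{last B2, y} \<in> E" "{m, x} \<in> E"
      using s B2 True by (auto simp: successively_append_iff successively_Cons insert_commute)
    show ?thesis
    proof (rule long_thetaI[of m y B2 "[x]" Q])
      show "\<exists>u\<in>set B2. {m, u} \<in> E" "\<exists>u\<in>set B2. {y, u} \<in> E"
        using b B2 hd_in_set last_in_set by (metis insert_commute)+
      show "\<exists>u\<in>set [x]. {m, u} \<in> E" "\<exists>u\<in>set [x]. {y, u} \<in> E" using b xy by (auto simp: insert_commute)
      show "\<exists>u\<in>set Q. {m, u} \<in> E" "\<exists>u\<in>set Q. {y, u} \<in> E" using h mh hQ by blast+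
    qed (use d sQ in auto)
  qed
qed

text \<open>What a counterexample to the light-edge statement would satisfy; the locale ends with
  the conclusion that such a graph is empty.\<close>

locale no_light_edge =
  fixes E :: "'a set set"
  assumes E: "edge_set E" and tf: "triangle_free E" and nt: "\<not> long_theta E"
    and heavy: "{u, v} \<in> E \<Longrightarrow> card (nb E u) + card (nb E v) \<ge> 5"
    and no_twins: "nb E u = {w} \<Longrightarrow> nb E u' = {w} \<Longrightarrow> u = u'"
begin

abbreviation "R \<equiv> \<lambda>u v. {u, v} \<in> E"

lemma not_both_small:
  assumes "{u, v} \<in> E" "nb E u \<subseteq> {a, b}" "nb E v \<subseteq> {a', b'}" shows False
proof -
  have 2: "card {p, q} \<le> 2" for p q :: 'a by (simp add: card_insert_if)
  have "card (nb E u) \<le> 2" "card (nb E v) \<le> 2"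
    using card_mono[OF _ assms(2)] card_mono[OF _ assms(3)] 2 by (meson finite.emptyI finite_insert le_trans)+
  then show False using heavy[OF assms(1)] by linarith
qed

text \<open>A longest cycle has no ears: between consecutive attachment points the ear would
  lengthen the cycle, and otherwise the ear and the two stretches of the cycle form a long theta.
  Maximality is demanded only among cycles through \<open>r\<close> inside \<open>S\<close>.\<close>

lemma ear_impossible:
  assumes c: "cyc E c" "set c \<subseteq> S" "r \<in> set c"
    and max: "\<And>c'. cyc E c' \<Longrightarrow> set c' \<subseteq> S \<Longrightarrow> r \<in> set c' \<Longrightarrow> length c' \<le> length c"
    and p: "p \<noteq> []" "distinct p" "successively R p" "set p \<subseteq> S - set c"
    and w: "w \<in> set c" "{w, hd p} \<in> E" and u: "u \<in> set c" "{last p, u} \<in> E" and wu: "w \<noteq> u"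
  shows False
proof -
  obtain c' where c': "cyc E (w # c')" "set (w # c') = set c" "length (w # c') = length c"
    using cyc_rotate_to[OF c(1) w(1)] by blast
  have "u \<in> set c'" using c'(2) u(1) wu by auto
  then obtain c1 c2 where c12: "c' = c1 @ u # c2" by (meson split_list)
  have d: "distinct (w # c1 @ u # c2)" and s: "successively R (w # c1 @ u # c2)" and l: "{last (w # c1 @ u # c2), w} \<in> E"
    using c'(1) by (auto simp: cyc_def c12)
  have setc: "set c = {w, u} \<union> set c1 \<union> set c2" using c'(2) c12 by auto
  have len: "length c = length c1 + length c2 + 2" using c'(3) c12 by auto
  have pc: "set p \<inter> set c = {}" using p(4) by auto
  consider "c1 = []" | "c2 = []" | "c1 \<noteq> []" "c2 \<noteq> []" by blast
  then show False
  proof cases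
    case 1
    have "cyc E (w # p @ u # c2)"
      using d s l p w(2) u(2) pc setc 1 unfolding cyc_def
      by (auto simp: successively_append_iff successively_Cons Suc_le_eq)
    moreover have "set (w # p @ u # c2) \<subseteq> S" "r \<in> set (w # p @ u # c2)" "length (w # p @ u # c2) > length c"
      using c p setc 1 len by auto
    ultimately show False using max[of "w # p @ u # c2"] by linarith
  next
    case 2
    have rp: "successively R (rev p)" using p(3) by (simp add: insert_commute)
    have "{w, hd (c1 @ u # rev p)} \<in> E"
      using s by (cases c1) (auto simp: successively_Cons)
    then have "cyc E (w # c1 @ u # rev p)"
      using d s l p(1,2) rp w(2) u(2) pc setc 2 unfolding cyc_def
      by (auto simp: successively_append_iff successively_Cons Suc_le_eq hd_rev last_rev insert_commute)
    moreover have "set (w # c1 @ u # rev p) \<subseteq> S" "r \<in> set (w # c1 @ u # rev p)" "length (w # c1 @ u # rev p) > length c"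
      using c p setc 2 len by auto
    ultimately show False using max[of "w # c1 @ u # rev p"] by linarith
  next
    case 3
    have s': "successively R c1" "successively R c2" "{w, hd c1} \<in> E" "{last c1, u} \<in> E" "{u, hd c2} \<in> E" "{last c2, w} \<in> E"
      using s l 3 by (auto simp: successively_append_iff successively_Cons)
    have "long_theta E"
    proof (rule long_thetaI[OF wu, of c1 c2 p])
      show "\<exists>z\<in>set c1. {w, z} \<in> E" "\<exists>z\<in>set c1. {u, z} \<in> E"
        using s'(3,4) 3 hd_in_set last_in_set by (metis insert_commute)+
      show "\<exists>z\<in>set c2. {w, z} \<in> E" "\<exists>z\<in>set c2. {u, z} \<in> E"
        using s'(5,6) 3 hd_in_set last_in_set by (metis insert_commute)+
      show "\<exists>z\<in>set p. {w, z} \<in> E" "\<exists>z\<in>set p. {u, z} \<in> E"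
        using p(1) w(2) u(2) hd_in_set last_in_set by (metis insert_commute)+
    qed (use d p pc setc s' in auto)
    then show False using nt by simp
  qed
qed

text \<open>No other chord leaves the inner vertices of a chord of least span: one that stays within
  the span would be shorter, and one that leaves it crosses and gives a long theta. Consecutive
  vertices inside the span therefore have only their two cycle neighbours on the cycle.\<close>

lemma chordless_pair:
  assumes c: "cyc E c" "hd c = r"
  obtains u v a b a' b' where "u \<in> set c" "v \<in> set c" "u \<noteq> r" "v \<noteq> r" "{u, v} \<in> E"
    "nb E u \<inter> set c \<subseteq> {a, b}" "nb E v \<inter> set c \<subseteq> {a', b'}"
proof -
  define L where "L = length c"
  have d: "distinct c" and s: "successively R c" and l: "{last c, hd c} \<in> E" and L3: "L \<ge> 3"
    using c by (auto simp: cyc_def L_def)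
  have nthR: "{c ! i, c ! Suc i} \<in> E" if "Suc i < L" for i
    using s that unfolding L_def by (simp add: successively_conv_nth)
  have c0: "c ! 0 = r" "{c ! (L - 1), r} \<in> E"
  proof -
    have "c \<noteq> []" using L3 L_def by auto
    then show "c ! 0 = r" "{c ! (L - 1), r} \<in> E" using c(2) l by (simp_all add: L_def hd_conv_nth last_conv_nth)
  qed
  have L4: "L \<ge> 4"
  proof (rule ccontr)
    assume "\<not> 4 \<le> L"
    then have "L = 3" using L3 by simp
    then have "{c!0, c!1} \<in> E" "{c!1, c!2} \<in> E" "{c!0, c!2} \<in> E"
      using nthR[of 0] nthR[of 1] c0 by (auto simp: insert_commute numeral_2_eq_2)
    then show False using tf unfolding triangle_free_def by blast
  qed
  \<comment> \<open>The pair \<open>(0, L)\<close> is an artificial chord around the whole cycle, so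
    that a minimum exists even without chords. The closing edge from \<open>0\<close> to
    \<open>L - 1\<close> does not count as a chord.\<close>
  define P where "P = (\<lambda>i j. i + 2 \<le> j \<and> (i = 0 \<and> j = L \<or> j < L \<and> {c ! i, c ! j} \<in> E \<and> \<not> (i = 0 \<and> j = L - 1)))"
  have "P 0 L" using L3 by (simp add: P_def)
  then have ex: "\<exists>ij. P (fst ij) (snd ij)" by (intro exI[of _ "(0, L)"]) simp
  obtain ij where ij0: "P (fst ij) (snd ij)" "\<And>ij'. P (fst ij') (snd ij') \<Longrightarrow> snd ij - fst ij \<le> snd ij' - fst ij'"
    using ex_has_least_nat[of "\<lambda>ij. P (fst ij) (snd ij)" _ "\<lambda>ij. snd ij - fst ij"] ex by metis
  define i j where "i = fst ij" and "j = snd ij"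
  have ij: "P i j" and min: "\<And>i' j'. P i' j' \<Longrightarrow> j - i \<le> j' - i'"
    using ij0(1) ij0(2)[of "(i', j')" for i' j'] by (auto simp: i_def j_def)
  have jL: "j \<le> L" using ij by (auto simp: P_def)
  \<comment> \<open>A chord of span two would close a triangle; span three leaves two inner
    positions, both different from position 0, which holds \<open>r\<close>.\<close>
  have ij3: "i + 3 \<le> j"
  proof (rule ccontr)
    assume "\<not> i + 3 \<le> j"
    then have j: "j = Suc (Suc i)" using ij by (auto simp: P_def)
    then have "j < L" "{c ! i, c ! j} \<in> E" using ij L4 by (auto simp: P_def)
    then show False using nthR[of i] nthR[of "Suc i"] tf j unfolding triangle_free_def by (metis Suc_lessD)
  qed
  have nbm: "nb E (c ! m) \<inter> set c \<subseteq> {c ! (m - 1), c ! (Suc m mod L)}" if m: "i < m" "m < j" for m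
  proof
    fix z assume "z \<in> nb E (c ! m) \<inter> set c"
    then obtain h where h: "h < L" "z = c ! h" "{c ! m, c ! h} \<in> E"
      by (auto simp: nb_def in_set_conv_nth L_def)
    have mL: "m < L" using m jL by simp
    have "h \<noteq> m" using h edge_set_neq[OF E] by auto
    show "z \<in> {c ! (m - 1), c ! (Suc m mod L)}"
    proof (rule ccontr)
      assume nz: "\<not> ?thesis"
      then have h1: "h \<noteq> m - 1" "h \<noteq> Suc m mod L" using h by auto
      have h2: "h \<noteq> Suc m" using h1(2) h(1) by auto
      show False
      proof (cases "i \<le> h \<and> h \<le> j")
        case True
        have "P (min m h) (max m h)"
          unfolding P_def
        proof (intro conjI disjI2)
          show "min m h + 2 \<le> max m h" using \<open>h \<noteq> m\<close> h1(1) h2 m by (auto simp: min_def max_def)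
          show "max m h < L" using mL h by simp
          show "{c ! min m h, c ! max m h} \<in> E" using h by (auto simp: min_def max_def insert_commute)
          show "\<not> (min m h = 0 \<and> max m h = L - 1)"
          proof
            assume "min m h = 0 \<and> max m h = L - 1"
            then have "h = 0" "m = L - 1" using m by (auto simp: min_def max_def split: if_splits)
            then show False using h1(2) L3 by simp
          qed
        qed
        then have "j - i \<le> max m h - min m h" by (rule min)
        then show False using True m by (auto simp: min_def max_def split: if_splits)
      next
        case False
        \<comment> \<open>The end \<open>h\<close> lies outside the span, so \<open>(i, j)\<close>
          is a genuine chord and the edge from \<open>m\<close> to \<open>h\<close> crosses
          it.\<close>
        then have jlt: "j < L" "{c ! i, c ! j} \<in> E" using ij h jL by (auto simp: P_def)
        define B where "B = take (j - i - 1) (drop (Suc i) c)"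
        have lenc: "length c = L" by (simp add: L_def)
        have 1: "drop i c = c ! i # drop (Suc i) c" using jlt ij3 lenc by (simp add: Cons_nth_drop_Suc)
        have 2: "drop (Suc i) c = B @ drop j c" unfolding B_def using ij3
          by (metis append_take_drop_id drop_drop diff_Suc_1 Suc_diff_Suc add.commute diff_diff_left le_add_diff_inverse2 less_eq_Suc_le m order_less_trans plus_1_eq_Suc)
        have 3: "drop j c = c ! j # drop (Suc j) c" using jlt lenc by (simp add: Cons_nth_drop_Suc)
        have dec: "c = take i c @ (c ! i # B @ c ! j # drop (Suc j) c)"
          using 1 2 3 by (metis append_take_drop_id)
        then have "cyc E ((c ! i # B @ c ! j # drop (Suc j) c) @ take i c)"
          using c(1) cyc_rotate by metis
        then have cy: "cyc E (c ! i # B @ c ! j # (drop (Suc j) c @ take i c))" by simp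
        have mB: "c ! m \<in> set B"
        proof -
          have "B ! (m - Suc i) = c ! m" "m - Suc i < length B" using m jlt lenc by (auto simp: B_def)
          then show ?thesis by (metis nth_mem)
        qed
        have hO: "c ! h \<in> set (drop (Suc j) c @ take i c)"
        proof (cases "h < i")
          case True
          then have "take i c ! h = c ! h" "h < length (take i c)" using jlt ij3 lenc by auto
          then show ?thesis by (metis Un_iff nth_mem set_append)
        next
          case F: False
          then have "h \<ge> Suc j" using False by simp
          then have "drop (Suc j) c ! (h - Suc j) = c ! h" "h - Suc j < length (drop (Suc j) c)" using h lenc by auto
          then show ?thesis by (metis Un_iff nth_mem set_append)
        qed
        have "length B \<ge> 2" using ij3 jlt lenc by (simp add: B_def)
        then have "long_theta E" using crossing_chords_long_theta[OF cy jlt(2) mB hO] h by simp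
        then show False using nt by simp
      qed
    qed
  qed
  have i2: "i + 2 < L" using ij3 jL by simp
  have ne: "c ! Suc i \<noteq> r" "c ! Suc (Suc i) \<noteq> r"
    using i2 nth_eq_iff_index_eq[OF d, of "Suc i" 0] nth_eq_iff_index_eq[OF d, of "Suc (Suc i)" 0] c0(1)
    by (force simp: L_def)+
  show thesis
  proof (rule that)
    show "c ! Suc i \<in> set c" "c ! Suc (Suc i) \<in> set c" using i2 by (auto simp: L_def)
    show "{c ! Suc i, c ! Suc (Suc i)} \<in> E" using nthR i2 by simp
    show "nb E (c ! Suc i) \<inter> set c \<subseteq> {c ! (Suc i - 1), c ! (Suc (Suc i) mod L)}" using nbm[of "Suc i"] ij3 by simp
    show "nb E (c ! Suc (Suc i)) \<inter> set c \<subseteq> {c ! (Suc (Suc i) - 1), c ! (Suc (Suc (Suc i)) mod L)}" using nbm[of "Suc (Suc i)"] ij3 by simp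
  qed (use ne in auto)
qed


text \<open>\<open>S\<close> is a union of pieces attached to the rest of the graph at
  \<open>r\<close> only. Induction on its size reduces to connected \<open>S - {r}\<close>. If
  \<open>r\<close> has at most one neighbour in \<open>S\<close>, the induction hypothesis at
  another root produces leaves there, hence twins or a light edge. Otherwise take a longest cycle
  through \<open>r\<close> in \<open>S\<close>: whatever hangs off it at another vertex is a smaller
  piece, hence a leaf, and \<open>chordless_pair\<close> yields a light edge.\<close>

lemma lobe:
  assumes "finite S" "r \<in> S" "\<And>v. v \<in> S - {r} \<Longrightarrow> nb E v \<subseteq> S" "v \<in> S - {r}" "nb E v \<noteq> {}"
  shows "nb E v = {r}"
  using assms
proof (induction "card S" arbitrary: S r v rule: less_induct)
  case less
  note fin = less.prems(1) and rS = less.prems(2) and closed = less.prems(3) and v = less.prems(4,5)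
  have IH: "nb E v' = {r'}" if "S' \<subset> S" "r' \<in> S'" "\<And>w. w \<in> S' - {r'} \<Longrightarrow> nb E w \<subseteq> S'" "v' \<in> S' - {r'}" "nb E v' \<noteq> {}" for S' r' v'
    using less.hyps[OF psubset_card_mono[OF fin that(1)] _ that(2-5)] finite_subset[OF _ fin] that(1) by blast
  show ?case
  proof (rule ccontr)
    assume nr: "nb E v \<noteq> {r}"
    define R' where "R' = (\<lambda>x y. x \<in> S - {r} \<and> y \<in> S - {r} \<and> {x, y} \<in> E)"
    define K where "K = {w. R'\<^sup>*\<^sup>* v w}"
    have KS: "K \<subseteq> S - {r}"
    proof
      fix w assume "w \<in> K"
      then have "R'\<^sup>*\<^sup>* v w" by (simp add: K_def)
      then show "w \<in> S - {r}" by (cases rule: rtranclp.cases) (use v in \<open>auto simp: R'_def\<close>)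
    qed
    have vK: "v \<in> K" by (simp add: K_def)
    have Kcl: "nb E w \<subseteq> insert r K" if "w \<in> K" for w
    proof
      fix z assume z: "z \<in> nb E w"
      then have "z \<in> S" using closed[of w] KS that by blast
      show "z \<in> insert r K"
      proof (cases "z = r")
        case False
        then have "R' w z" using z KS that \<open>z \<in> S\<close> by (auto simp: R'_def nb_def)
        then show ?thesis using that by (auto simp: K_def intro: rtranclp.rtrancl_into_rtrancl)
      qed simp
    qed
    \<comment> \<open>If this failed, the component of \<open>v\<close> with \<open>r\<close> would
      be a smaller piece, for which the claim is known.\<close>
    have SK: "insert r K = S"
    proof (rule ccontr)
      assume "insert r K \<noteq> S"
      then have "insert r K \<subset> S" using KS rS by blast
      from IH[OF this, of r v] Kcl vK KS v(2) nr show False by blast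
    qed
    have symR: "symp R'" by (auto simp: R'_def symp_def insert_commute)
    have reach: "R'\<^sup>*\<^sup>* w z" if "w \<in> S - {r}" "z \<in> S - {r}" for w z
    proof -
      have "w \<in> K" "z \<in> K" using that SK by auto
      then have "R'\<^sup>*\<^sup>* v w" "R'\<^sup>*\<^sup>* v z" by (auto simp: K_def)
      then show ?thesis by (meson symR symp_rtranclp sympD rtranclp_trans)
    qed
    have Sr: "S - {r} \<subset> S" using rS by blast
    consider "nb E r \<inter> S = {}" | s where "nb E r \<inter> S = {s}"
      | s1 s2 where "s1 \<in> nb E r \<inter> S" "s2 \<in> nb E r \<inter> S" "s1 \<noteq> s2"
      by blast
    then show False
    proof cases
      case 1
      have clr: "nb E w \<subseteq> S - {r}" if "w \<in> S - {r}" for w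
        using closed[OF that] 1 that nb_sym by fastforce
      have leaf: "nb E w = {v}" if "w \<in> nb E v" for w
      proof (rule IH[OF Sr v(1)])
        show "w \<in> S - {r} - {v}" using that clr[OF v(1)] edge_set_neq[OF E] by (auto simp: nb_def)
        show "nb E w \<noteq> {}" using that nb_sym by fastforce
      qed (use clr in blast)
      obtain w where w: "w \<in> nb E v" using v(2) by blast
      have "nb E v \<subseteq> {w}" using no_twins[OF leaf[OF w]] leaf by blast
      then show False using not_both_small[of v w w w v v] leaf[OF w] w by (auto simp: nb_def)
    next
      case (2 s)
      have "s \<in> nb E r \<inter> S" using 2 by blast
      then have s: "s \<in> S - {r}" "s \<in> nb E r" using edge_set_neq[OF E, of r s] by (auto simp: nb_def)
      have clr: "nb E w \<subseteq> S - {r}" if "w \<in> S - {r} - {s}" for w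
        using closed[of w] 2 that nb_sym by fastforce
      have leaf: "nb E w = {s}" if "w \<in> S - {r} - {s}" "nb E w \<noteq> {}" for w
        by (rule IH[OF Sr s(1)]) (use clr that in auto)
      have nbs: "nb E s \<subseteq> S" using closed s by blast
      show False
      proof (cases "nb E s \<subseteq> {r}")
        case True
        show False
        proof (cases "v = s")
          case True then show False using \<open>nb E s \<subseteq> {r}\<close> v nr by blast
        next
          case False
          then have "nb E v = {s}" using leaf v by blast
          then have "v \<in> nb E s" using nb_sym by fastforce
          then show False using True v by blast
        qed
      next
        case False
        then obtain w where w: "w \<in> nb E s" "w \<noteq> r" by blast
        have l: "nb E w' = {s}" if "w' \<in> nb E s" "w' \<noteq> r" for w'
        proof (rule leaf)
          show "w' \<in> S - {r} - {s}" using that nbs edge_set_neq[OF E] by (auto simp: nb_def)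
          show "nb E w' \<noteq> {}" using that nb_sym by fastforce
        qed
        have "nb E s \<subseteq> {r, w}" using no_twins[OF l[OF w]] l by blast
        moreover have "nb E w \<subseteq> {s, s}" using l[OF w] by simp
        moreover have "{s, w} \<in> E" using w by (simp add: nb_def)
        ultimately show False using not_both_small by blast
      qed
    next
      \<comment> \<open>A path between the two neighbours that avoids \<open>r\<close> closes up to
        a cycle through \<open>r\<close>, so a longest such cycle exists.\<close>
      case (3 s1 s2)
      have "s1 \<in> S - {r}" "s2 \<in> S - {r}" using 3 edge_set_neq[OF E, of r s1] edge_set_neq[OF E, of r s2] by (auto simp: nb_def)
      then obtain q where q: "q \<noteq> []" "hd q = s1" "last q = s2" "distinct q" "successively R' q" "\<forall>z\<in>set q. R'\<^sup>*\<^sup>* s1 z"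
        using rtranclp_distinct_path[OF reach] by meson
      have qS: "set q \<subseteq> S - {r}"
      proof
        fix z assume "z \<in> set q"
        then have "R'\<^sup>*\<^sup>* s1 z" using q by blast
        then show "z \<in> S - {r}" by (cases rule: rtranclp.cases) (use \<open>s1 \<in> S - {r}\<close> in \<open>auto simp: R'_def\<close>)
      qed
      have q2: "length q \<ge> 2"
      proof (rule ccontr)
        assume "\<not> 2 \<le> length q"
        then have "q = [hd q]" using q(1) by (cases q) (auto simp: Suc_le_eq)
        then have "last q = hd q" by (metis last_ConsL)
        then show False using q 3 by simp
      qed
      have "successively R q" using q(5) by (rule successively_mono) (auto simp: R'_def)
      then have cyc0: "cyc E (r # q)"
        using q q2 qS 3 by (auto simp: cyc_def successively_Cons nb_def insert_commute)
      define \<C> where "\<C> = (\<lambda>c. cyc E c \<and> set c \<subseteq> S \<and> r \<in> set c)"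
      have C0: "\<C> (r # q)" using cyc0 qS rS by (auto simp: \<C>_def)
      have bd: "\<forall>c. \<C> c \<longrightarrow> length c \<le> card S"
        unfolding \<C>_def cyc_def using fin by (metis card_mono distinct_card)
      obtain c where c: "\<C> c" and max: "\<And>c'. \<C> c' \<Longrightarrow> length c' \<le> length c"
        using ex_has_greatest_nat[of \<C> "r # q" length "Suc (card S)"] C0 bd by (metis le_imp_less_Suc less_or_eq_imp_le)
      have cc: "cyc E c" "set c \<subseteq> S" "r \<in> set c" using c by (auto simp: \<C>_def)
      \<comment> \<open>The component of \<open>y\<close> off the cycle is attached at
        \<open>w\<close> alone, since a second attachment would give an ear. With root
        \<open>w\<close> it is a smaller piece, as it does not contain \<open>r\<close>.\<close>
      have off: "nb E y = {w}" if w: "w \<in> set c" "w \<noteq> r" and y: "y \<in> nb E w" "y \<notin> set c" for w y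
      proof -
        have yS: "y \<in> S" using closed[of w] w y cc by blast
        define R'' where "R'' = (\<lambda>x z. x \<in> S - set c \<and> z \<in> S - set c \<and> {x, z} \<in> E)"
        define K' where "K' = {z. R''\<^sup>*\<^sup>* y z}"
        have K'S: "K' \<subseteq> S - set c"
        proof
          fix z assume "z \<in> K'"
          then have "R''\<^sup>*\<^sup>* y z" by (simp add: K'_def)
          then show "z \<in> S - set c" by (cases rule: rtranclp.cases) (use y yS in \<open>auto simp: R''_def\<close>)
        qed
        have yK': "y \<in> K'" by (simp add: K'_def)
        have cl: "nb E z \<subseteq> insert w K'" if z: "z \<in> K'" for z
        proof
          fix u assume u: "u \<in> nb E z"
          have zz: "z \<in> S - set c" "z \<noteq> r" using z K'S cc by auto
          then have uS: "u \<in> S" using u closed[of z] by blast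
          show "u \<in> insert w K'"
          proof (cases "u \<in> set c")
            case False
            then have "R'' z u" using zz uS u by (auto simp: R''_def nb_def)
            then show ?thesis using z by (auto simp: K'_def intro: rtranclp.rtrancl_into_rtrancl)
          next
            case True
            show ?thesis
            proof (rule ccontr)
              assume "u \<notin> insert w K'"
              then have uw: "w \<noteq> u" by auto
              have "R''\<^sup>*\<^sup>* y z" using z by (simp add: K'_def)
              then obtain p where p: "p \<noteq> []" "hd p = y" "last p = z" "distinct p" "successively R'' p" "\<forall>x\<in>set p. R''\<^sup>*\<^sup>* y x"
                using rtranclp_distinct_path by meson
              have "set p \<subseteq> K'" using p(6) by (auto simp: K'_def)
              then have pS: "set p \<subseteq> S - set c" using K'S by blast
              have pR: "successively R p" using p(5) by (rule successively_mono) (auto simp: R''_def)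
              have "{w, hd p} \<in> E" "{last p, u} \<in> E" using y u p by (auto simp: nb_def)
              with ear_impossible[OF cc _ p(1,4) pR pS w(1) _ True _ uw] max show False by (auto simp: \<C>_def)
            qed
          qed
        qed
        show "nb E y = {w}"
        proof (rule IH)
          show "insert w K' \<subset> S" using K'S w cc by blast
          show "y \<in> insert w K' - {w}" using yK' w y by auto
          show "nb E y \<noteq> {}" using y nb_sym by fastforce
        qed (use cl in auto)
      qed
      \<comment> \<open>There is at most one leaf at \<open>w\<close>, as twins are excluded. With
        one leaf, \<open>w\<close> has degree at most three and the edge to the leaf is
        light.\<close>
      have small: "nb E w \<subseteq> {a, b}" if w: "w \<in> set c" "w \<noteq> r" "nb E w \<inter> set c \<subseteq> {a, b}" for w a b
      proof (rule ccontr)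
        assume "\<not> nb E w \<subseteq> {a, b}"
        then obtain y where y: "y \<in> nb E w" "y \<notin> set c" using w(3) by blast
        have ly: "nb E y = {w}" using off[OF w(1,2) y] .
        have "nb E w \<subseteq> {a, b, y}"
          using w(3) no_twins[OF ly] off[OF w(1,2)] by blast
        then have "card (nb E w) \<le> card {a, b, y}" by (intro card_mono) auto
        also have "\<dots> \<le> 3" by (simp add: card_insert_if)
        finally show False using heavy[of w y] y ly by (simp add: nb_def)
      qed
      obtain c' where c': "cyc E (r # c')" "set (r # c') = set c" using cyc_rotate_to[OF cc(1,3)] by metis
      obtain u v a b a' b' where uv: "u \<in> set c" "v \<in> set c" "u \<noteq> r" "v \<noteq> r" "{u, v} \<in> E"
        "nb E u \<inter> set c \<subseteq> {a, b}" "nb E v \<inter> set c \<subseteq> {a', b'}"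
        using chordless_pair[OF c'(1)] c'(2) by (metis list.sel(1))
      show False using not_both_small[OF uv(5) small[OF uv(1,3,6)] small[OF uv(2,4,7)]] .
    qed
  qed
qed

text \<open>With the whole graph as \<open>S\<close> and an end of some edge as root, everything is
  a star around the root; without twins it is a single edge, which is light.\<close>

lemma no_edges: "E = {}"
proof (rule ccontr)
  assume "E \<noteq> {}"
  then obtain u v where uv: "u \<noteq> v" "{u, v} \<in> E" using E unfolding edge_set_def by fastforce
  have fin: "finite (\<Union>E)" using E by (auto simp: edge_set_def)
  have r: "u \<in> \<Union>E" and cl: "nb E w \<subseteq> \<Union>E" for w using uv by (auto simp: nb_def)
  have leaf: "nb E w = {u}" if "w \<in> \<Union>E - {u}" "nb E w \<noteq> {}" for w
    using lobe[OF fin r cl that] .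
  have leaf': "nb E w = {u}" if "w \<in> nb E u" for w
  proof (rule leaf)
    show "w \<in> \<Union>E - {u}" using that cl edge_set_neq[OF E] by (auto simp: nb_def)
    show "nb E w \<noteq> {}" using that nb_sym by fastforce
  qed
  have v: "v \<in> nb E u" using uv by (simp add: nb_def)
  have "nb E u \<subseteq> {v, v}" using no_twins[OF leaf'[OF v]] leaf' by blast
  moreover have "nb E v \<subseteq> {u, u}" using leaf'[OF v] by simp
  ultimately show False using not_both_small[OF uv(2)] by blast
qed

end

lemma light_edge_or_twin_leaves:
  assumes "edge_set E" "triangle_free E" "\<not> long_theta E" "E \<noteq> {}"
  shows "(\<exists>u v. {u, v} \<in> E \<and> card (nb E u) + card (nb E v) \<le> 4) \<or> (\<exists>u u' w. u \<noteq> u' \<and> nb E u = {w} \<and> nb E u' = {w})"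
proof (rule ccontr)
  assume neg: "\<not> ?thesis"
  have "no_light_edge E"
  proof
    fix u v assume "{u, v} \<in> E"
    then have "\<not> card (nb E u) + card (nb E v) \<le> 4" using neg by blast
    then show "5 \<le> card (nb E u) + card (nb E v)" by linarith
  next
    fix u u' w assume "nb E u = {w}" "nb E u' = {w}"
    then show "u = u'" using neg by blast
  qed (use assms in auto)
  then show False using no_light_edge.no_edges assms(4) by blast
qed

section \<open>Packing edge-disjoint cycles\<close>

lemma cyc_mono: "cyc E c \<Longrightarrow> E \<subseteq> F \<Longrightarrow> cyc F c"
  unfolding cyc_def by (auto elim: successively_mono)

lemma cyc_nth:
  "cyc E c \<longleftrightarrow> length c \<ge> 3 \<and> distinct c \<and> (\<forall>i<length c. {c ! i, c ! ((i + 1) mod length c)} \<in> E)"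
proof (cases "length c \<ge> 3")
  case True
  then have ne: "c \<noteq> []" by auto
  have "(\<forall>i<length c. {c ! i, c ! ((i + 1) mod length c)} \<in> E) \<longleftrightarrow>
    (\<forall>i. Suc i < length c \<longrightarrow> {c ! i, c ! Suc i} \<in> E) \<and> {c ! (length c - 1), c ! 0} \<in> E" (is "?L \<longleftrightarrow> ?R")
  proof
    assume L: ?L
    show ?R
    proof (intro conjI allI impI)
      fix i assume "Suc i < length c" then show "{c ! i, c ! Suc i} \<in> E" using L[rule_format, of i] by simp
    next
      show "{c ! (length c - 1), c ! 0} \<in> E" proof -
        have "Suc (length c - 1) = length c" "length c - 1 < length c" using True by auto
        then show ?thesis using L[rule_format, of "length c - 1"] by simp
      qed
    qed
  next
    assume R: ?R
    show ?L
    proof (intro allI impI)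
      fix i assume i: "i < length c"
      show "{c ! i, c ! ((i + 1) mod length c)} \<in> E"
      proof (cases "Suc i < length c")
        case False
        then have "i = length c - 1" using i by simp
        moreover have "Suc i = length c" using i False by simp
        then have "(i + 1) mod length c = 0" by simp
        ultimately show ?thesis using R by simp
      qed (use R in simp)
    qed
  qed
  then show ?thesis using ne by (auto simp: cyc_def successively_conv_nth hd_conv_nth last_conv_nth)
qed (simp add: cyc_def)

lemma cycle_edges_subset: "cyc E c \<Longrightarrow> cycle_edges c \<subseteq> E"
  unfolding cyc_nth cycle_edges_def by auto

lemma cycle_edges3: "cycle_edges [x, y, z] = {{x, y}, {y, z}, {z, x}}"
proof -
  have "{i. i < length [x, y, z]} = {0, 1, 2}" by auto
  then show ?thesis unfolding cycle_edges_def setcompr_eq_image by simp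
qed

lemma cycle_edges4: "cycle_edges [x, y, z, w] = {{x, y}, {y, z}, {z, w}, {w, x}}"
proof -
  have "{i. i < length [x, y, z, w]} = {0, 1, 2, 3}" by auto
  then show ?thesis unfolding cycle_edges_def setcompr_eq_image by simp
qed

lemma cyc3: "cyc E [x, y, z] \<longleftrightarrow> distinct [x, y, z] \<and> {{x, y}, {y, z}, {z, x}} \<subseteq> E"
  by (simp add: cyc_def; blast)

lemma cyc4: "cyc E [x, y, z, w] \<longleftrightarrow> distinct [x, y, z, w] \<and> {{x, y}, {y, z}, {z, w}, {w, x}} \<subseteq> E"
  by (simp add: cyc_def; blast)

text \<open>Edge-disjoint cycles as successive deletions, so that peeling arguments are plain
  inductions; \<open>packs_family\<close> recovers the indexed family.\<close>

inductive packs :: "'a set set \<Rightarrow> nat \<Rightarrow> bool" where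
  packs_0: "packs F 0"
| packs_Suc: "cyc F c \<Longrightarrow> packs (F - cycle_edges c) t \<Longrightarrow> packs F (Suc t)"

lemma packs_mono: "packs F t \<Longrightarrow> F \<subseteq> F' \<Longrightarrow> packs F' t"
proof (induction arbitrary: F' rule: packs.induct)
  case (packs_Suc F c t)
  have "packs (F' - cycle_edges c) t" by (rule packs_Suc.IH) (use packs_Suc.prems in blast)
  moreover have "cyc F' c" using packs_Suc.hyps(1) packs_Suc.prems by (rule cyc_mono)
  ultimately show ?case by (rule packs.packs_Suc[rotated])
qed (rule packs_0)

lemma packs_decrease: "packs F t \<Longrightarrow> s \<le> t \<Longrightarrow> packs F s"
proof (induction arbitrary: s rule: packs.induct)
  case (packs_Suc F c t)
  then show ?case by (cases s) (auto intro: packs.intros)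
qed (auto intro: packs_0)

lemma packs_insert:
  assumes "cyc F c" "packs F' t" "F' \<subseteq> F" "F' \<inter> cycle_edges c = {}"
  shows "packs F (Suc t)"
proof (rule packs_Suc[OF assms(1)])
  show "packs (F - cycle_edges c) t" using packs_mono[OF assms(2)] assms(3,4) by blast
qed

lemma packs_Un: "packs F s \<Longrightarrow> packs F' t \<Longrightarrow> F \<inter> F' = {} \<Longrightarrow> packs (F \<union> F') (s + t)"
proof (induction rule: packs.induct)
  case (packs_0 F)
  then show ?case using packs_mono[of F' t "F \<union> F'"] by simp
next
  case (packs_Suc F c s)
  have "cycle_edges c \<subseteq> F" using packs_Suc(1) by (rule cycle_edges_subset)
  then have "packs (F - cycle_edges c \<union> F') (s + t)" "(F - cycle_edges c \<union> F') \<inter> cycle_edges c = {}"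
    using packs_Suc by auto
  moreover have "cyc (F \<union> F') c" using packs_Suc(1) by (rule cyc_mono) auto
  ultimately have "packs (F \<union> F') (Suc (s + t))" by (intro packs_insert[of _ c "F - cycle_edges c \<union> F'"]) auto
  then show ?case by simp
qed

lemma packs_family:
  assumes "packs F t"
  shows "\<exists>C. (\<forall>i<t. cyc F (C i)) \<and> (\<forall>i<t. \<forall>j<t. i \<noteq> j \<longrightarrow> cycle_edges (C i) \<inter> cycle_edges (C j) = {})"
  using assms
proof (induction rule: packs.induct)
  case (packs_Suc F c t)
  then obtain C where C: "\<forall>i<t. cyc (F - cycle_edges c) (C i)"
    "\<forall>i<t. \<forall>j<t. i \<noteq> j \<longrightarrow> cycle_edges (C i) \<inter> cycle_edges (C j) = {}" by blast
  have d: "cycle_edges (C i) \<inter> cycle_edges c = {}" if "i < t" for i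
    using cycle_edges_subset[of "F - cycle_edges c" "C i"] C(1) that by blast
  have F: "cyc F (C i)" if "i < t" for i using C(1) that cyc_mono by blast
  define C' where "C' = (\<lambda>i. case i of 0 \<Rightarrow> c | Suc j \<Rightarrow> C j)"
  show ?case
  proof (intro exI[of _ C'] conjI allI impI)
    fix i assume "i < Suc t" then show "cyc F (C' i)" using packs_Suc(1) F by (auto simp: C'_def split: nat.split)
  next
    fix i j assume "i < Suc t" "j < Suc t" "i \<noteq> j"
    then show "cycle_edges (C' i) \<inter> cycle_edges (C' j) = {}"
      using C(2) d by (auto simp: C'_def Int_commute split: nat.split)
  qed
qed simp

lemma packs_imp_has_k:
  assumes "simple_graph G" "packs (edges G) k"
  shows "has_k_edge_disjoint_cycles G k"
proof -
  obtain C where C: "\<forall>i<k. cyc (edges G) (C i)" "\<forall>i<k. \<forall>j<k. i \<noteq> j \<longrightarrow> cycle_edges (C i) \<inter> cycle_edges (C j) = {}"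
    using packs_family[OF assms(2)] by blast
  have "is_cycle G c" if "cyc (edges G) c" for c
    unfolding is_cycle_def adj_def
  proof (intro conjI)
    show "set c \<subseteq> verts G"
    proof
      fix v assume "v \<in> set c"
      then obtain i where i: "i < length c" "v = c ! i" by (auto simp: in_set_conv_nth)
      then have "{v, c ! ((i + 1) mod length c)} \<in> edges G" using that unfolding cyc_nth by blast
      then obtain x y where "{v, c ! ((i + 1) mod length c)} = {x, y}" "x \<in> verts G" "y \<in> verts G"
        using assms(1) unfolding simple_graph_def by blast
      then show "v \<in> verts G" by (metis doubleton_eq_iff)
    qed
  qed (use that cyc_nth in auto)
  then show ?thesis using C unfolding has_k_edge_disjoint_cycles_def by blast
qed

lemma edge_set_subset: "edge_set E \<Longrightarrow> E' \<subseteq> E \<Longrightarrow> edge_set E'"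
  unfolding edge_set_def using finite_subset by blast

lemma triangle_free_subset: "triangle_free E \<Longrightarrow> E' \<subseteq> E \<Longrightarrow> triangle_free E'"
  unfolding triangle_free_def by blast

lemma long_theta_mono:
  assumes "long_theta E'" "E' \<subseteq> E" shows "long_theta E"
proof -
  have c: "conn E A" if "conn E' A" for A
    unfolding conn_def
  proof (intro ballI)
    fix u v assume uv: "u \<in> A" "v \<in> A"
    then have "(\<lambda>x y. x \<in> A \<and> y \<in> A \<and> {x, y} \<in> E')\<^sup>*\<^sup>* u v" using that unfolding conn_def by blast
    then show "(\<lambda>x y. x \<in> A \<and> y \<in> A \<and> {x, y} \<in> E)\<^sup>*\<^sup>* u v"
      by (rule rtranclp_mono[THEN predicate2D, rotated]) (use assms(2) in auto)
  qed
  have "links E x y A" if "links E' x y A" for x y A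
    using that c assms(2) unfolding links_def by blast
  then show ?thesis using assms(1) unfolding long_theta_def by meson
qed

section \<open>Cones over triangle-free graphs\<close>

definition apex :: "'a \<Rightarrow> 'a set set \<Rightarrow> 'a set set" where
  "apex a E = E \<union> {{a, v} | v. v \<in> \<Union>E}"

lemma apex_mono: "E \<subseteq> E' \<Longrightarrow> apex a E \<subseteq> apex a E'"
  unfolding apex_def by blast

lemma nb_in_Union: "u \<in> nb E v \<Longrightarrow> u \<in> \<Union>E \<and> v \<in> \<Union>E"
  by (auto simp: nb_def)

lemma edge_set_pair: "edge_set E \<Longrightarrow> e \<in> E \<Longrightarrow> \<exists>u v. u \<noteq> v \<and> e = {u, v}"
  unfolding edge_set_def by (rule bspec[of E]) auto

lemma incident_subset:
  assumes "edge_set E" "e \<in> E" "v \<in> e" obtains x where "x \<in> nb E v" "e = {v, x}"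
proof -
  obtain x y where xy: "e = {x, y}" using edge_set_pair[OF assms(1,2)] by (elim exE conjE) (rule that)
  consider "v = x" | "v = y" using assms(3) xy by auto
  then show thesis
  proof cases
    case 1 then show thesis using that[of y] assms(2) xy by (simp add: nb_def)
  next
    case 2 then show thesis using that[of x] assms(2) xy by (simp add: nb_def insert_commute)
  qed
qed

lemma apex_spoke:
  assumes e: "{u, v} \<in> E"
  shows "{a, u} \<in> apex a E \<and> {u, a} \<in> apex a E \<and> {a, v} \<in> apex a E \<and> {v, a} \<in> apex a E \<and>
    {u, v} \<in> apex a E \<and> {v, u} \<in> apex a E"
proof -
  from e have "u \<in> \<Union>E" "v \<in> \<Union>E" by auto
  then have "{a, u} \<in> apex a E" "{a, v} \<in> apex a E" unfolding apex_def by blast+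
  moreover have "{u, v} \<in> apex a E" using e by (simp add: apex_def)
  ultimately show ?thesis by (simp add: insert_commute)
qed

text \<open>Each step trades at most three edges for a cycle through \<open>a\<close>: for a light
  edge \<open>{u, v}\<close> all edges at \<open>u\<close> or \<open>v\<close> go and the triangle
  on \<open>a\<close>, \<open>u\<close>, \<open>v\<close> is gained; for twin leaves it is the
  4-cycle through \<open>a\<close>, both leaves and their neighbour. The spokes used lead to
  vertices that no longer occur, so later cycles avoid them. The summand 1 is what excludes a
  nonempty triangle-free remainder in the case of equality.\<close>

lemma triangle_free_peel:
  assumes "edge_set E" "a \<notin> \<Union>E" "triangle_free E" "\<not> long_theta E" "E \<noteq> {}"
  shows "\<exists>t. packs (apex a E) t \<and> card E + 1 \<le> 3 * t"
  using assms
proof (induction "card E" arbitrary: E rule: less_induct)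
  case less
  note E = less.prems(1) and aE = less.prems(2) and tf = less.prems(3) and nt = less.prems(4)
  have fin: "finite E" using E by (simp add: edge_set_def)
  have aN: "u \<noteq> a \<and> v \<noteq> a \<and> u \<noteq> v" if "{u, v} \<in> E" for u v
    using that aE edge_set_neq[OF E that] by auto
  \<comment> \<open>\<open>small\<close> concerns the last piece, where the summand 1 is earned: it
    has at most two edges, or its cone holds a second cycle.\<close>
  have step: ?case if E': "E' \<subset> E" "card E \<le> card E' + 3" and c: "cyc (apex a E) c" "apex a E' \<inter> cycle_edges c = {}"
    and small: "E' = {} \<Longrightarrow> card E \<le> 2 \<or> packs (apex a E) 2" for E' c
  proof (cases "E' = {}")
    case True
    show ?thesis
    proof (cases "packs (apex a E) 2")
      case True
      then show ?thesis using \<open>E' = {}\<close> E'(2) by (intro exI[of _ 2]) auto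
    next
      case False
      then have "card E \<le> 2" using small True by blast
      then show ?thesis using packs_Suc[OF c(1) packs_0] by (intro exI[of _ 1]) auto
    qed
  next
    case False
    have "card E' < card E" using E'(1) fin by (rule psubset_card_mono[rotated])
    moreover have "edge_set E'" "a \<notin> \<Union>E'" "triangle_free E'" "\<not> long_theta E'"
      using E E'(1) edge_set_subset aE tf triangle_free_subset nt long_theta_mono by blast+
    ultimately obtain t where t: "packs (apex a E') t" "card E' + 1 \<le> 3 * t" using less.hyps False by blast
    have "packs (apex a E) (Suc t)"
      using packs_insert[OF c(1) t(1) apex_mono c(2)] E'(1) by blast
    then show ?thesis using t(2) E'(2) by (intro exI[of _ "Suc t"]) auto
  qed
  \<comment> \<open>The cone over three edges at \<open>u\<close> holds a triangle on one of them
    and a 4-cycle on the other two.\<close>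
  have star: "packs (apex a E) 2" if u: "{u, v} \<in> E" "{u, x} \<in> E" "{u, y} \<in> E" "distinct [v, x, y]" for u v x y
  proof -
    have d: "a \<noteq> u" "a \<noteq> v" "a \<noteq> x" "a \<noteq> y" "u \<noteq> v" "u \<noteq> x" "u \<noteq> y"
      using aN u by metis+
    have d': "v \<noteq> x" "x \<noteq> v" "v \<noteq> y" "y \<noteq> v" "x \<noteq> y" "y \<noteq> x" "v \<noteq> u" "x \<noteq> u" "y \<noteq> u" using u(4) d by auto
    have "cyc (apex a E) [a, u, v]" "cyc (apex a E - cycle_edges [a, u, v]) [a, x, u, y]"
      using d d' apex_spoke[OF u(1)] apex_spoke[OF u(2)] apex_spoke[OF u(3)]
      by (simp_all add: cyc3 cyc4 cycle_edges3 doubleton_eq_iff)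
    then show ?thesis using packs_Suc[OF _ packs_Suc[OF _ packs_0]] by (metis numeral_2_eq_2)
  qed
  \<comment> \<open>The cone over a path of three edges holds a triangle on each end half. The ends
    \<open>x\<close> and \<open>y\<close> differ because there are no triangles.\<close>
  have path: "packs (apex a E) 2" if u: "{u, v} \<in> E" "{u, x} \<in> E" "{v, y} \<in> E" "x \<noteq> v" "y \<noteq> u" for u v x y
  proof -
    have "x \<noteq> y" using u tf unfolding triangle_free_def by (metis insert_commute)
    have d: "a \<noteq> u" "a \<noteq> v" "a \<noteq> x" "a \<noteq> y" "u \<noteq> v" "u \<noteq> x" "v \<noteq> y"
      using aN u by metis+
    have d': "v \<noteq> x" "x \<noteq> v" "v \<noteq> y" "y \<noteq> v" "x \<noteq> y" "y \<noteq> x" "v \<noteq> u" "x \<noteq> u" "y \<noteq> u" "u \<noteq> y"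
      using u(4,5) d \<open>x \<noteq> y\<close> by auto
    have "cyc (apex a E) [a, x, u]" "cyc (apex a E - cycle_edges [a, x, u]) [a, v, y]"
      using d d' apex_spoke[OF u(1)] apex_spoke[OF u(2)] apex_spoke[OF u(3)]
      by (simp_all add: cyc3 cycle_edges3 doubleton_eq_iff)
    then show ?thesis using packs_Suc[OF _ packs_Suc[OF _ packs_0]] by (metis numeral_2_eq_2)
  qed
  consider u v where "{u, v} \<in> E" "card (nb E u) + card (nb E v) \<le> 4" | u u' w where "u \<noteq> u'" "nb E u = {w}" "nb E u' = {w}"
    using light_edge_or_twin_leaves[OF E tf nt] less.prems(5) by blast
  then show ?case
  proof cases
    case (1 u v)
    have uv: "u \<noteq> v" "u \<noteq> a" "v \<noteq> a" using 1 aN by metis+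
    define E' where "E' = {e \<in> E. u \<notin> e \<and> v \<notin> e}"
    define I where "I = (\<lambda>x. {u, x}) ` nb E u \<union> (\<lambda>x. {v, x}) ` (nb E v - {u})"
    have EI: "E \<subseteq> E' \<union> I"
    proof
      fix e assume e: "e \<in> E"
      consider "u \<in> e" | "v \<in> e" "u \<notin> e" | "e \<in> E'" using e by (auto simp: E'_def)
      then show "e \<in> E' \<union> I"
      proof cases
        case 1 then show ?thesis using incident_subset[OF E e] unfolding I_def by blast
      next
        case 2
        then obtain x where "x \<in> nb E v" "e = {v, x}" using incident_subset[OF E e] by blast
        then show ?thesis using 2 unfolding I_def by blast
      qed simp
    qed
    have "u \<in> nb E v" using 1 by (simp add: nb_def insert_commute)
    then have "card (nb E v - {u}) = card (nb E v) - 1" "card (nb E v) \<ge> 1"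
      using finite_nb[OF E] by (auto simp: Suc_le_eq card_gt_0_iff)
    then have "card I \<le> card (nb E u) + (card (nb E v) - 1)"
      unfolding I_def using order_trans[OF card_Un_le add_mono[OF card_image_le card_image_le]] finite_nb[OF E]
      by (metis (no_types, lifting) finite_Diff)
    \<comment> \<open>The edge \<open>{u, v}\<close> is counted in both degrees, hence three edges
      instead of four.\<close>
    then have I3: "card I \<le> 3" and I4: "card (nb E u) + card (nb E v) \<ge> card I + 1"
      using 1(2) \<open>card (nb E v) \<ge> 1\<close> by linarith+
    have finI: "finite I" unfolding I_def using finite_nb[OF E] by simp
    have cE: "card E \<le> card E' + card I"
      by (rule order_trans[OF card_mono[OF _ EI] card_Un_le]) (use fin finI in \<open>simp add: E'_def\<close>)
    show ?thesis
    proof (rule step[of E' "[a, u, v]"])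
      have "E' \<subseteq> E" "{u, v} \<notin> E'" by (auto simp: E'_def)
      then show "E' \<subset> E" using 1(1) by (metis psubsetI)
      show "card E \<le> card E' + 3" using cE I3 by simp
      show "cyc (apex a E) [a, u, v]" using uv apex_spoke[OF 1(1)] by (simp add: cyc3)
      show "apex a E' \<inter> cycle_edges [a, u, v] = {}"
        using uv unfolding cycle_edges3 by (auto simp: apex_def E'_def doubleton_eq_iff)
      assume "E' = {}"
      show "card E \<le> 2 \<or> packs (apex a E) 2"
      proof (rule ccontr)
        assume neg: "\<not> ?thesis"
        then have cI: "card I \<ge> 3" using cE \<open>E' = {}\<close> by simp
        then have s4: "card (nb E u) + card (nb E v) = 4" using I4 1(2) by simp
        have three: "packs (apex a E) 2" if "nb E v' \<subseteq> {u'}" "card (nb E u') + card (nb E v') = 4" for u' v'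
        proof -
          have "card (nb E v') \<le> 1" using card_mono[OF _ that(1)] by simp
          then have "card (nb E u') \<ge> 3" using that(2) by linarith
          then obtain X where X: "X \<subseteq> nb E u'" "card X = 3" by (meson obtain_subset_with_card_n)
          then obtain x y z where "X = {x, y, z}" "x \<noteq> y" "y \<noteq> z" "x \<noteq> z" by (metis card_3_iff)
          moreover from this X(1) have "x \<in> nb E u'" "y \<in> nb E u'" "z \<in> nb E u'" by simp_all
          ultimately show ?thesis using star[of u' x y z] by (simp add: nb_def)
        qed
        have "\<not> nb E v \<subseteq> {u}" "\<not> nb E u \<subseteq> {v}" using three[of v u] three[of u v] s4 neg by (auto simp: add.commute)
        then obtain x y where "x \<in> nb E u" "x \<noteq> v" "y \<in> nb E v" "y \<noteq> u" by blast
        then have "{u, x} \<in> E" "{v, y} \<in> E" "x \<noteq> v" "y \<noteq> u" by (simp_all add: nb_def)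
        then show False using path[OF 1(1)] neg by blast
      qed
    qed
  next
    case (2 u u' w)
    have e: "{u, w} \<in> E" "{u', w} \<in> E" using 2 by (auto simp: nb_def)
    have d: "u \<noteq> w" "u' \<noteq> w" "u \<noteq> a" "u' \<noteq> a" "w \<noteq> a" using e aN by metis+
    \<comment> \<open>\<open>w\<close> may keep other edges and its spoke: the 4-cycle uses only the
      spokes of the two leaves.\<close>
    define E' where "E' = E - {{u, w}, {u', w}}"
    have un: "u \<notin> \<Union>E'" "u' \<notin> \<Union>E'"
    proof -
      have ww: "e' = {z, w}" if "e' \<in> E" "z \<in> e'" "nb E z = {w}" for e' z
        using incident_subset[OF E that(1,2)] that(3) by (metis singletonD)
      show "u \<notin> \<Union>E'" using ww[of _ u] 2(2) by (auto simp: E'_def)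
      show "u' \<notin> \<Union>E'" using ww[of _ u'] 2(3) by (auto simp: E'_def)
    qed
    have EE: "E = E' \<union> {{u, w}, {u', w}}" using e by (auto simp: E'_def)
    have "card {{u, w}, {u', w}} \<le> 2" by (simp add: card_insert_if)
    then have cE: "card E \<le> card E' + 2" using card_Un_le[of E' "{{u, w}, {u', w}}"] EE by (metis add_le_cancel_left le_trans)
    show ?thesis
    proof (rule step[of E' "[a, u, w, u']"])
      have "E' \<subseteq> E" "{u, w} \<notin> E'" by (auto simp: E'_def)
      then show "E' \<subset> E" using e(1) by (metis psubsetI)
      show "cyc (apex a E) [a, u, w, u']" using d 2(1) apex_spoke[OF e(1)] apex_spoke[OF e(2)] by (simp add: cyc4)
      show "apex a E' \<inter> cycle_edges [a, u, w, u'] = {}"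
        using un d 2(1) unfolding cycle_edges4 by (auto simp: apex_def doubleton_eq_iff)
      show "E' = {} \<Longrightarrow> card E \<le> 2 \<or> packs (apex a E) 2" using cE by simp
    qed (use cE in simp)
  qed
qed

section \<open>Edge-disjoint triangles\<close>

definition tri :: "'a set \<Rightarrow> 'a set set" where
  "tri T = {e. e \<subseteq> T \<and> card e = 2}"

text \<open>Triangles are represented by vertex sets; for distinct ones, sharing at most one vertex
  means having no common edge.\<close>

definition triangle_family :: "'a set set \<Rightarrow> 'a set set \<Rightarrow> bool" where
  "triangle_family E \<T> \<longleftrightarrow> finite \<T> \<and> (\<forall>T\<in>\<T>. card T = 3 \<and> tri T \<subseteq> E) \<and>
     (\<forall>T\<in>\<T>. \<forall>T'\<in>\<T>. T \<noteq> T' \<longrightarrow> card (T \<inter> T') \<le> 1)"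

definition tri_edges :: "'a set set \<Rightarrow> 'a set set" where
  "tri_edges \<T> = (\<Union>T\<in>\<T>. tri T)"

lemma tri_3: "distinct [x, y, z] \<Longrightarrow> tri {x, y, z} = {{x, y}, {y, z}, {z, x}}"
  unfolding tri_def by (auto simp: card_2_iff doubleton_eq_iff)

lemma finite_tri: "finite T \<Longrightarrow> finite (tri T)"
  unfolding tri_def by (auto intro: finite_subset[of _ "Pow T"])

lemma card_tri: "card T = 3 \<Longrightarrow> card (tri T) = 3"
proof -
  assume "card T = 3"
  then have "finite T" by (simp add: card_ge_0_finite)
  then show ?thesis using n_subsets[of T 2] \<open>card T = 3\<close> unfolding tri_def by (simp add: choose_two)
qed

lemma tri_disjoint:
  assumes "finite T" "card (T \<inter> T') \<le> 1" shows "tri T \<inter> tri T' = {}"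
proof (rule ccontr)
  assume "\<not> ?thesis"
  then obtain e where "e \<subseteq> T \<inter> T'" "card e = 2" by (auto simp: tri_def)
  then show False using card_mono[of "T \<inter> T'" e] assms by simp
qed

lemma triangle_family_packs:
  assumes "triangle_family E \<T>" shows "packs (tri_edges \<T>) (card \<T>)"
proof -
  have "finite \<T>" using assms by (simp add: triangle_family_def)
  then show ?thesis using assms
  proof (induction rule: finite_induct)
    case (insert T \<T>)
    have T: "card T = 3" "finite T" using insert.prems by (auto simp: triangle_family_def card_ge_0_finite)
    then obtain x y z where xyz: "T = {x, y, z}" "distinct [x, y, z]" by (auto simp: card_3_iff)
    have "triangle_family E \<T>" using insert.prems by (simp add: triangle_family_def)
    then have IH: "packs (tri_edges \<T>) (card \<T>)" using insert.IH by blast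
    have dis: "tri T \<inter> tri_edges \<T> = {}"
    proof -
      have "tri T \<inter> tri T' = {}" if "T' \<in> \<T>" for T'
      proof (rule tri_disjoint[OF T(2)])
        have "T \<noteq> T'" using insert.hyps that by auto
        then show "card (T \<inter> T') \<le> 1" using insert.prems that unfolding triangle_family_def by simp
      qed
      then show ?thesis unfolding tri_edges_def by blast
    qed
    have tT: "tri T = cycle_edges [x, y, z]" using xyz tri_3[OF xyz(2)] by (simp add: cycle_edges3)
    have eq: "tri_edges (insert T \<T>) = tri T \<union> tri_edges \<T>" by (simp add: tri_edges_def)
    have "packs (tri_edges (insert T \<T>)) (Suc (card \<T>))"
    proof (rule packs_insert[OF _ IH])
      show "cyc (tri_edges (insert T \<T>)) [x, y, z]"
        unfolding cyc3 eq using xyz(2) tT by (auto simp: cycle_edges3)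
      show "tri_edges \<T> \<inter> cycle_edges [x, y, z] = {}" using dis tT by blast
    qed (auto simp: eq)
    then show ?case using insert.hyps by simp
  qed (simp add: packs_0)
qed

lemma card_tri_edges:
  assumes "triangle_family E \<T>" shows "card (tri_edges \<T>) = 3 * card \<T>"
proof -
  have f: "finite T" if "T \<in> \<T>" for T using assms that by (auto simp: triangle_family_def intro: card_ge_0_finite)
  have dis: "\<forall>T\<in>\<T>. \<forall>T'\<in>\<T>. T \<noteq> T' \<longrightarrow> tri T \<inter> tri T' = {}"
    using assms tri_disjoint[OF f] unfolding triangle_family_def by meson
  have "card (tri_edges \<T>) = (\<Sum>T\<in>\<T>. card (tri T))"
    unfolding tri_edges_def
    by (rule card_UN_disjoint[OF _ _ dis]) (use assms f finite_tri in \<open>auto simp: triangle_family_def\<close>)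
  also have "\<dots> = (\<Sum>T\<in>\<T>. 3)" using assms card_tri by (intro sum.cong) (auto simp: triangle_family_def)
  finally show ?thesis by simp
qed

lemma tri_edges_subset: "triangle_family E \<T> \<Longrightarrow> tri_edges \<T> \<subseteq> E"
  unfolding triangle_family_def tri_edges_def by blast

text \<open>The triangles use only edges of \<open>E\<close>, and the peeled cycles only the cone
  over what is left, so both are packed together. A nonempty remainder makes the edge bound strict;
  equality therefore forces the triangles to cover \<open>E\<close>.\<close>

lemma triangle_family_bound:
  assumes E: "edge_set E" "a \<notin> \<Union>E" "\<not> long_theta E" and np: "\<not> packs (apex a E) k"
    and T: "triangle_family E \<T>" and tf: "triangle_free (E - tri_edges \<T>)"
  shows "card E \<le> 3 * (k - 1)" "card E = 3 * (k - 1) \<Longrightarrow> E = tri_edges \<T>"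
proof -
  define E0 where "E0 = E - tri_edges \<T>"
  have fin: "finite E" using E by (simp add: edge_set_def)
  have sub: "tri_edges \<T> \<subseteq> E" using tri_edges_subset[OF T] .
  have cE: "card E = 3 * card \<T> + card E0"
    using card_tri_edges[OF T] card_Diff_subset[of "tri_edges \<T>" E] card_mono[OF fin sub] finite_subset[OF sub fin] sub
    by (simp add: E0_def)
  have lt: "t < k" if "packs (apex a E) t" for t
    using packs_decrease[OF that] np by (meson not_less)
  have "card E \<le> 3 * (k - 1) \<and> (card E = 3 * (k - 1) \<longrightarrow> E = tri_edges \<T>)"
  proof (cases "E0 = {}")
    case True
    have "packs (apex a E) (card \<T>)"
    proof (rule packs_mono[OF triangle_family_packs[OF T]])
      show "tri_edges \<T> \<subseteq> apex a E" using sub by (auto simp: apex_def)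
    qed
    then have "card \<T> < k" by (rule lt)
    then show ?thesis using cE True sub by (auto simp: E0_def)
  next
    case False
    have E0: "edge_set E0" "a \<notin> \<Union>E0" "\<not> long_theta E0"
      using E edge_set_subset[OF E(1)] long_theta_mono[of E0 E] by (auto simp: E0_def)
    obtain t where t: "packs (apex a E0) t" "card E0 + 1 \<le> 3 * t"
      using triangle_free_peel[OF E0(1,2) _ E0(3) False] tf by (auto simp: E0_def)
    have "tri_edges \<T> \<inter> apex a E0 = {}"
      using sub E(2) by (auto simp: apex_def E0_def)
    then have "packs (tri_edges \<T> \<union> apex a E0) (card \<T> + t)"
      using packs_Un[OF triangle_family_packs[OF T] t(1)] by blast
    moreover have "tri_edges \<T> \<union> apex a E0 \<subseteq> apex a E" using sub by (auto simp: apex_def E0_def)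
    ultimately have "card \<T> + t < k" using packs_mono lt by blast
    then have "card E < 3 * (k - 1)" using cE t(2) by linarith
    then show ?thesis by simp
  qed
  then show "card E \<le> 3 * (k - 1)" "card E = 3 * (k - 1) \<Longrightarrow> E = tri_edges \<T>" by auto
qed

lemma maximal_triangle_family:
  assumes E: "edge_set E"
  obtains \<T> where "triangle_family E \<T>" "triangle_free (E - tri_edges \<T>)"
proof -
  have fin: "finite E" using E by (simp add: edge_set_def)
  have bd: "card \<T> \<le> card E" if "triangle_family E \<T>" for \<T>
    using card_mono[OF fin tri_edges_subset[OF that]] card_tri_edges[OF that] by simp
  have "triangle_family E {}" by (simp add: triangle_family_def)
  then obtain \<T> where T: "triangle_family E \<T>" and max: "\<And>\<T>'. triangle_family E \<T>' \<Longrightarrow> card \<T>' \<le> card \<T>"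
  proof -
    have "\<forall>\<T>. triangle_family E \<T> \<longrightarrow> card \<T> < Suc (card E)" using bd by (simp add: less_Suc_eq_le)
    from ex_has_greatest_nat[OF \<open>triangle_family E {}\<close> this] show thesis using that by blast
  qed
  have "triangle_free (E - tri_edges \<T>)"
    unfolding triangle_free_def
  proof
    assume "\<exists>u v w. {u, v} \<in> E - tri_edges \<T> \<and> {v, w} \<in> E - tri_edges \<T> \<and> {u, w} \<in> E - tri_edges \<T>"
    then obtain u v w where uvw: "{u, v} \<in> E - tri_edges \<T>" "{v, w} \<in> E - tri_edges \<T>" "{u, w} \<in> E - tri_edges \<T>" by blast
    then have d: "distinct [u, v, w]" using edge_set_neq[OF E] by auto
    let ?N = "{u, v, w}"
    have tN: "tri ?N = {{u, v}, {v, w}, {w, u}}" by (rule tri_3[OF d])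
    have tN': "tri ?N \<subseteq> E" "tri ?N \<inter> tri_edges \<T> = {}" using uvw unfolding tN by (auto simp: insert_commute)
    have small: "card (?N \<inter> T) \<le> 1" if "T \<in> \<T>" for T
    proof (rule ccontr)
      assume "\<not> ?thesis"
      then have "2 \<le> card (?N \<inter> T)" by simp
      then obtain e where "e \<subseteq> ?N \<inter> T" "card e = 2" by (meson obtain_subset_with_card_n)
      then have "e \<in> tri ?N \<inter> tri T" by (auto simp: tri_def)
      then show False using tN'(2) that by (auto simp: tri_edges_def)
    qed
    have nin: "?N \<notin> \<T>" using small[of ?N] d by auto
    have "triangle_family E (insert ?N \<T>)"
      using T tN'(1) small d unfolding triangle_family_def by (auto simp: Int_commute)
    then have "card (insert ?N \<T>) \<le> card \<T>" by (rule max)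
    then show False using nin T by (simp add: triangle_family_def)
  qed
  then show thesis using that T by blast
qed

section \<open>Degrees in a graph decomposed into triangles\<close>

lemma triangle_family_nb:
  assumes T: "triangle_family E \<T>" and cov: "E = tri_edges \<T>"
  shows "card (nb E v) = 2 * card {T \<in> \<T>. v \<in> T}"
proof -
  have T3: "card T = 3" "finite T" if "T \<in> \<T>" for T
    using T that by (auto simp: triangle_family_def card_ge_0_finite)
  have fin: "finite \<T>" using T by (simp add: triangle_family_def)
  have mem: "{v, u} \<in> tri T \<longleftrightarrow> v \<in> T \<and> u \<in> T - {v}" for u T
    unfolding tri_def by (auto simp: card_insert_if)
  have "nb E v = (\<Union>T\<in>{T \<in> \<T>. v \<in> T}. T - {v})"
    unfolding nb_def cov tri_edges_def using mem by auto
  also have "card \<dots> = (\<Sum>T\<in>{T \<in> \<T>. v \<in> T}. card (T - {v}))"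
  proof (rule card_UN_disjoint)
    show "\<forall>T\<in>{T \<in> \<T>. v \<in> T}. \<forall>T'\<in>{T \<in> \<T>. v \<in> T}. T \<noteq> T' \<longrightarrow> (T - {v}) \<inter> (T' - {v}) = {}"
    proof (intro ballI impI, rule ccontr)
      fix T T' assume TT: "T \<in> {T \<in> \<T>. v \<in> T}" "T' \<in> {T \<in> \<T>. v \<in> T}" "T \<noteq> T'" "(T - {v}) \<inter> (T' - {v}) \<noteq> {}"
      then obtain u where u: "{u, v} \<subseteq> T \<inter> T'" "u \<noteq> v" by auto
      have "card {u, v} \<le> card (T \<inter> T')" using u(1) T3 TT by (intro card_mono) auto
      moreover have "card (T \<inter> T') \<le> 1" using T TT unfolding triangle_family_def by simp
      ultimately show False using u(2) by simp
    qed
  qed (use fin T3 in auto)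
  also have "\<dots> = (\<Sum>T\<in>{T \<in> \<T>. v \<in> T}. 2)"
    using T3 by (intro sum.cong) auto
  finally show ?thesis by simp
qed

lemma sum_incidence_squares:
  fixes \<T> :: "'a set set"
  assumes "finite \<T>" "finite V" "\<Union>\<T> \<subseteq> V"
  shows "(\<Sum>v\<in>V. (card {T \<in> \<T>. v \<in> T})\<^sup>2) = (\<Sum>T\<in>\<T>. \<Sum>T'\<in>\<T>. card (T \<inter> T'))"
proof -
  define f :: "'a set \<Rightarrow> 'a \<Rightarrow> nat" where "f = (\<lambda>T v. if v \<in> T then 1 else 0 :: nat)"
  have "card {T \<in> \<T>. v \<in> T} = (\<Sum>T\<in>\<T>. f T v)" for v :: 'a
    unfolding f_def using assms(1) by (simp add: sum.If_cases Int_def conj_commute)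
  then have "(\<Sum>v\<in>V. (card {T \<in> \<T>. v \<in> T})\<^sup>2) = (\<Sum>v\<in>V. \<Sum>T\<in>\<T>. \<Sum>T'\<in>\<T>. f T v * f T' v)"
    by (simp add: power2_eq_square sum_product)
  also have "\<dots> = (\<Sum>T\<in>\<T>. \<Sum>v\<in>V. \<Sum>T'\<in>\<T>. f T v * f T' v)" by (rule sum.swap)
  also have "\<dots> = (\<Sum>T\<in>\<T>. \<Sum>T'\<in>\<T>. \<Sum>v\<in>V. f T v * f T' v)" by (intro sum.cong refl sum.swap)
  also have "\<dots> = (\<Sum>T\<in>\<T>. \<Sum>T'\<in>\<T>. card (T \<inter> T'))"
  proof (intro sum.cong refl)
    fix T T' assume "T \<in> \<T>" "T' \<in> \<T>"
    then have "V \<inter> {v \<in> T. v \<in> T'} = T \<inter> T'" using assms(3) by blast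
    moreover have "(\<Sum>v\<in>V. f T v * f T' v) = (\<Sum>v\<in>V. if v \<in> T \<inter> T' then 1 else 0)"
      by (intro sum.cong) (auto simp: f_def)
    ultimately show "(\<Sum>v\<in>V. f T v * f T' v) = card (T \<inter> T')"
      using assms(2) by (simp add: sum.If_cases)
  qed
  finally show ?thesis .
qed

text \<open>Without a common vertex, three of the triangles meet pairwise in distinct points
  \<open>x\<close>, \<open>y\<close>, \<open>z\<close>, and these span a further triangle with one
  edge from each. Exchanging the three for it leaves six edges, all between \<open>{x, y, z}\<close>
  and other vertices, hence a bipartite remainder. By \<open>rigid\<close> the new family would
  cover \<open>E\<close>, but it misses \<open>{x, p}\<close>.\<close>

lemma pairwise_meeting_triangles:
  assumes E: "edge_set E" and T: "triangle_family E \<T>" and cov: "E = tri_edges \<T>"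
    and rigid: "\<And>\<T>'. triangle_family E \<T>' \<Longrightarrow> triangle_free (E - tri_edges \<T>') \<Longrightarrow> E = tri_edges \<T>'"
    and meet: "\<And>T T'. T \<in> \<T> \<Longrightarrow> T' \<in> \<T> \<Longrightarrow> T \<inter> T' \<noteq> {}"
  shows "\<exists>b. \<forall>T\<in>\<T>. b \<in> T"
proof (cases "\<exists>T1\<in>\<T>. \<exists>T2\<in>\<T>. T1 \<noteq> T2")
  case False
  show ?thesis
  proof (cases "\<T> = {}")
    case False
    then obtain T1 where T1: "T1 \<in> \<T>" by blast
    then obtain b where "b \<in> T1" using meet[of T1 T1] by blast
    then show ?thesis using \<open>\<not> (\<exists>T1\<in>\<T>. \<exists>T2\<in>\<T>. T1 \<noteq> T2)\<close> T1 by blast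
  qed simp
next
  case True
  then obtain T1 T2 where T12: "T1 \<in> \<T>" "T2 \<in> \<T>" "T1 \<noteq> T2" by blast
  have T3: "card T = 3" "finite T" if "T \<in> \<T>" for T
    using T that by (auto simp: triangle_family_def card_ge_0_finite)
  have single: "\<exists>y. T \<inter> T' = {y}" if "T \<in> \<T>" "T' \<in> \<T>" "T \<noteq> T'" for T T'
  proof -
    have "card (T \<inter> T') \<le> 1" using T that unfolding triangle_family_def by simp
    moreover have "card (T \<inter> T') \<noteq> 0" using meet[OF that(1,2)] T3(2)[OF that(1)] by simp
    ultimately show ?thesis by (metis One_nat_def card_1_singletonE le_SucE le_zero_eq)
  qed
  have share: "T = T'" if "T \<in> \<T>" "T' \<in> \<T>" "u \<in> T" "v \<in> T" "u \<in> T'" "v \<in> T'" "u \<noteq> v" for T T' u v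
  proof (rule ccontr)
    assume "T \<noteq> T'"
    from single[OF that(1,2) this] obtain y where "T \<inter> T' = {y}" by blast
    then have "u = y" "v = y" using that by auto
    then show False using that(7) by simp
  qed
  obtain y where y: "T1 \<inter> T2 = {y}" using single T12 by blast
  show ?thesis
  proof (rule ccontr)
    assume "\<not> ?thesis"
    then obtain U where U: "U \<in> \<T>" "y \<notin> U" by blast
    have UT: "U \<noteq> T1" "U \<noteq> T2" using U y by auto
    obtain x where x: "T1 \<inter> U = {x}" using single T12 U UT by metis
    obtain z where z: "T2 \<inter> U = {z}" using single T12 U UT by metis
    have mem: "x \<in> T1" "y \<in> T1" "y \<in> T2" "z \<in> T2" "x \<in> U" "z \<in> U" using x y z by auto
    have nmem: "z \<notin> T1" "x \<notin> T2"
    proof -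
      have "z = y" if "z \<in> T1" using y mem that by auto
      then show "z \<notin> T1" using U mem by auto
      have "x = y" if "x \<in> T2" using y mem that by auto
      then show "x \<notin> T2" using U mem by auto
    qed
    have d: "x \<noteq> y" "y \<noteq> z" "x \<noteq> z" using mem nmem U by auto
    let ?N = "{x, y, z}"
    have third: "\<exists>p. T = {u, v, p} \<and> p \<notin> {u, v}" if "T \<in> \<T>" "u \<in> T" "v \<in> T" "u \<noteq> v" for T u v
    proof -
      have "card (T - {u, v}) = 1" using T3[OF that(1)] that by (simp add: card_Diff_subset)
      then obtain p where "T - {u, v} = {p}" by (rule card_1_singletonE)
      then have "T = {u, v, p}" "p \<notin> {u, v}" using that by auto
      then show ?thesis by blast
    qed
    obtain p where p: "T1 = {x, y, p}" "p \<notin> {x, y}" using third[of T1 x y] T12 mem d by blast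
    obtain q where q: "T2 = {y, z, q}" "q \<notin> {y, z}" using third[of T2 y z] T12 mem d by blast
    obtain r where r: "U = {x, z, r}" "r \<notin> {x, z}" using third[of U x z] U mem d by blast
    have pN: "p \<notin> ?N" "q \<notin> ?N" "r \<notin> ?N" using p q r nmem U by auto
    define \<T>' where "\<T>' = insert ?N (\<T> - {T1, T2, U})"
    have NE: "tri ?N \<subseteq> E"
    proof -
      have t: "{u, v} \<in> E" if "T \<in> \<T>" "u \<in> T" "v \<in> T" "u \<noteq> v" for T u v
      proof -
        have "{u, v} \<in> tri T" using that by (simp add: tri_def card_insert_if)
        then show ?thesis using T that(1) unfolding triangle_family_def by blast
      qed
      have "{x, y} \<in> E" "{y, z} \<in> E" "{z, x} \<in> E"
        using t[OF T12(1) mem(1,2) d(1)] t[OF T12(2) mem(3,4) d(2)] t[OF U(1) mem(6,5)] d by simp_all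
      then show ?thesis using tri_3[of x y z] d by simp
    qed
    have small: "card (?N \<inter> T) \<le> 1" if "T \<in> \<T> - {T1, T2, U}" for T
    proof -
      have "\<not> (u \<in> T \<and> v \<in> T)" if "S \<in> {T1, T2, U}" "u \<in> S" "v \<in> S" "u \<noteq> v" for S u v
      proof
        assume uv: "u \<in> T \<and> v \<in> T"
        have "S \<in> \<T>" "T \<in> \<T>" "T \<noteq> S" using that(1) \<open>T \<in> \<T> - {T1, T2, U}\<close> T12 U by auto
        then show False using share[of T S u v] uv that(2-4) by simp
      qed
      from this[of T1 x y] this[of T2 y z] this[of U x z] have "\<not> (x \<in> T \<and> y \<in> T)" "\<not> (y \<in> T \<and> z \<in> T)" "\<not> (x \<in> T \<and> z \<in> T)"
        using mem d by simp_all
      then have "?N \<inter> T \<subseteq> {if x \<in> T then x else if y \<in> T then y else z}" by auto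
      then have "card (?N \<inter> T) \<le> card {if x \<in> T then x else if y \<in> T then y else z}" by (intro card_mono) auto
      then show ?thesis by simp
    qed
    have fam: "triangle_family E \<T>'"
      using T NE small d unfolding triangle_family_def \<T>'_def by (auto simp: Int_commute)
    have part: "(u \<in> ?N) \<noteq> (v \<in> ?N)" if uv: "{u, v} \<in> E - tri_edges \<T>'" for u v
    proof -
      obtain S where S: "S \<in> \<T>" "{u, v} \<in> tri S" using uv cov by (auto simp: tri_edges_def)
      have "S \<in> {T1, T2, U}" using uv S by (auto simp: \<T>'_def tri_edges_def)
      moreover have neN: "{u, v} \<notin> tri ?N" using uv by (auto simp: \<T>'_def tri_edges_def)
      moreover have uv': "u \<in> S" "v \<in> S" "u \<noteq> v" using S(2) by (auto simp: tri_def card_insert_if split: if_splits)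
      moreover have "\<not> (u \<in> ?N \<and> v \<in> ?N)" using neN uv'(3) by (auto simp: tri_def)
      ultimately show ?thesis using p q r pN by auto
    qed
    have "triangle_free (E - tri_edges \<T>')"
      unfolding triangle_free_def using part by metis
    then have eq: "E = tri_edges \<T>'" using rigid fam by blast
    have "{x, p} \<in> tri T1" using p by (auto simp: tri_def card_insert_if)
    then have "{x, p} \<in> E" using cov T12 by (auto simp: tri_edges_def)
    then obtain S where S: "S \<in> \<T>'" "{x, p} \<in> tri S" using eq by (auto simp: tri_edges_def)
    then have "x \<in> S" "p \<in> S" by (auto simp: tri_def)
    then have "S \<in> \<T> - {T1, T2, U}" using S(1) pN by (auto simp: \<T>'_def)
    then show False using share[of S T1 x p] \<open>x \<in> S\<close> \<open>p \<in> S\<close> p T12 by auto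
  qed
qed

text \<open>The number \<open>4 * t\<^sup>2 + 8 * t\<close> is the sum of squared degrees in the
  friendship graph with t triangles. A degree is twice the number of triangles at the vertex, so the
  sum is four times the sum of \<open>card (T \<inter> T')\<close> over ordered pairs, where each
  row is at most \<open>3 + (t - 1)\<close>. A disjoint pair lowers two rows by one each, hence
  8.\<close>

lemma triangle_structure:
  assumes E: "edge_set E" and T: "triangle_family E \<T>" and cov: "E = tri_edges \<T>"
    and rigid: "\<And>\<T>'. triangle_family E \<T>' \<Longrightarrow> triangle_free (E - tri_edges \<T>') \<Longrightarrow> E = tri_edges \<T>'"
    and V: "finite V" "\<Union>E \<subseteq> V"
  shows "(\<exists>b. \<forall>T\<in>\<T>. b \<in> T) \<or> (\<Sum>v\<in>V. (card (nb E v))\<^sup>2) + 8 \<le> 4 * (card \<T>)\<^sup>2 + 8 * card \<T>"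
proof (cases "\<forall>T\<in>\<T>. \<forall>T'\<in>\<T>. T \<inter> T' \<noteq> {}")
  case True
  then show ?thesis using pairwise_meeting_triangles[OF E T cov rigid] by blast
next
  case False
  then obtain A B where AB: "A \<in> \<T>" "B \<in> \<T>" "A \<inter> B = {}" by blast
  have fin: "finite \<T>" using T by (simp add: triangle_family_def)
  have T3: "card T = 3" "finite T" if "T \<in> \<T>" for T
    using T that by (auto simp: triangle_family_def card_ge_0_finite)
  have ne: "A \<noteq> B" using AB T3[OF AB(1)] by auto
  have "\<Union>\<T> \<subseteq> V"
  proof
    fix v assume "v \<in> \<Union>\<T>"
    then obtain T where T': "T \<in> \<T>" "v \<in> T" by blast
    then have "card (T - {v}) = 2" using T3 by simp
    then have "T - {v} \<noteq> {}" by (metis card.empty zero_neq_numeral)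
    then obtain u where "u \<in> T - {v}" by blast
    then have "{v, u} \<in> tri T" using T' by (auto simp: tri_def card_insert_if)
    then have "{v, u} \<in> E" using cov T' by (auto simp: tri_edges_def)
    then show "v \<in> V" using V by auto
  qed
  then have S: "(\<Sum>v\<in>V. (card {T \<in> \<T>. v \<in> T})\<^sup>2) = (\<Sum>T\<in>\<T>. \<Sum>T'\<in>\<T>. card (T \<inter> T'))"
    by (rule sum_incidence_squares[OF fin V(1)])
  have row: "(\<Sum>T'\<in>\<T>. card (T \<inter> T')) + (if T \<in> {A, B} then 1 else 0) \<le> card \<T> + 2" if TT: "T \<in> \<T>" for T
  proof -
    have le1: "card (T \<inter> T') \<le> 1" if "T' \<in> \<T> - {T}" for T' using T TT that unfolding triangle_family_def by auto
    have eq: "(\<Sum>T'\<in>\<T>. card (T \<inter> T')) = 3 + (\<Sum>T'\<in>\<T> - {T}. card (T \<inter> T'))"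
      using sum.remove[OF fin TT, of "\<lambda>T'. card (T \<inter> T')"] T3[OF TT] by simp
    have c1: "card (\<T> - {T}) + 1 = card \<T>" using fin TT by (metis Suc_eq_plus1 card_Suc_Diff1)
    show ?thesis
    proof (cases "T \<in> {A, B}")
      case False
      have "(\<Sum>T'\<in>\<T> - {T}. card (T \<inter> T')) \<le> (\<Sum>T'\<in>\<T> - {T}. 1)" by (rule sum_mono) (rule le1)
      then show ?thesis using False eq c1 by simp
    next
      case True
      define C where "C = (if T = A then B else A)"
      have C: "C \<in> \<T> - {T}" "T \<inter> C = {}" using True AB ne by (auto simp: C_def)
      have "(\<Sum>T'\<in>\<T> - {T}. card (T \<inter> T')) = card (T \<inter> C) + (\<Sum>T'\<in>\<T> - {T} - {C}. card (T \<inter> T'))"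
        using sum.remove[OF _ C(1), of "\<lambda>T'. card (T \<inter> T')"] fin by simp
      also have "\<dots> = (\<Sum>T'\<in>\<T> - {T} - {C}. card (T \<inter> T'))" using C(2) by simp
      also have "\<dots> \<le> (\<Sum>T'\<in>\<T> - {T} - {C}. 1)" by (rule sum_mono) (use le1 in blast)
      also have "\<dots> = card (\<T> - {T} - {C})" by simp
      finally have "(\<Sum>T'\<in>\<T> - {T}. card (T \<inter> T')) \<le> card (\<T> - {T} - {C})" .
      moreover have "Suc (card (\<T> - {T} - {C})) = card (\<T> - {T})"
        using card_Suc_Diff1[of "\<T> - {T}" C] C(1) fin by simp
      ultimately show ?thesis using True eq c1 by simp
    qed
  qed
  have "(\<Sum>T\<in>\<T>. (\<Sum>T'\<in>\<T>. card (T \<inter> T')) + (if T \<in> {A, B} then 1 else 0)) \<le> (\<Sum>T\<in>\<T>. card \<T> + 2)"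
    by (rule sum_mono) (rule row)
  moreover have "(\<Sum>T\<in>\<T>. if T \<in> {A, B} then 1 else 0 :: nat) = 2"
  proof -
    have "\<T> \<inter> {T. T = A \<or> T = B} = {A, B}" using AB by auto
    then show ?thesis using fin ne by (simp add: sum.If_cases)
  qed
  ultimately have "(\<Sum>T\<in>\<T>. \<Sum>T'\<in>\<T>. card (T \<inter> T')) + 2 \<le> card \<T> * (card \<T> + 2)"
    by (simp add: sum.distrib)
  moreover have "(\<Sum>v\<in>V. (card (nb E v))\<^sup>2) = 4 * (\<Sum>v\<in>V. (card {T \<in> \<T>. v \<in> T})\<^sup>2)"
    unfolding triangle_family_nb[OF T cov] by (simp add: power_mult_distrib sum_distrib_left)
  ultimately have "(\<Sum>v\<in>V. (card (nb E v))\<^sup>2) + 8 \<le> 4 * (card \<T> * (card \<T> + 2))" using S by linarith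
  then show ?thesis by (simp add: power2_eq_square algebra_simps)
qed

section \<open>Perron vectors\<close>

text \<open>\<open>spectral_radius\<close> is a \<open>Max\<close> and needs a finite set. Unit
  eigenvectors of different eigenvalues are orthonormal; Bessel's inequality for each coordinate
  vector, summed over \<open>V\<close>, bounds their number by \<open>card V\<close>.\<close>

lemma finite_symmetric_eigenvalues:
  fixes A :: "'a \<Rightarrow> 'a \<Rightarrow> real"
  assumes fin: "finite V" and sym: "\<And>u v. A u v = A v u"
  shows "finite {mu. \<exists>x. (\<exists>v\<in>V. x v \<noteq> 0) \<and> (\<forall>u\<in>V. (\<Sum>v\<in>V. A u v * x v) = mu * x u)}" (is "finite ?S")
proof -
  define P where "P = (\<lambda>mu x. (\<Sum>v\<in>V. x v * x v) = 1 \<and> (\<forall>u\<in>V. (\<Sum>v\<in>V. A u v * x v) = mu * x u))"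
  have ex: "\<exists>x. P mu x" if mu: "mu \<in> ?S" for mu
  proof -
    obtain x v where x: "v \<in> V" "x v \<noteq> 0" "\<forall>u\<in>V. (\<Sum>v\<in>V. A u v * x v) = mu * x u" using mu by blast
    define s where "s = (\<Sum>v\<in>V. x v * x v)"
    have "0 < (x v)\<^sup>2" using x(2) by simp
    then have "0 < x v * x v" by (simp add: power2_eq_square)
    also have "\<dots> \<le> s" unfolding s_def using fin x(1) by (intro member_le_sum) auto
    finally have s: "s > 0" .
    define y where "y = (\<lambda>v. x v / sqrt s)"
    have "(\<Sum>v\<in>V. y v * y v) = (\<Sum>v\<in>V. x v * x v) / s"
      using s by (simp add: y_def sum_divide_distrib)
    then have "(\<Sum>v\<in>V. y v * y v) = 1" using s by (simp add: s_def)
    moreover have "(\<Sum>v\<in>V. A u v * y v) = mu * y u" if "u \<in> V" for u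
      using x(3) that by (simp add: y_def sum_divide_distrib[symmetric])
    ultimately show ?thesis unfolding P_def by blast
  qed
  define X where "X = (\<lambda>mu. SOME x. P mu x)"
  have X: "P mu (X mu)" if "mu \<in> ?S" for mu unfolding X_def using ex[OF that] by (rule someI_ex)
  have orth: "(\<Sum>v\<in>V. X mu v * X nu v) = 0" if "mu \<in> ?S" "nu \<in> ?S" "mu \<noteq> nu" for mu nu
  proof -
    have "mu * (\<Sum>u\<in>V. X mu u * X nu u) = (\<Sum>u\<in>V. (\<Sum>v\<in>V. A u v * X mu v) * X nu u)"
      using X[OF that(1)] by (simp add: P_def sum_distrib_left mult.assoc)
    also have "\<dots> = (\<Sum>u\<in>V. \<Sum>v\<in>V. A u v * X mu v * X nu u)" by (simp add: sum_distrib_right)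
    also have "\<dots> = (\<Sum>v\<in>V. \<Sum>u\<in>V. A u v * X mu v * X nu u)" by (rule sum.swap)
    also have "\<dots> = (\<Sum>v\<in>V. X mu v * (\<Sum>u\<in>V. A v u * X nu u))"
      by (simp add: sum_distrib_left sym mult_ac)
    also have "\<dots> = nu * (\<Sum>u\<in>V. X mu u * X nu u)"
      using X[OF that(2)] by (simp add: P_def sum_distrib_left mult_ac)
    finally have "(mu - nu) * (\<Sum>u\<in>V. X mu u * X nu u) = 0" by (simp add: algebra_simps)
    then show ?thesis using that(3) by simp
  qed
  have "card S \<le> card V" if S: "S \<subseteq> ?S" "finite S" for S
  proof -
    have gram: "(\<Sum>v\<in>V. X mu v * X nu v) = (if mu = nu then 1 else 0)" if "mu \<in> S" "nu \<in> S" for mu nu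
    proof -
      have "mu \<in> ?S" "nu \<in> ?S" using that S(1) by blast+
      then show ?thesis using orth[of mu nu] X[of mu] unfolding P_def by (cases "mu = nu") simp_all
    qed
    have bessel: "(\<Sum>mu\<in>S. (X mu w)\<^sup>2) \<le> 1" if w: "w \<in> V" for w
    proof -
      define b where "b = (\<Sum>mu\<in>S. (X mu w)\<^sup>2)"
      define p where "p = (\<lambda>v. \<Sum>mu\<in>S. X mu w * X mu v)"
      have pw: "p w = b" by (simp add: p_def b_def power2_eq_square)
      have "(\<Sum>v\<in>V. (p v)\<^sup>2) = (\<Sum>v\<in>V. \<Sum>mu\<in>S. \<Sum>nu\<in>S. X mu w * X nu w * (X mu v * X nu v))"
        by (simp add: p_def power2_eq_square sum_product mult_ac)
      also have "\<dots> = (\<Sum>mu\<in>S. \<Sum>v\<in>V. \<Sum>nu\<in>S. X mu w * X nu w * (X mu v * X nu v))" by (rule sum.swap)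
      also have "\<dots> = (\<Sum>mu\<in>S. \<Sum>nu\<in>S. \<Sum>v\<in>V. X mu w * X nu w * (X mu v * X nu v))" by (intro sum.cong refl sum.swap)
      also have "\<dots> = (\<Sum>mu\<in>S. \<Sum>nu\<in>S. X mu w * X nu w * (\<Sum>v\<in>V. X mu v * X nu v))" by (simp add: sum_distrib_left)
      also have "\<dots> = (\<Sum>mu\<in>S. \<Sum>nu\<in>S. if mu = nu then X mu w * X nu w else 0)"
        by (intro sum.cong refl) (simp add: gram)
      also have "\<dots> = b" using S(2) by (simp add: b_def power2_eq_square)
      finally have pp: "(\<Sum>v\<in>V. (p v)\<^sup>2) = b" .
      \<comment> \<open>The squared distance of the coordinate vector at \<open>w\<close> from its
        projection \<open>p\<close>.\<close>
      have "0 \<le> (\<Sum>v\<in>V. ((if v = w then 1 else 0) - p v)\<^sup>2)" by (intro sum_nonneg) auto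
      also have "\<dots> = (\<Sum>v\<in>V. (if v = w then 1 - 2 * p v else 0) + (p v)\<^sup>2)"
        by (intro sum.cong) (auto simp: power2_eq_square algebra_simps)
      also have "\<dots> = 1 - 2 * p w + (\<Sum>v\<in>V. (p v)\<^sup>2)" using fin w by (simp add: sum.distrib)
      finally show ?thesis using pw pp by (simp add: b_def)
    qed
    have "real (card S) = (\<Sum>mu\<in>S. \<Sum>w\<in>V. (X mu w)\<^sup>2)"
      using gram by (simp add: power2_eq_square)
    also have "\<dots> = (\<Sum>w\<in>V. \<Sum>mu\<in>S. (X mu w)\<^sup>2)" by (rule sum.swap)
    also have "\<dots> \<le> (\<Sum>w\<in>V. 1)" by (intro sum_mono bessel)
    finally show ?thesis by simp
  qed
  then show ?thesis using finite_if_finite_subsets_card_bdd by blast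
qed

lemma symmetric_form_maximizer:
  fixes A :: "'a \<Rightarrow> 'a \<Rightarrow> real"
  assumes fin: "finite V" "V \<noteq> {}"
  obtains x where "(\<Sum>v\<in>V. (x v)\<^sup>2) = 1"
    "\<And>y. (\<Sum>v\<in>V. (y v)\<^sup>2) = 1 \<Longrightarrow> (\<Sum>u\<in>V. \<Sum>v\<in>V. A u v * y u * y v) \<le> (\<Sum>u\<in>V. \<Sum>v\<in>V. A u v * x u * x v)"
proof -
  \<comment> \<open>Entries outside \<open>V\<close> are frozen at 0, so the cube is a product of
    compact sets over the whole type and Tychonoff's theorem applies to an infinite type as
    well.\<close>
  define C where "C = PiE UNIV (\<lambda>v. if v \<in> V then {-1..1::real} else {0})"
  have "compactin (product_topology (\<lambda>v. euclidean) UNIV) C"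
    unfolding C_def compactin_PiE by auto
  then have "compact C" by (simp add: euclidean_product_topology)
  define B where "B = C \<inter> {x. (\<Sum>v\<in>V. (x v)\<^sup>2) = 1}"
  have cont: "continuous_on UNIV (\<lambda>x :: 'a \<Rightarrow> real. x v)" for v
    by (rule continuous_on_product_coordinates)
  have "closed {x :: 'a \<Rightarrow> real. (\<Sum>v\<in>V. (x v)\<^sup>2) = 1}"
    by (intro closed_Collect_eq continuous_intros cont)
  then have B: "compact B" unfolding B_def using \<open>compact C\<close> by (rule compact_Int_closed[rotated])
  obtain v0 where v0: "v0 \<in> V" using fin by blast
  have "(\<Sum>v\<in>V. (if v = v0 then 1 else 0 :: real)\<^sup>2) = (\<Sum>v\<in>V. if v = v0 then 1 else 0)"
    by (intro sum.cong) auto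
  then have "(\<Sum>v\<in>V. (if v = v0 then 1 else 0 :: real)\<^sup>2) = 1" using v0 fin by simp
  moreover have "(\<lambda>v. if v = v0 then 1 else 0) \<in> C" using v0 by (auto simp: C_def)
  ultimately have "(\<lambda>v. if v = v0 then 1 else 0) \<in> B" by (simp add: B_def)
  then have Bne: "B \<noteq> {}" by blast
  have "continuous_on B (\<lambda>x. \<Sum>u\<in>V. \<Sum>v\<in>V. A u v * x u * x v)"
    by (intro continuous_intros continuous_on_subset[OF cont]) auto
  then obtain x where x: "x \<in> B" "\<forall>y\<in>B. (\<Sum>u\<in>V. \<Sum>v\<in>V. A u v * y u * y v) \<le> (\<Sum>u\<in>V. \<Sum>v\<in>V. A u v * x u * x v)"
    using continuous_attains_sup[OF B Bne] by blast
  show thesis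
  proof (rule that)
    show "(\<Sum>v\<in>V. (x v)\<^sup>2) = 1" using x(1) by (simp add: B_def)
    fix y :: "'a \<Rightarrow> real" assume y: "(\<Sum>v\<in>V. (y v)\<^sup>2) = 1"
    define y' where "y' = (\<lambda>v. if v \<in> V then y v else 0)"
    have "-1 \<le> y v \<and> y v \<le> 1" if "v \<in> V" for v
    proof -
      have "(y v)\<^sup>2 \<le> (\<Sum>v\<in>V. (y v)\<^sup>2)" using fin that by (intro member_le_sum) auto
      then have "\<bar>y v\<bar> \<le> 1" using y by (simp add: abs_square_le_1)
      then show ?thesis by linarith
    qed
    then have "y' \<in> B" using y by (auto simp: B_def C_def y'_def)
    then have "(\<Sum>u\<in>V. \<Sum>v\<in>V. A u v * y' u * y' v) \<le> (\<Sum>u\<in>V. \<Sum>v\<in>V. A u v * x u * x v)" using x(2) by blast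
    then show "(\<Sum>u\<in>V. \<Sum>v\<in>V. A u v * y u * y v) \<le> (\<Sum>u\<in>V. \<Sum>v\<in>V. A u v * x u * x v)"
      by (simp add: y'_def)
  qed
qed

lemma linear_term_vanishes:
  fixes p q :: real
  assumes "\<And>t. 0 \<le> 2 * t * p + t\<^sup>2 * q"
  shows "p = 0"
proof (rule ccontr)
  assume p: "p \<noteq> 0"
  define s where "s = \<bar>q\<bar> + 1"
  have s: "s > 0" "q \<le> s" by (auto simp: s_def)
  have "0 \<le> 2 * (- p / s) * p + (- p / s)\<^sup>2 * q" by (rule assms)
  also have "\<dots> = (p\<^sup>2 / s) * (q / s - 2)" using s by (simp add: field_simps power2_eq_square)
  finally have "q / s \<ge> 2" using p s by (simp add: zero_le_mult_iff zero_le_divide_iff)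
  then show False using s by (simp add: field_simps)
qed

text \<open>Absolute values keep the norm and do not decrease the form, so the maximizer may be
  taken nonnegative. Its eigenvalue equation at \<open>u\<close> is the vanishing of the first-order
  term when only the entry at \<open>u\<close> is varied.\<close>

lemma nonneg_symmetric_top_eigenvector:
  fixes A :: "'a \<Rightarrow> 'a \<Rightarrow> real"
  assumes fin: "finite V" "V \<noteq> {}" and sym: "\<And>u v. A u v = A v u" and nn: "\<And>u v. 0 \<le> A u v"
  obtains x lam where "\<And>v. 0 \<le> x v" "\<exists>v\<in>V. x v \<noteq> 0" "\<And>u. u \<in> V \<Longrightarrow> (\<Sum>v\<in>V. A u v * x v) = lam * x u"
    "\<And>y. (\<Sum>u\<in>V. \<Sum>v\<in>V. A u v * y u * y v) \<le> lam * (\<Sum>v\<in>V. (y v)\<^sup>2)"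
proof -
  obtain x where x: "(\<Sum>v\<in>V. (x v)\<^sup>2) = 1"
    "\<And>y. (\<Sum>v\<in>V. (y v)\<^sup>2) = 1 \<Longrightarrow> (\<Sum>u\<in>V. \<Sum>v\<in>V. A u v * y u * y v) \<le> (\<Sum>u\<in>V. \<Sum>v\<in>V. A u v * x u * x v)"
    using symmetric_form_maximizer[OF fin, of A] by blast
  define z where "z = (\<lambda>v. \<bar>x v\<bar>)"
  define q where "q = (\<lambda>y. \<Sum>u\<in>V. \<Sum>v\<in>V. A u v * y u * y v)"
  define lam where "lam = q z"
  have z1: "(\<Sum>v\<in>V. (z v)\<^sup>2) = 1" using x(1) by (simp add: z_def)
  have "q x \<le> q z"
    unfolding q_def z_def
  proof (intro sum_mono)
    fix u v
    have "A u v * x u * x v \<le> \<bar>A u v * x u * x v\<bar>" by simp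
    also have "\<dots> = A u v * \<bar>x u\<bar> * \<bar>x v\<bar>" using nn by (simp add: abs_mult)
    finally show "A u v * x u * x v \<le> A u v * \<bar>x u\<bar> * \<bar>x v\<bar>" .
  qed
  then have max: "q y \<le> lam" if "(\<Sum>v\<in>V. (y v)\<^sup>2) = 1" for y
    using x(2)[OF that] by (simp add: q_def lam_def)
  have ray: "q y \<le> lam * (\<Sum>v\<in>V. (y v)\<^sup>2)" for y
  proof (cases "(\<Sum>v\<in>V. (y v)\<^sup>2) = 0")
    case True
    then have "\<forall>v\<in>V. y v = 0" using fin by (simp add: sum_nonneg_eq_0_iff)
    then have "q y = 0" unfolding q_def by (simp add: sum.neutral)
    then show ?thesis using True by simp
  next
    case False
    define s where "s = (\<Sum>v\<in>V. (y v)\<^sup>2)"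
    have s: "s > 0" using False sum_nonneg[of V "\<lambda>v. (y v)\<^sup>2"] by (simp add: s_def)
    have "(\<Sum>v\<in>V. (y v / sqrt s)\<^sup>2) = 1"
      using s by (simp add: power_divide s_def[symmetric] sum_divide_distrib[symmetric])
    then have "q (\<lambda>v. y v / sqrt s) \<le> lam" by (rule max)
    moreover have "q (\<lambda>v. y v / sqrt s) = q y / s"
      using s by (simp add: q_def sum_divide_distrib)
    ultimately show ?thesis using s by (simp add: s_def[symmetric] field_simps)
  qed
  have eig: "(\<Sum>v\<in>V. A u v * z v) = lam * z u" if u: "u \<in> V" for u
  proof -
    define g where "g = (\<Sum>v\<in>V. A u v * z v)"
    have "0 \<le> 2 * t * (lam * z u - g) + t\<^sup>2 * (lam - A u u)" for t
    proof -
      define e where "e = (\<lambda>v. if v = u then t else 0 :: real)"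
      have n: "(\<Sum>v\<in>V. (z v + e v)\<^sup>2) = 1 + 2 * t * z u + t\<^sup>2"
      proof -
        have "(\<Sum>v\<in>V. (z v + e v)\<^sup>2) = (\<Sum>v\<in>V. (z v)\<^sup>2 + (if v = u then 2 * t * z v + t\<^sup>2 else 0))"
          by (intro sum.cong) (auto simp: e_def power2_eq_square algebra_simps)
        then show ?thesis using fin u z1 by (simp add: sum.distrib)
      qed
      have inner1: "(\<Sum>v\<in>V. A w v * e v) = A w u * t" for w
      proof -
        have "(\<Sum>v\<in>V. A w v * e v) = (\<Sum>v\<in>V. if v = u then A w v * t else 0)" by (intro sum.cong) (auto simp: e_def)
        then show ?thesis using fin u by simp
      qed
      have outer: "(\<Sum>w\<in>V. e w * h w) = t * h u" for h
      proof -
        have "(\<Sum>w\<in>V. e w * h w) = (\<Sum>w\<in>V. if w = u then t * h w else 0)" by (intro sum.cong) (auto simp: e_def)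
        then show ?thesis using fin u by simp
      qed
      have q': "q y = (\<Sum>w\<in>V. y w * (\<Sum>v\<in>V. A w v * y v))" for y
        by (simp add: q_def sum_distrib_left mult_ac)
      have "q (\<lambda>v. z v + e v) = (\<Sum>w\<in>V. (z w + e w) * ((\<Sum>v\<in>V. A w v * z v) + A w u * t))"
        unfolding q' by (simp add: distrib_left sum.distrib inner1)
      also have "\<dots> = (\<Sum>w\<in>V. z w * (\<Sum>v\<in>V. A w v * z v)) + (\<Sum>w\<in>V. z w * (A w u * t))
          + (\<Sum>w\<in>V. e w * (\<Sum>v\<in>V. A w v * z v)) + (\<Sum>w\<in>V. e w * (A w u * t))"
        by (simp add: algebra_simps sum.distrib)
      also have "\<dots> = lam + t * g + t * g + t * (A u u * t)"
      proof -
        have "(\<Sum>w\<in>V. z w * (A w u * t)) = t * g"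
          by (simp add: g_def sum_distrib_left sym[of _ u] mult_ac)
        then show ?thesis using outer[of "\<lambda>w. \<Sum>v\<in>V. A w v * z v"] outer[of "\<lambda>w. A w u * t"]
          by (simp add: lam_def q' g_def)
      qed
      finally have "lam + t * g + t * g + t * (A u u * t) \<le> lam * (1 + 2 * t * z u + t\<^sup>2)"
        using ray[of "\<lambda>v. z v + e v"] n by simp
      then show ?thesis by (simp add: algebra_simps power2_eq_square)
    qed
    then have "lam * z u - g = 0" by (rule linear_term_vanishes)
    then show ?thesis by (simp add: g_def)
  qed
  show thesis
  proof (rule that[of z lam])
    show "\<exists>v\<in>V. z v \<noteq> 0"
    proof (rule ccontr)
      assume "\<not> ?thesis"
      then have "(\<Sum>v\<in>V. (z v)\<^sup>2) = 0" by simp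
      then show False using z1 by simp
    qed
  qed (use eig ray in \<open>auto simp: z_def q_def\<close>)
qed

section \<open>The spectral radius as a Rayleigh maximum, and its invariance under
  isomorphism\<close>

lemma adj_mat_sym: "adj_mat G u v = adj_mat G v u"
  by (simp add: adj_mat_def adj_def insert_commute)

lemma adj_mat_nonneg: "0 \<le> adj_mat G u v"
  by (simp add: adj_mat_def)

text \<open>The Rayleigh bound dominates every eigenvalue, so the maximum of the form is the
  \<open>Max\<close>. The entries are only nonnegative, since the graph may be disconnected.\<close>

lemma spectral_radius_perron:
  assumes "finite (verts G)" "verts G \<noteq> {}"
  obtains x where "\<And>v. 0 \<le> x v" "\<exists>v\<in>verts G. x v \<noteq> 0"
    "\<And>u. u \<in> verts G \<Longrightarrow> (\<Sum>v\<in>verts G. adj_mat G u v * x v) = spectral_radius G * x u"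
    "\<And>y. (\<Sum>u\<in>verts G. \<Sum>v\<in>verts G. adj_mat G u v * y u * y v) \<le> spectral_radius G * (\<Sum>v\<in>verts G. (y v)\<^sup>2)"
proof -
  obtain x lam where x: "\<And>v. 0 \<le> x v" "\<exists>v\<in>verts G. x v \<noteq> 0"
    "\<And>u. u \<in> verts G \<Longrightarrow> (\<Sum>v\<in>verts G. adj_mat G u v * x v) = lam * x u"
    "\<And>y. (\<Sum>u\<in>verts G. \<Sum>v\<in>verts G. adj_mat G u v * y u * y v) \<le> lam * (\<Sum>v\<in>verts G. (y v)\<^sup>2)"
    using nonneg_symmetric_top_eigenvector[of "verts G" "adj_mat G", OF assms adj_mat_sym adj_mat_nonneg] by blast
  have fin: "finite {mu. adj_eigenvalue G mu}"
    unfolding adj_eigenvalue_def by (rule finite_symmetric_eigenvalues[OF assms(1) adj_mat_sym])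
  have "spectral_radius G = lam"
    unfolding spectral_radius_def
  proof (rule Max_eqI[OF fin])
    show "lam \<in> {mu. adj_eigenvalue G mu}" using x(2,3) unfolding adj_eigenvalue_def by blast
    fix mu assume "mu \<in> {mu. adj_eigenvalue G mu}"
    then obtain y v where y: "v \<in> verts G" "y v \<noteq> 0" "\<forall>u\<in>verts G. (\<Sum>v\<in>verts G. adj_mat G u v * y v) = mu * y u"
      unfolding adj_eigenvalue_def by blast
    have "0 < (y v)\<^sup>2" using y(2) by simp
    also have "\<dots> \<le> (\<Sum>v\<in>verts G. (y v)\<^sup>2)" using assms(1) y(1) by (intro member_le_sum) auto
    finally have pos: "0 < (\<Sum>v\<in>verts G. (y v)\<^sup>2)" .
    have "(\<Sum>u\<in>verts G. \<Sum>v\<in>verts G. adj_mat G u v * y u * y v) = (\<Sum>u\<in>verts G. y u * (\<Sum>v\<in>verts G. adj_mat G u v * y v))"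
      by (simp add: sum_distrib_left mult_ac)
    also have "\<dots> = mu * (\<Sum>v\<in>verts G. (y v)\<^sup>2)"
      using y(3) by (simp add: sum_distrib_left power2_eq_square mult_ac)
    finally show "mu \<le> lam" using x(4)[of y] pos by simp
  qed
  note eq = this
  show thesis by (rule that[OF x[folded eq]])
qed

lemma graph_iso_sym: "graph_iso G H \<Longrightarrow> graph_iso H G"
proof -
  assume "graph_iso G H"
  then obtain f where f: "bij_betw f (verts G) (verts H)" "\<forall>u\<in>verts G. \<forall>v\<in>verts G. adj G u v \<longleftrightarrow> adj H (f u) (f v)"
    unfolding graph_iso_def by blast
  let ?g = "inv_into (verts G) f"
  have "bij_betw ?g (verts H) (verts G)" using f(1) by (rule bij_betw_inv_into)
  moreover have "adj H u v \<longleftrightarrow> adj G (?g u) (?g v)" if "u \<in> verts H" "v \<in> verts H" for u v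
  proof -
    have "?g u \<in> verts G" "?g v \<in> verts G" "f (?g u) = u" "f (?g v) = v"
      using f(1) that by (auto simp: bij_betw_def inv_into_into f_inv_into_f)
    then show ?thesis using f(2) by metis
  qed
  ultimately show ?thesis unfolding graph_iso_def by blast
qed

lemma graph_iso_eigenvalue:
  assumes "graph_iso G H" "adj_eigenvalue H mu" shows "adj_eigenvalue G mu"
proof -
  obtain f where f: "bij_betw f (verts G) (verts H)" "\<forall>u\<in>verts G. \<forall>v\<in>verts G. adj G u v \<longleftrightarrow> adj H (f u) (f v)"
    using assms(1) unfolding graph_iso_def by blast
  obtain x w where x: "w \<in> verts H" "x w \<noteq> 0" "\<forall>u\<in>verts H. (\<Sum>v\<in>verts H. adj_mat H u v * x v) = mu * x u"
    using assms(2) unfolding adj_eigenvalue_def by blast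
  have "(\<Sum>v\<in>verts G. adj_mat G u v * (x \<circ> f) v) = mu * (x \<circ> f) u" if u: "u \<in> verts G" for u
  proof -
    have "(\<Sum>v\<in>verts G. adj_mat G u v * (x \<circ> f) v) = (\<Sum>v\<in>verts G. adj_mat H (f u) (f v) * x (f v))"
      using f(2) u by (intro sum.cong) (auto simp: adj_mat_def)
    also have "\<dots> = (\<Sum>v\<in>verts H. adj_mat H (f u) v * x v)" by (rule sum.reindex_bij_betw[OF f(1)])
    also have "\<dots> = mu * x (f u)" using x(3) f(1) u by (auto simp: bij_betw_def)
    finally show ?thesis by simp
  qed
  moreover have "\<exists>v\<in>verts G. (x \<circ> f) v \<noteq> 0"
  proof -
    have "w \<in> f ` verts G" using x(1) f(1) by (simp add: bij_betw_def)
    then show ?thesis using x(2) by auto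
  qed
  ultimately show ?thesis unfolding adj_eigenvalue_def by blast
qed

lemma graph_iso_spectral_radius: "graph_iso G H \<Longrightarrow> spectral_radius G = spectral_radius H"
  unfolding spectral_radius_def using graph_iso_eigenvalue graph_iso_sym by metis

section \<open>Forests and cycles\<close>

definition acyclic_edges :: "'a set set \<Rightarrow> bool" where
  "acyclic_edges E \<longleftrightarrow> (\<nexists>c. cyc E c)"

lemma card_nb_incident:
  assumes "edge_set E" shows "card (nb E v) = card {e \<in> E. v \<in> e}"
proof (rule bij_betw_same_card)
  show "bij_betw (\<lambda>u. {v, u}) (nb E v) {e \<in> E. v \<in> e}"
    unfolding bij_betw_def
  proof
    show "inj_on (\<lambda>u. {v, u}) (nb E v)" by (auto simp: inj_on_def doubleton_eq_iff)
    show "(\<lambda>u. {v, u}) ` nb E v = {e \<in> E. v \<in> e}"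
    proof
      show "(\<lambda>u. {v, u}) ` nb E v \<subseteq> {e \<in> E. v \<in> e}" by (auto simp: nb_def)
      show "{e \<in> E. v \<in> e} \<subseteq> (\<lambda>u. {v, u}) ` nb E v"
      proof
        fix e assume "e \<in> {e \<in> E. v \<in> e}"
        then have "e \<in> E" "v \<in> e" by auto
        then obtain x where "x \<in> nb E v" "e = {v, x}" by (rule incident_subset[OF assms])
        then show "e \<in> (\<lambda>u. {v, u}) ` nb E v" by simp
      qed
    qed
  qed
qed

lemma card_nb_le: "edge_set E \<Longrightarrow> card (nb E v) \<le> card E"
  unfolding card_nb_incident by (intro card_mono) (auto simp: edge_set_def)

lemma sum_card_incident_le:
  assumes "edge_set E" "finite W"
  shows "(\<Sum>v\<in>W. card (nb E v)) \<le> 2 * card E"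
proof -
  have fin: "finite E" using assms by (simp add: edge_set_def)
  have "(\<Sum>v\<in>W. card (nb E v)) = (\<Sum>v\<in>W. \<Sum>e\<in>E. if v \<in> e then 1 else 0)"
    using fin by (simp add: card_nb_incident[OF assms(1)] sum.If_cases Int_def)
  also have "\<dots> = (\<Sum>e\<in>E. \<Sum>v\<in>W. if v \<in> e then 1 else 0)" by (rule sum.swap)
  also have "\<dots> = (\<Sum>e\<in>E. card (W \<inter> e))"
    using assms(2) by (intro sum.cong) (auto simp: sum.If_cases)
  also have "\<dots> \<le> (\<Sum>e\<in>E. 2)"
  proof (rule sum_mono)
    fix e assume "e \<in> E"
    then obtain u v where e: "u \<noteq> v" "e = {u, v}" using edge_set_pair[OF assms(1)] by metis
    have "card (W \<inter> e) \<le> card e" using e by (intro card_mono) auto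
    then show "card (W \<inter> e) \<le> 2" using e by simp
  qed
  finally show ?thesis by simp
qed

lemma sum_card_nb:
  assumes "edge_set E" "finite V" "\<Union>E \<subseteq> V"
  shows "(\<Sum>v\<in>V. card (nb E v)) = 2 * card E"
proof -
  have fin: "finite E" using assms by (simp add: edge_set_def)
  have "(\<Sum>v\<in>V. card (nb E v)) = (\<Sum>v\<in>V. \<Sum>e\<in>E. if v \<in> e then 1 else 0)"
    using fin by (simp add: card_nb_incident[OF assms(1)] sum.If_cases Int_def)
  also have "\<dots> = (\<Sum>e\<in>E. \<Sum>v\<in>V. if v \<in> e then 1 else 0)" by (rule sum.swap)
  also have "\<dots> = (\<Sum>e\<in>E. 2)"
  proof (rule sum.cong[OF refl])
    fix e assume e: "e \<in> E"
    then obtain u v where uv: "u \<noteq> v" "e = {u, v}" using edge_set_pair[OF assms(1)] by metis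
    have "V \<inter> {x. x = u \<or> x = v} = {u, v}" using assms(3) e uv by auto
    then show "(\<Sum>v\<in>V. if v \<in> e then 1 else 0) = (2::nat)" using assms(2) uv by (simp add: sum.If_cases)
  qed
  finally show ?thesis by simp
qed

lemma acyclic_edges_subset: "acyclic_edges E \<Longrightarrow> F \<subseteq> E \<Longrightarrow> acyclic_edges F"
  unfolding acyclic_edges_def using cyc_mono by blast

text \<open>\<open>v\<close> is an end of a longest path: a second neighbour would lengthen the path
  or close a cycle.\<close>

lemma acyclic_leaf:
  assumes E: "edge_set E" and ac: "acyclic_edges E" and ne: "E \<noteq> {}"
  obtains v w where "nb E v = {w}" "{v, w} \<in> E"
proof -
  define \<P> where "\<P> = (\<lambda>p. distinct p \<and> length p \<ge> 2 \<and> successively (\<lambda>u v. {u, v} \<in> E) p \<and> set p \<subseteq> \<Union>E)"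
  have finU: "finite (\<Union>E)" using E by (auto simp: edge_set_def)
  obtain e where "e \<in> E" using ne by blast
  then obtain x y where xy: "x \<noteq> y" "{x, y} \<in> E" using edge_set_pair[OF E] by metis
  then have P0: "\<P> [x, y]" by (auto simp: \<P>_def)
  have "length p < Suc (card (\<Union>E))" if "\<P> p" for p
    using that card_mono[OF finU, of "set p"] distinct_card[of p] unfolding \<P>_def by simp
  then have "\<forall>p. \<P> p \<longrightarrow> length p < Suc (card (\<Union>E))" by blast
  from ex_has_greatest_nat[OF P0 this] obtain p where p: "\<P> p" and max: "\<And>q. \<P> q \<Longrightarrow> length q \<le> length p"
    by blast
  obtain v w r where vwr: "p = v # w # r"
    using p unfolding \<P>_def by (metis One_nat_def Suc_1 Suc_le_length_iff)
  have vw: "{v, w} \<in> E" and d: "distinct (v # w # r)" and s: "successively (\<lambda>u v. {u, v} \<in> E) (v # w # r)"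
    and sub: "set (v # w # r) \<subseteq> \<Union>E"
    using p vwr by (auto simp: \<P>_def)
  have "z = w" if z: "z \<in> nb E v" for z
  proof (rule ccontr)
    assume zw: "z \<noteq> w"
    have vz: "{v, z} \<in> E" using z by (simp add: nb_def)
    have zv: "z \<noteq> v" using edge_set_neq[OF E vz] by blast
    show False
    proof (cases "z \<in> set r")
      case False
      have "{z, v} \<in> E" using vz by (simp add: insert_commute)
      then have "\<P> (z # v # w # r)" using False zv zw d s sub by (auto simp: \<P>_def)
      then show False using max vwr by force
    next
      case True
      then obtain r1 r2 where r: "r = r1 @ z # r2" by (meson split_list)
      have "successively (\<lambda>u v. {u, v} \<in> E) ((v # w # r1 @ [z]) @ r2)" using s r by simp
      then have "successively (\<lambda>u v. {u, v} \<in> E) (v # w # r1 @ [z])" unfolding successively_append_iff by blast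
      then have "cyc E (v # w # r1 @ [z])"
        using d r vz by (auto simp: cyc_def insert_commute)
      then show False using ac by (auto simp: acyclic_edges_def)
    qed
  qed
  moreover have "w \<in> nb E v" using vw by (simp add: nb_def)
  ultimately have "nb E v = {w}" by blast
  then show thesis using that vw by blast
qed

lemma acyclic_card:
  assumes "edge_set E" "acyclic_edges E" "finite V" "V \<noteq> {}" "\<Union>E \<subseteq> V"
  shows "card E + 1 \<le> card V"
  using assms
proof (induction "card V" arbitrary: V E rule: less_induct)
  case less
  show ?case
  proof (cases "E = {}")
    case True
    then show ?thesis using less.prems(3,4) by (simp add: Suc_le_eq card_gt_0_iff)
  next
    case False
    obtain v w where vw: "nb E v = {w}" "{v, w} \<in> E" using acyclic_leaf[OF less.prems(1,2) False] by blast
    have V: "v \<in> V" "w \<in> V" "v \<noteq> w" using less.prems(5) vw(2) edge_set_neq[OF less.prems(1) vw(2)] by auto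
    define E' where "E' = E - {{v, w}}"
    have "v \<notin> \<Union>E'"
    proof
      assume "v \<in> \<Union>E'"
      then obtain e where e: "e \<in> E" "v \<in> e" "e \<noteq> {v, w}" by (auto simp: E'_def)
      from incident_subset[OF less.prems(1) e(1,2)] vw(1) e(3) show False by (metis singletonD)
    qed
    then have sub: "\<Union>E' \<subseteq> V - {v}" using less.prems(5) by (auto simp: E'_def)
    have lt: "card (V - {v}) < card V" using V(1) less.prems(3) by (rule card_Diff1_less[rotated])
    have "card E' + 1 \<le> card (V - {v})"
    proof (rule less.hyps[OF lt _ _ _ _ sub])
      show "edge_set E'" using less.prems(1) by (rule edge_set_subset) (simp add: E'_def)
      show "acyclic_edges E'" using less.prems(2) by (rule acyclic_edges_subset) (auto simp: E'_def)
      show "finite (V - {v})" using less.prems(3) by simp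
      show "V - {v} \<noteq> {}" using V by auto
    qed
    moreover have "card E = card E' + 1"
      using card_Suc_Diff1[of E "{v, w}"] vw(2) less.prems(1) by (simp add: E'_def edge_set_def)
    ultimately show ?thesis using lt by simp
  qed
qed

lemma nb_cycle_edges: 
  assumes "distinct c" shows "card (nb (cycle_edges c) v) \<le> 2"
proof (cases "v \<in> set c")
  case False
  have "nb (cycle_edges c) v = {}"
  proof (rule ccontr)
    assume "nb (cycle_edges c) v \<noteq> {}"
    then obtain u i where "{v, u} = {c ! i, c ! ((i + 1) mod length c)}" "i < length c"
      unfolding nb_def cycle_edges_def by blast
    moreover have "(i + 1) mod length c < length c" using \<open>i < length c\<close> by (intro mod_less_divisor) auto
    ultimately have "v \<in> set c" by (metis doubleton_eq_iff nth_mem)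
    then show False using False by simp
  qed
  then show ?thesis by simp
next
  case True
  then obtain j where j: "j < length c" "v = c ! j" by (auto simp: in_set_conv_nth)
  define L where "L = length c"
  have "nb (cycle_edges c) v \<subseteq> {c ! ((j + 1) mod L), c ! ((j + L - 1) mod L)}"
  proof
    fix u assume "u \<in> nb (cycle_edges c) v"
    then obtain i where i: "{v, u} = {c ! i, c ! ((i + 1) mod L)}" "i < L"
      unfolding nb_def cycle_edges_def L_def by blast
    have m: "(i + 1) mod L < L" using i(2) by (intro mod_less_divisor) auto
    consider "v = c ! i" "u = c ! ((i + 1) mod L)" | "v = c ! ((i + 1) mod L)" "u = c ! i"
      using i(1) by (auto simp: doubleton_eq_iff)
    then show "u \<in> {c ! ((j + 1) mod L), c ! ((j + L - 1) mod L)}"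
    proof cases
      case 1
      then have "i = j" using j i(2) assms by (simp add: L_def nth_eq_iff_index_eq)
      then show ?thesis using 1 by simp
    next
      case 2
      then have ij: "j = (i + 1) mod L" using j m assms by (simp add: L_def nth_eq_iff_index_eq)
      have "(j + L - 1) mod L = i"
      proof (cases "i + 1 = L")
        case True
        then have "j = 0" using ij by simp
        then show ?thesis using True i(2) by auto
      next
        case False
        then have "j = i + 1" using ij i(2) by simp
        then show ?thesis using i(2) by simp
      qed
      then show ?thesis using 2 by simp
    qed
  qed
  then have "card (nb (cycle_edges c) v) \<le> card {c ! ((j + 1) mod L), c ! ((j + L - 1) mod L)}"
    by (intro card_mono) auto
  also have "\<dots> \<le> 2" by (simp add: card_insert_if)
  finally show ?thesis .
qed

lemma nb_Un: "nb (E \<union> F) v = nb E v \<union> nb F v"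
  by (auto simp: nb_def)

text \<open>Cycles are removed greedily, and each of them contributes at most two to every degree.\<close>
lemma forest_decomposition:
  assumes "edge_set E" "\<not> packs E k"
  shows "\<exists>F\<subseteq>E. acyclic_edges F \<and> (\<forall>v. card (nb (E - F) v) \<le> 2 * (k - 1))"
  using assms
proof (induction k arbitrary: E)
  case 0
  then show ?case using packs_0 by blast
next
  case (Suc k)
  show ?case
  proof (cases "acyclic_edges E")
    case True
    then show ?thesis by (intro exI[of _ E]) (auto simp: nb_def)
  next
    case False
    then obtain c where c: "cyc E c" by (auto simp: acyclic_edges_def)
    define E1 where "E1 = E - cycle_edges c"
    have np: "\<not> packs E1 k" using packs_Suc[OF c] Suc.prems(2) unfolding E1_def by blast
    have E1: "edge_set E1" using Suc.prems(1) by (rule edge_set_subset) (auto simp: E1_def)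
    \<comment> \<open>\<open>packs E1 0\<close> always holds. Positivity of \<open>k\<close> makes
      the truncated \<open>k - 1\<close> harmless.\<close>
    have k: "k \<noteq> 0" using np packs_0 by (metis)
    obtain F where F: "F \<subseteq> E1" "acyclic_edges F" "\<forall>v. card (nb (E1 - F) v) \<le> 2 * (k - 1)"
      using Suc.IH[OF E1 np] by blast
    have "card (nb (E - F) v) \<le> 2 * (Suc k - 1)" for v
    proof -
      have "E - F \<subseteq> (E1 - F) \<union> cycle_edges c" by (auto simp: E1_def)
      then have "nb (E - F) v \<subseteq> nb (E1 - F) v \<union> nb (cycle_edges c) v" by (auto simp: nb_def)
      moreover have "finite (nb (E1 - F) v)" "finite (nb (cycle_edges c) v)"
        using finite_nb edge_set_subset[OF E1, of "E1 - F"] edge_set_subset[OF Suc.prems(1) cycle_edges_subset[OF c]] by auto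
      ultimately have "card (nb (E - F) v) \<le> card (nb (E1 - F) v \<union> nb (cycle_edges c) v)"
        by (intro card_mono) auto
      also have "\<dots> \<le> card (nb (E1 - F) v) + card (nb (cycle_edges c) v)" by (rule card_Un_le)
      also have "\<dots> \<le> 2 * (k - 1) + 2"
        using F(3) nb_cycle_edges[of c v] c by (intro add_mono) (auto simp: cyc_def)
      finally show ?thesis using k by simp
    qed
    then show ?thesis using F by (intro exI[of _ F]) (auto simp: E1_def)
  qed
qed

lemma acyclic_common_nb:
  assumes E: "edge_set E" and ac: "acyclic_edges E" and uv: "u \<noteq> v"
  shows "card (nb E u \<inter> nb E v) \<le> 1"
proof (rule ccontr)
  assume "\<not> ?thesis"
  then have "2 \<le> card (nb E u \<inter> nb E v)" by simp
  then obtain X where X: "X \<subseteq> nb E u \<inter> nb E v" "card X = 2" by (meson obtain_subset_with_card_n)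
  then obtain x y where xy: "X = {x, y}" "x \<noteq> y" by (meson card_2_iff)
  then have e: "{u, x} \<in> E" "{u, y} \<in> E" "{v, x} \<in> E" "{v, y} \<in> E" using X by (auto simp: nb_def)
  then have "u \<noteq> x" "u \<noteq> y" "v \<noteq> x" "v \<noteq> y" using edge_set_neq[OF E] by metis+
  then have "cyc E [u, x, v, y]" unfolding cyc4 using e uv xy by (simp add: insert_commute)
  then show False using ac by (auto simp: acyclic_edges_def)
qed

lemma acyclic_no_triangle:
  assumes E: "edge_set E" and ac: "acyclic_edges E" and "u \<in> nb E v"
  shows "nb E u \<inter> nb E v = {}"
proof (rule ccontr)
  assume "\<not> ?thesis"
  then obtain w where "w \<in> nb E u" "w \<in> nb E v" by blast
  then have e: "{u, w} \<in> E" "{v, w} \<in> E" "{v, u} \<in> E" using assms(3) by (auto simp: nb_def)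
  then have "u \<noteq> w" "v \<noteq> w" "u \<noteq> v" using edge_set_neq[OF E] by metis+
  then have "cyc E [u, w, v]" unfolding cyc3 using e by (simp add: insert_commute)
  then show False using ac by (auto simp: acyclic_edges_def)
qed

section \<open>Locating the dominating vertex\<close>

lemma nb_subset: "\<Union>E \<subseteq> V \<Longrightarrow> nb E v \<subseteq> V"
  using nb_in_Union by fastforce

lemma sum_nb_swap:
  fixes f :: "'a \<Rightarrow> 'a \<Rightarrow> 'b::comm_monoid_add"
  assumes "finite S" "finite T"
  shows "(\<Sum>u\<in>S. \<Sum>v\<in>nb E u \<inter> T. f u v) = (\<Sum>v\<in>T. \<Sum>u\<in>nb E v \<inter> S. f u v)"
proof -
  have 1: "(\<Sum>v\<in>nb E u \<inter> T. f u v) = (\<Sum>v\<in>T. if {u, v} \<in> E then f u v else 0)" for u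
  proof -
    have "nb E u \<inter> T = {v \<in> T. {u, v} \<in> E}" by (auto simp: nb_def)
    then show ?thesis using sum.inter_filter[OF assms(2), of "f u" "\<lambda>v. {u, v} \<in> E"] by simp
  qed
  have 2: "(\<Sum>u\<in>nb E v \<inter> S. f u v) = (\<Sum>u\<in>S. if {u, v} \<in> E then f u v else 0)" for v
  proof -
    have "nb E v \<inter> S = {u \<in> S. {u, v} \<in> E}" by (auto simp: nb_def insert_commute)
    then show ?thesis using sum.inter_filter[OF assms(1), of "\<lambda>u. f u v" "\<lambda>u. {u, v} \<in> E"] by simp
  qed
  show ?thesis unfolding 1 2 by (rule sum.swap)
qed

lemma sum_nb_sym:
  fixes f :: "'a \<Rightarrow> 'a \<Rightarrow> 'b::comm_monoid_add"
  assumes "finite V" "\<Union>E \<subseteq> V"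
  shows "(\<Sum>u\<in>V. \<Sum>v\<in>nb E u. f u v) = (\<Sum>v\<in>V. \<Sum>u\<in>nb E v. f u v)"
  using sum_nb_swap[OF assms(1,1), of f E] nb_subset[OF assms(2)] by (simp add: Int_absorb2)

lemma perron_nb:
  fixes V :: "'a set"
  assumes "finite V" "V \<noteq> {}" "\<Union>E \<subseteq> V"
  obtains x where "\<And>v. 0 \<le> x v" "\<exists>v\<in>V. x v \<noteq> 0"
    "\<And>u. u \<in> V \<Longrightarrow> (\<Sum>v\<in>nb E u. x v) = spectral_radius (V, E) * x u"
    "\<And>y. (\<Sum>u\<in>V. \<Sum>v\<in>nb E u. y u * y v) \<le> spectral_radius (V, E) * (\<Sum>v\<in>V. (y v)\<^sup>2)"
proof -
  have adjs: "(\<Sum>v\<in>V. adj_mat (V, E) u v * g v) = (\<Sum>v\<in>nb E u. g v)" for u and g :: "'a \<Rightarrow> real"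
  proof -
    have "(\<Sum>v\<in>V. adj_mat (V, E) u v * g v) = (\<Sum>v\<in>V. if {u, v} \<in> E then g v else 0)"
      by (intro sum.cong) (auto simp: adj_mat_def adj_def edges_def)
    also have "\<dots> = (\<Sum>v\<in>{v \<in> V. {u, v} \<in> E}. g v)" using assms(1) by (simp add: sum.inter_filter)
    also have "{v \<in> V. {u, v} \<in> E} = nb E u" using nb_subset[OF assms(3), of u] by (auto simp: nb_def)
    finally show ?thesis .
  qed
  have fv: "finite (verts (V, E))" "verts (V, E) \<noteq> {}" using assms by (auto simp: verts_def)
  obtain x where x: "\<And>v. 0 \<le> x v" "\<exists>v\<in>verts (V, E). x v \<noteq> 0"
    "\<And>u. u \<in> verts (V, E) \<Longrightarrow> (\<Sum>v\<in>verts (V, E). adj_mat (V, E) u v * x v) = spectral_radius (V, E) * x u"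
    "\<And>y. (\<Sum>u\<in>verts (V, E). \<Sum>v\<in>verts (V, E). adj_mat (V, E) u v * y u * y v) \<le> spectral_radius (V, E) * (\<Sum>v\<in>verts (V, E). (y v)\<^sup>2)"
    using spectral_radius_perron[OF fv] by blast
  have v: "verts (V, E) = V" by (simp add: verts_def)
  have eig: "(\<Sum>v\<in>nb E u. x v) = spectral_radius (V, E) * x u" if "u \<in> V" for u
    using x(3)[of u] that unfolding v adjs .
  have ray: "(\<Sum>u\<in>V. \<Sum>v\<in>nb E u. y u * y v) \<le> spectral_radius (V, E) * (\<Sum>v\<in>V. (y v)\<^sup>2)" for y :: "'a \<Rightarrow> real"
  proof -
    have "(\<Sum>v\<in>V. adj_mat (V, E) u v * y u * y v) = (\<Sum>v\<in>nb E u. y u * y v)" for u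
      using adjs[of u "\<lambda>v. y u * y v"] by (simp add: mult_ac)
    then show ?thesis using x(4)[of y] unfolding v by simp
  qed
  show thesis by (rule that[OF x(1) x(2)[unfolded v] eig ray])
qed

text \<open>The Perron vector of \<open>E\<close> is tested in the Rayleigh bound for
  \<open>F\<close>. The deleted edges contribute at most \<open>d\<close> times the squared norm, by
  the inequality of arithmetic and geometric means on each edge and the degree bound.\<close>

lemma spectral_radius_forest_part:
  assumes V: "finite V" "V \<noteq> {}" "\<Union>E \<subseteq> V" and E: "edge_set E" and FE: "F \<subseteq> E"
    and deg: "\<And>v. card (nb (E - F) v) \<le> d"
  shows "spectral_radius (V, E) - d \<le> spectral_radius (V, F)"
proof -
  obtain x where x: "\<And>v. 0 \<le> x v" "\<exists>v\<in>V. x v \<noteq> 0"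
    "\<And>u. u \<in> V \<Longrightarrow> (\<Sum>v\<in>nb E u. x v) = spectral_radius (V, E) * x u"
    by (rule perron_nb[OF V]) (rule that; assumption)
  have VF: "\<Union>F \<subseteq> V" using V(3) FE by blast
  have VQ: "\<Union>(E - F) \<subseteq> V" using V(3) by blast
  obtain z where ray: "\<And>y. (\<Sum>u\<in>V. \<Sum>v\<in>nb F u. y u * y v) \<le> spectral_radius (V, F) * (\<Sum>v\<in>V. (y v)\<^sup>2)"
    using perron_nb[OF V(1,2) VF] by blast
  define s where "s = (\<Sum>v\<in>V. (x v)\<^sup>2)"
  obtain v where v: "v \<in> V" "x v \<noteq> 0" using x(2) by blast
  have "0 < (x v)\<^sup>2" using v by simp
  also have "\<dots> \<le> s" unfolding s_def using V(1) v by (intro member_le_sum) auto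
  finally have s: "s > 0" .
  have split: "(\<Sum>v\<in>nb E u. g v) = (\<Sum>v\<in>nb F u. g v) + (\<Sum>v\<in>nb (E - F) u. g v)" for u and g :: "'a \<Rightarrow> real"
  proof -
    have "E = F \<union> (E - F)" using FE by blast
    then have "nb E u = nb F u \<union> nb (E - F) u" using nb_Un[of F "E - F" u] by simp
    moreover have "nb F u \<inter> nb (E - F) u = {}" by (simp add: nb_def disjoint_iff)
    moreover have "finite (nb F u)" "finite (nb (E - F) u)"
      using finite_nb[OF edge_set_subset[OF E FE]] finite_nb[OF edge_set_subset[OF E Diff_subset]] by blast+
    ultimately show ?thesis by (simp add: sum.union_disjoint)
  qed
  have "spectral_radius (V, E) * s = (\<Sum>u\<in>V. x u * (\<Sum>v\<in>nb E u. x v))"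
    using x(3) by (simp add: s_def sum_distrib_left power2_eq_square mult_ac)
  also have "\<dots> = (\<Sum>u\<in>V. \<Sum>v\<in>nb E u. x u * x v)" by (simp add: sum_distrib_left)
  also have "\<dots> = (\<Sum>u\<in>V. \<Sum>v\<in>nb F u. x u * x v) + (\<Sum>u\<in>V. \<Sum>v\<in>nb (E - F) u. x u * x v)"
    by (simp add: split sum.distrib)
  also have "(\<Sum>u\<in>V. \<Sum>v\<in>nb (E - F) u. x u * x v) \<le> (\<Sum>u\<in>V. \<Sum>v\<in>nb (E - F) u. (x u)\<^sup>2 / 2 + (x v)\<^sup>2 / 2)"
  proof (intro sum_mono)
    fix u v
    have "0 \<le> (x u - x v)\<^sup>2" by simp
    then show "x u * x v \<le> (x u)\<^sup>2 / 2 + (x v)\<^sup>2 / 2" by (simp add: power2_eq_square algebra_simps)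
  qed
  also have "\<dots> = (\<Sum>u\<in>V. \<Sum>v\<in>nb (E - F) u. (x u)\<^sup>2 / 2) + (\<Sum>u\<in>V. \<Sum>v\<in>nb (E - F) u. (x v)\<^sup>2 / 2)"
    by (simp add: sum.distrib)
  also have "(\<Sum>u\<in>V. \<Sum>v\<in>nb (E - F) u. (x v)\<^sup>2 / 2) = (\<Sum>u\<in>V. \<Sum>v\<in>nb (E - F) u. (x u)\<^sup>2 / 2)"
    by (rule sum_nb_sym[OF V(1) VQ])
  also have "(\<Sum>u\<in>V. \<Sum>v\<in>nb (E - F) u. (x u)\<^sup>2 / 2) + (\<Sum>u\<in>V. \<Sum>v\<in>nb (E - F) u. (x u)\<^sup>2 / 2)
      = (\<Sum>u\<in>V. real (card (nb (E - F) u)) * (x u)\<^sup>2)"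
    by (simp add: sum.distrib[symmetric] mult.commute)
  also have "\<dots> \<le> (\<Sum>u\<in>V. real d * (x u)\<^sup>2)"
    using deg by (intro sum_mono mult_right_mono) auto
  also have "\<dots> = d * s" by (simp add: s_def sum_distrib_left)
  finally have "spectral_radius (V, E) * s \<le> (\<Sum>u\<in>V. \<Sum>v\<in>nb F u. x u * x v) + d * s" by simp
  also have "\<dots> \<le> spectral_radius (V, F) * s + d * s" using ray[of x] by (simp add: s_def)
  finally have "(spectral_radius (V, E) - d) * s \<le> spectral_radius (V, F) * s" by (simp add: algebra_simps)
  then show ?thesis using s by simp
qed

lemma Max_entry:
  fixes x :: "'a \<Rightarrow> real"
  assumes "finite V" "V \<noteq> {}"
  obtains a where "a \<in> V" "\<And>v. v \<in> V \<Longrightarrow> x v \<le> x a"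
proof -
  have "Max (x ` V) \<in> x ` V" using assms by (intro Max_in) auto
  then obtain a where a: "a \<in> V" "x a = Max (x ` V)" by auto
  then show thesis using assms that[of a] by auto
qed

lemma card_avoiding:
  assumes "edge_set E"
  shows "card {e \<in> E. a \<notin> e} + card (nb E a) = card E"
proof -
  have fin: "finite E" using assms by (simp add: edge_set_def)
  have "card ({e \<in> E. a \<notin> e} \<union> {e \<in> E. a \<in> e}) = card {e \<in> E. a \<notin> e} + card {e \<in> E. a \<in> e}"
    using fin by (intro card_Un_disjoint) auto
  moreover have "{e \<in> E. a \<notin> e} \<union> {e \<in> E. a \<in> e} = E" by blast
  ultimately show ?thesis by (simp add: card_nb_incident[OF assms])
qed

lemma nb_avoiding: "w \<noteq> a \<Longrightarrow> nb {e \<in> E. a \<notin> e} w = nb E w - {a}"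
  by (rule set_eqI) (simp add: nb_def, metis)

text \<open>In a forest every vertex at distance two from \<open>a\<close> has a unique neighbour next to \<open>a\<close>,
  and its entry is at most its degree divided by \<open>\<rho>\<close>.\<close>
lemma forest_hub:
  assumes V: "finite V" "V \<noteq> {}" "\<Union>F \<subseteq> V" and F: "edge_set F" "acyclic_edges F"
  defines "\<rho> \<equiv> spectral_radius (V, F)"
  assumes pos: "\<rho> > 0"
  obtains a where "a \<in> V" "\<rho>\<^sup>2 \<le> card (nb F a) + 2 * (real (card V) - 1 - card (nb F a)) / \<rho>"
proof -
  obtain y where y0: "\<And>v. 0 \<le> y v" "\<exists>v\<in>V. y v \<noteq> 0" "\<And>u. u \<in> V \<Longrightarrow> (\<Sum>v\<in>nb F u. y v) = \<rho> * y u"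
    by (rule perron_nb[OF V, folded \<rho>_def]) (rule that; assumption)
  obtain a where a: "a \<in> V" "\<And>v. v \<in> V \<Longrightarrow> y v \<le> y a" using Max_entry[OF V(1,2)] by metis
  have ya: "y a > 0"
  proof -
    obtain v where "v \<in> V" "y v \<noteq> 0" using y0(2) by blast
    then show ?thesis using y0(1)[of v] a(2)[of v] by linarith
  qed
  note nbV = nb_subset[OF V(3)]
  have small: "\<rho> * y w \<le> card (nb F w) * y a" if "w \<in> V" for w
  proof -
    have "\<rho> * y w = (\<Sum>v\<in>nb F w. y v)" using y0(3) that by simp
    also have "\<dots> \<le> (\<Sum>v\<in>nb F w. y a)" using a(2) nbV by (intro sum_mono) blast
    finally show ?thesis by simp
  qed
  define W where "W = (\<Union>u\<in>nb F a. nb F u - {a})"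
  have finn: "finite (nb F u)" for u by (rule finite_nb[OF F(1)])
  have finW: "finite W" by (simp add: W_def finn)
  have WV: "W \<subseteq> V" using nbV by (auto simp: W_def)
  define F' where "F' = {e \<in> F. a \<notin> e}"
  have F': "edge_set F'" using F(1) by (rule edge_set_subset) (auto simp: F'_def)
  \<comment> \<open>A vertex of \<open>W\<close> is not adjacent to \<open>a\<close>, as that would
    close a triangle. So the degrees on \<open>W\<close> are counted by the edges avoiding
    \<open>a\<close>, of which a forest has at most
    \<open>card V - 1 - card (nb F a)\<close>.\<close>
  have nbW: "nb F' w = nb F w" if w: "w \<in> W" for w
  proof -
    obtain u where u: "u \<in> nb F a" "w \<in> nb F u" "w \<noteq> a" using w by (auto simp: W_def)
    have "nb F u \<inter> nb F a = {}" using acyclic_no_triangle[OF F u(1)] .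
    then have "w \<notin> nb F a" using u(2) by blast
    then have "a \<notin> nb F w" using nb_sym by fastforce
    then show ?thesis using nb_avoiding[OF u(3)] by (auto simp: F'_def)
  qed
  have "(\<Sum>w\<in>W. card (nb F w)) = (\<Sum>w\<in>W. card (nb F' w))" using nbW by simp
  also have "\<dots> \<le> 2 * card F'" by (rule sum_card_incident_le[OF F' finW])
  finally have sumW: "(\<Sum>w\<in>W. card (nb F w)) \<le> 2 * card F'" .
  have cF: "card F' + card (nb F a) + 1 \<le> card V"
    using acyclic_card[OF F V] card_avoiding[OF F(1), of a] by (simp add: F'_def)
  have "\<rho>\<^sup>2 * y a = \<rho> * (\<Sum>u\<in>nb F a. y u)" using y0(3)[OF a(1)] by (simp add: power2_eq_square)
  also have "\<dots> = (\<Sum>u\<in>nb F a. \<Sum>w\<in>nb F u. y w)"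
    using y0(3) nbV by (simp add: sum_distrib_left subset_eq)
  also have "\<dots> = (\<Sum>u\<in>nb F a. y a + (\<Sum>w\<in>nb F u - {a}. y w))"
  proof (rule sum.cong[OF refl])
    fix u assume "u \<in> nb F a"
    then have "a \<in> nb F u" by (simp add: nb_sym)
    then show "(\<Sum>w\<in>nb F u. y w) = y a + (\<Sum>w\<in>nb F u - {a}. y w)" using finn by (simp add: sum.remove)
  qed
  also have "\<dots> = card (nb F a) * y a + (\<Sum>u\<in>nb F a. \<Sum>w\<in>nb F u - {a}. y w)"
    by (simp add: sum.distrib)
  also have "(\<Sum>u\<in>nb F a. \<Sum>w\<in>nb F u - {a}. y w) = (\<Sum>w\<in>W. y w)"
    unfolding W_def
  proof (rule sum.UNION_disjoint[symmetric])
    show "\<forall>u\<in>nb F a. \<forall>u'\<in>nb F a. u \<noteq> u' \<longrightarrow> (nb F u - {a}) \<inter> (nb F u' - {a}) = {}"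
    proof (intro ballI impI, rule ccontr)
      fix u u' assume u: "u \<in> nb F a" "u' \<in> nb F a" "u \<noteq> u'" "(nb F u - {a}) \<inter> (nb F u' - {a}) \<noteq> {}"
      then obtain w where w: "w \<in> nb F u" "w \<in> nb F u'" "w \<noteq> a" by blast
      have "{w, a} \<subseteq> nb F u \<inter> nb F u'" using w u nb_sym by fastforce
      then have "card {w, a} \<le> card (nb F u \<inter> nb F u')" using finn by (intro card_mono) auto
      then show False using acyclic_common_nb[OF F u(3)] w(3) by simp
    qed
  qed (use finn in auto)
  also have "(\<Sum>w\<in>W. y w) \<le> (\<Sum>w\<in>W. card (nb F w) * y a / \<rho>)"
    using small WV pos by (intro sum_mono) (auto simp: field_simps)
  also have "\<dots> = real (\<Sum>w\<in>W. card (nb F w)) * (y a / \<rho>)" by (simp add: sum_distrib_right sum_divide_distrib)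
  also have "\<dots> \<le> real (2 * card F') * (y a / \<rho>)"
    using sumW pos ya by (intro mult_right_mono) (auto simp del: of_nat_sum)
  also have "\<dots> \<le> (2 * (real (card V) - 1 - card (nb F a))) * (y a / \<rho>)"
    using cF pos ya by (intro mult_right_mono) (simp_all)
  finally have "\<rho>\<^sup>2 * y a \<le> (card (nb F a) + 2 * (real (card V) - 1 - card (nb F a)) / \<rho>) * y a"
    by (simp add: algebra_simps add_divide_distrib diff_divide_distrib)
  then have "\<rho>\<^sup>2 \<le> card (nb F a) + 2 * (real (card V) - 1 - card (nb F a)) / \<rho>" using ya by simp
  then show thesis using that a(1) by blast
qed

section \<open>Numerical estimates around the hub\<close>

lemma hub_radius_bound:
  fixes \<rho> n :: real and k :: nat
  assumes "k \<ge> 1" "144 * real k ^ 4 \<le> n" "n - 1 \<le> \<rho>\<^sup>2" "0 \<le> \<rho>"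
  shows "\<rho> \<ge> 119/10 * (real k)\<^sup>2"
proof (rule power2_le_imp_le)
  have "1 \<le> real k ^ 4" using assms(1) by simp
  \<comment> \<open>The square of \<open>119/10\<close> is 141.61, which leaves room below 144 for
    subtracting 1.\<close>
  then have "(119/10 * (real k)\<^sup>2)\<^sup>2 \<le> 144 * real k ^ 4 - 1" by (simp add: power_mult_distrib power2_eq_square power4_eq_xxxx)
  then show "(119/10 * (real k)\<^sup>2)\<^sup>2 \<le> \<rho>\<^sup>2" using assms(2,3) by linarith
qed (use assms in auto)

text \<open>The vertices other than the hub that are not its forest neighbours number
  \<open>n - 1 - d\<close>. As \<open>\<rho>F \<ge> 10\<close>, each adds at most
  \<open>2/10\<close> to the bound on \<open>\<rho>F\<^sup>2\<close> where a neighbour adds 1, so it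
  costs \<open>8/10\<close>. Passing from \<rho> to \<open>\<rho>F\<close> loses at most
  \<open>4 * (K - 1) * \<rho>\<close> in the square, and 5 is 4 divided by
  \<open>8/10\<close>.\<close>

lemma hub_defect_bound:
  fixes \<rho> \<rho>F n d :: real and k :: nat
  assumes k: "k \<ge> 1" and \<rho>: "\<rho> \<ge> 119/10 * (real k)\<^sup>2" "n - 1 \<le> \<rho>\<^sup>2"
    and F: "\<rho> - 2 * (real k - 1) \<le> \<rho>F" "\<rho>F\<^sup>2 \<le> d + 2 * (n - 1 - d) / \<rho>F" and d: "d \<le> n - 1"
  shows "n - 1 - d \<le> 5 * (real k - 1) * \<rho>"
proof -
  define K where "K = real k"
  define r where "r = n - 1 - d"
  have K: "K \<ge> 1" using k by (simp add: K_def)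
  have K2: "K\<^sup>2 \<ge> K" using K by (simp add: power2_eq_square)
  have \<rho>K: "\<rho> \<ge> 119/10 * K\<^sup>2" using \<rho>(1) by (simp add: K_def)
  have \<rho>F: "\<rho>F \<ge> 10" using F(1) \<rho>K K2 K by (simp add: K_def[symmetric])
  have r0: "r \<ge> 0" using d by (simp add: r_def)
  have "2 * r / \<rho>F \<le> 2 * r / 10" using r0 \<rho>F by (intro divide_left_mono) auto
  moreover have "\<rho>F\<^sup>2 \<le> n - 1 - r + 2 * r / \<rho>F" using F(2) by (simp add: r_def)
  ultimately have "\<rho>F\<^sup>2 \<le> n - 1 - r + 2 * r / 10" by linarith
  moreover have "(\<rho> - 2 * (K - 1))\<^sup>2 \<le> \<rho>F\<^sup>2"
    using F(1) \<rho>K K2 K by (intro power_mono) (simp_all add: K_def[symmetric])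
  ultimately have "(\<rho> - 2 * (K - 1))\<^sup>2 + 8/10 * r \<le> \<rho>\<^sup>2" using \<rho>(2) by linarith
  moreover define p where "p = (K - 1) * \<rho>"
  have "(\<rho> - 2 * (K - 1))\<^sup>2 = \<rho>\<^sup>2 - 4 * p + (2 * (K - 1))\<^sup>2"
    by (simp add: p_def power2_eq_square algebra_simps)
  moreover have "0 \<le> (2 * (K - 1))\<^sup>2" by simp
  ultimately have "r \<le> 5 * p" by linarith
  then have "r \<le> 5 * ((K - 1) * \<rho>)" unfolding p_def .
  then show ?thesis unfolding r_def K_def mult.assoc .
qed

text \<open>\<open>M\<close> is the largest entry away from the hub, \<open>xa\<close> the entry at
  the hub, \<open>R\<close> the number of non-neighbours. Any non-neighbour gives
  \<open>xa \<le> M * (10 * K - 9)\<close>; inserted in the bound for \<open>M\<close>, this leaves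
  \<open>\<rho> * (\<rho> - 10 * K\<^sup>2 + 9) \<le> 44 * K\<^sup>2\<close>. Here the constant 144
  pays off: \<open>119/10\<close> exceeds 10, and nine times \<open>119/10\<close> exceeds
  44.\<close>

lemma hub_final_contradiction:
  fixes \<rho> r M xa R :: real and k :: nat
  assumes k: "k \<ge> 1" and \<rho>: "\<rho> \<ge> 119/10 * (real k)\<^sup>2"
    and r: "r \<le> 5 * (real k - 1) * \<rho>"
    and M: "M \<ge> 0" "M * (\<rho>\<^sup>2 - (2 * r + 2 * (real k - 1) * (r + 2 * (real k - 1)))) \<le> (\<rho> + (4 * real k - 3)) * xa"
    and R: "R \<ge> 1" "R * xa \<le> M * (6 * (real k - 1) + (4 * real k - 3) * R)"
    and pos: "0 < M \<or> 0 < xa"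
  shows False
proof -
  define K where "K = real k"
  have K: "K \<ge> 1" using k by (simp add: K_def)
  have K2: "K\<^sup>2 \<ge> K" "K\<^sup>2 \<ge> 1" using K by (simp_all add: power2_eq_square mult_ge1_I)
  have \<rho>K: "\<rho> \<ge> 119/10 * K\<^sup>2" using \<rho> by (simp add: K_def)
  have \<rho>0: "\<rho> > 0" using \<rho>K K2 by linarith
  define W where "W = 2 * r + 2 * (K - 1) * (r + 2 * (K - 1))"
  have W: "W \<le> 10 * K * (K - 1) * \<rho> + 4 * (K - 1)\<^sup>2"
  proof -
    have "W = 2 * K * r + 4 * (K - 1)\<^sup>2" by (simp add: W_def power2_eq_square algebra_simps)
    also have "2 * K * r \<le> 2 * K * (5 * (K - 1) * \<rho>)" using r K by (intro mult_left_mono) (auto simp: K_def)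
    finally show ?thesis by (simp add: algebra_simps)
  qed
  have lin: "6 * (K - 1) + (4 * K - 3) * R \<le> (10 * K - 9) * R"
  proof -
    have "6 * (K - 1) * 1 \<le> 6 * (K - 1) * R" using R(1) K by (intro mult_left_mono) auto
    then show ?thesis by (simp add: algebra_simps)
  qed
  have "R * xa \<le> M * ((10 * K - 9) * R)"
    using R(2) mult_left_mono[OF lin M(1)] by (simp add: K_def)
  then have "R * xa \<le> R * (M * (10 * K - 9))" by (simp add: algebra_simps)
  then have xa: "xa \<le> M * (10 * K - 9)" using R(1) by simp
  have "M * (\<rho>\<^sup>2 - W) \<le> (\<rho> + (4 * K - 3)) * xa" using M(2) by (simp add: W_def K_def)
  also have "\<dots> \<le> (\<rho> + (4 * K - 3)) * (M * (10 * K - 9))" using xa \<rho>0 K by (intro mult_left_mono) auto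
  finally have MM: "M * (\<rho>\<^sup>2 - W) \<le> M * ((\<rho> + (4 * K - 3)) * (10 * K - 9))" by (simp add: algebra_simps)
  have Mpos: "M > 0"
  proof (rule ccontr)
    assume "\<not> M > 0"
    then have "M = 0" using M(1) by simp
    then show False using xa pos by simp
  qed
  then have "\<rho>\<^sup>2 - W \<le> (\<rho> + (4 * K - 3)) * (10 * K - 9)" using MM by simp
  then have "\<rho>\<^sup>2 - 10 * K * (K - 1) * \<rho> - (10 * K - 9) * \<rho> \<le> 4 * (K - 1)\<^sup>2 + (4 * K - 3) * (10 * K - 9)"
    using W by (simp add: algebra_simps)
  moreover have "\<rho>\<^sup>2 - 10 * K * (K - 1) * \<rho> - (10 * K - 9) * \<rho> = \<rho> * (\<rho> - 10 * K\<^sup>2 + 9)"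
    by (simp add: power2_eq_square algebra_simps)
  moreover have "4 * (K - 1)\<^sup>2 + (4 * K - 3) * (10 * K - 9) \<le> 44 * K\<^sup>2"
    using K by (simp add: power2_eq_square algebra_simps)
  moreover have "\<rho> * (\<rho> - 10 * K\<^sup>2 + 9) \<ge> (119/10 * K\<^sup>2) * 9"
    using \<rho>K K2 by (intro mult_mono) auto
  ultimately show False using K2 by linarith
qed

text \<open>The hub of the forest part is adjacent to everything in \<open>E\<close>. Two-step walks
  from the largest other vertex bound \<open>M\<close> in terms of \<open>x a\<close>; two-step
  walks from \<open>a\<close>, compared with \<open>\<rho>\<^sup>2 \<ge> card V - 1\<close>, bound
  \<open>card R * x a\<close> in terms of \<open>M\<close>. Both together leave no room for a
  non-neighbour. The hub is chosen by the Perron vector of the forest, so its entry in that of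
  \<open>E\<close> is not known to be the largest.\<close>

lemma hub_dominates:
  fixes V :: "'a set" and k :: nat
  assumes V: "finite V" "\<Union>E \<subseteq> V" and E: "edge_set E" and k: "k \<ge> 1" and n: "144 * k ^ 4 \<le> card V"
    and np: "\<not> packs E k"
    and loc: "\<And>a. a \<in> V \<Longrightarrow> card {e \<in> E. e \<subseteq> nb E a} \<le> 3 * (k - 1)"
  defines "\<rho> \<equiv> spectral_radius (V, E)"
  assumes \<rho>0: "0 \<le> \<rho>" and \<rho>n: "real (card V) - 1 \<le> \<rho>\<^sup>2"
  shows "\<exists>a\<in>V. nb E a = V - {a}"
proof -
  define K where "K = real k"
  define d where "d = 2 * (k - 1)"
  have dK: "real d = 2 * (K - 1)" using k by (simp add: d_def K_def of_nat_diff)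
  have "144 * 1 \<le> 144 * k ^ 4" using k by simp
  then have V2: "144 \<le> card V" using n by linarith
  then have Vne: "V \<noteq> {}" by auto
  have nR: "144 * K ^ 4 \<le> real (card V)"
    using n unfolding K_def by (metis of_nat_le_iff of_nat_mult of_nat_numeral of_nat_power)
  have \<rho>b: "\<rho> \<ge> 119/10 * K\<^sup>2" using hub_radius_bound[OF k _ \<rho>n \<rho>0] nR by (simp add: K_def)
  obtain F where F: "F \<subseteq> E" "acyclic_edges F" "\<And>v. card (nb (E - F) v) \<le> d"
    using forest_decomposition[OF E np] unfolding d_def by blast
  have FE: "edge_set F" using edge_set_subset[OF E F(1)] .
  have FV: "\<Union>F \<subseteq> V" using F(1) V(2) by blast
  define \<rho>F where "\<rho>F = spectral_radius (V, F)"
  have \<rho>F: "\<rho> - 2 * (K - 1) \<le> \<rho>F"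
    using spectral_radius_forest_part[OF V(1) Vne V(2) E F(1,3)] dK by (simp add: \<rho>_def \<rho>F_def)
  have K1: "K \<ge> 1" "K\<^sup>2 \<ge> K" using k by (auto simp: K_def power2_eq_square)
  have \<rho>K: "\<rho> \<ge> 119/10 * K" by (rule order_trans[OF _ \<rho>b]) (use K1 in simp)
  have "0 < 119/10 * K - 2 * (K - 1)" using K1(1) by simp
  also have "\<dots> \<le> \<rho> - 2 * (K - 1)" using \<rho>K by simp
  also have "\<dots> \<le> \<rho>F" by (rule \<rho>F)
  finally have \<rho>F0: "\<rho>F > 0" .
  obtain a where a: "a \<in> V" and ha: "\<rho>F\<^sup>2 \<le> card (nb F a) + 2 * (real (card V) - 1 - card (nb F a)) / \<rho>F"
    using forest_hub[OF V(1) Vne FV FE F(2)] \<rho>F0 unfolding \<rho>F_def by blast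
  define F' where "F' = {e \<in> F. a \<notin> e}"
  define r where "r = real (card V) - 1 - card (nb F a)"
  have F'E: "edge_set F'" using FE by (rule edge_set_subset) (auto simp: F'_def)
  have "card F' + card (nb F a) + 1 \<le> card V"
    using acyclic_card[OF FE F(2) V(1) Vne FV] card_avoiding[OF FE, of a] by (simp add: F'_def)
  then have F'r: "real (card F') \<le> r" by (simp add: r_def)
  have r: "r \<le> 5 * (K - 1) * \<rho>"
    using hub_defect_bound[OF k _ \<rho>n _ ha] \<rho>b \<rho>F F'r unfolding K_def r_def by simp
  have finE: "finite (nb E u)" "finite (nb F u)" "finite (nb (E - F) u)" "finite (nb F' u)" for u
    using finite_nb[OF E] finite_nb[OF FE] finite_nb[OF edge_set_subset[OF E Diff_subset]] finite_nb[OF F'E] by auto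
  have nbsplit: "nb E u = nb F u \<union> nb (E - F) u" for u
  proof -
    have "E = F \<union> (E - F)" using F(1) by blast
    then show ?thesis using nb_Un[of F "E - F" u] by simp
  qed
  note nbV = nb_subset[OF V(2)]
  have degE: "card (nb E u - {a}) \<le> card (nb F' u) + d" if "u \<noteq> a" for u
  proof -
    have "nb E u - {a} \<subseteq> nb F' u \<union> nb (E - F) u"
      using nbsplit[of u] nb_avoiding[OF that, of F] by (auto simp: F'_def)
    then have "card (nb E u - {a}) \<le> card (nb F' u \<union> nb (E - F) u)" using finE by (intro card_mono) auto
    also have "\<dots> \<le> card (nb F' u) + card (nb (E - F) u)" by (rule card_Un_le)
    finally show ?thesis using F(3)[of u] by linarith
  qed
  \<comment> \<open>One common neighbour in the forest, and at most \<open>d\<close> from each of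
    the two deleted neighbourhoods. This \<open>1 + 2 * d\<close> is \<open>4 * K - 3\<close>
    below.\<close>
  have common: "card (nb E w \<inter> nb E a) \<le> 1 + 2 * d" if "w \<noteq> a" for w
  proof -
    have "nb E w \<inter> nb E a \<subseteq> (nb F w \<inter> nb F a) \<union> (nb (E - F) w \<union> nb (E - F) a)"
      using nbsplit by auto
    then have "card (nb E w \<inter> nb E a) \<le> card ((nb F w \<inter> nb F a) \<union> (nb (E - F) w \<union> nb (E - F) a))"
      using finE by (intro card_mono) auto
    also have "\<dots> \<le> card (nb F w \<inter> nb F a) + (card (nb (E - F) w) + card (nb (E - F) a))"
      by (meson add_left_mono card_Un_le order_trans)
    finally show ?thesis using acyclic_common_nb[OF FE F(2) that] F(3)[of w] F(3)[of a] by linarith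
  qed
  obtain x where x: "\<And>v. 0 \<le> x v" "\<exists>v\<in>V. x v \<noteq> 0" "\<And>u. u \<in> V \<Longrightarrow> (\<Sum>v\<in>nb E u. x v) = \<rho> * x u"
    by (rule perron_nb[OF V(1) Vne V(2), folded \<rho>_def]) (rule that; assumption)
  have "card (V - {a}) \<ge> 143" using V2 a V(1) by simp
  then have V'ne: "V - {a} \<noteq> {}" by (metis card.empty not_numeral_le_zero)
  obtain w where w: "w \<in> V - {a}" and wmax: "\<And>v. v \<in> V - {a} \<Longrightarrow> x v \<le> x w"
    using Max_entry[of "V - {a}" x] V(1) V'ne by blast
  define M where "M = x w"
  have M0: "M \<ge> 0" using x(1) by (simp add: M_def)
  have wa: "w \<noteq> a" "w \<in> V" using w by auto
  have pos: "0 < M \<or> 0 < x a"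
  proof -
    obtain v where v: "v \<in> V" "x v \<noteq> 0" using x(2) by blast
    then have "x v > 0" using x(1)[of v] by simp
    then show ?thesis using wmax[of v] v(1) by (cases "v = a") (auto simp: M_def)
  qed
  have row: "(\<Sum>v\<in>nb E u. x v) \<le> (if u \<in> nb E a then x a else 0) + card (nb E u - {a}) * M" for u
  proof -
    have "(\<Sum>v\<in>nb E u - {a}. x v) \<le> (\<Sum>v\<in>nb E u - {a}. M)"
      using wmax nbV[of u] by (intro sum_mono) (auto simp: M_def)
    moreover have "(\<Sum>v\<in>nb E u. x v) = (if u \<in> nb E a then x a else 0) + (\<Sum>v\<in>nb E u - {a}. x v)"
    proof (cases "u \<in> nb E a")
      case True
      then have "a \<in> nb E u" by (simp add: nb_sym)
      then show ?thesis using True finE by (simp add: sum.remove)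
    next
      case False
      then have "a \<notin> nb E u" by (simp add: nb_sym)
      then show ?thesis using False by simp
    qed
    ultimately show ?thesis by simp
  qed
  \<comment> \<open>Two-step walks from \<open>w\<close>: those through \<open>a\<close> contribute
    at most \<open>\<rho> * x a\<close>, at most \<open>4 * K - 3\<close> of the others end in
    \<open>a\<close>, and the rest end in entries at most \<open>M\<close> and are counted by the
    forest edges off \<open>a\<close> and by \<open>d\<close>.\<close>
  have Mbound: "M * (\<rho>\<^sup>2 - (2 * r + 2 * (K - 1) * (r + 2 * (K - 1)))) \<le> (\<rho> + (4 * K - 3)) * x a"
  proof -
    have A: "\<rho> * M \<le> x a + (\<Sum>u\<in>nb E w - {a}. x u)"
    proof -
      have "\<rho> * M = (\<Sum>u\<in>nb E w. x u)" using x(3)[OF wa(2)] by (simp add: M_def)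
      also have "\<dots> \<le> (\<Sum>u\<in>insert a (nb E w - {a}). x u)" using finE x(1) by (intro sum_mono2) auto
      also have "\<dots> = x a + (\<Sum>u\<in>nb E w - {a}. x u)" using finE by (subst sum.insert) auto
      finally show ?thesis .
    qed
    have "\<rho>\<^sup>2 * M = \<rho> * (\<rho> * M)" by (simp add: power2_eq_square)
    also have "\<dots> \<le> \<rho> * (x a + (\<Sum>u\<in>nb E w - {a}. x u))" using A \<rho>0 by (rule mult_left_mono)
    also have "\<dots> = \<rho> * x a + (\<Sum>u\<in>nb E w - {a}. \<rho> * x u)" by (simp add: distrib_left sum_distrib_left)
    also have "(\<Sum>u\<in>nb E w - {a}. \<rho> * x u) = (\<Sum>u\<in>nb E w - {a}. \<Sum>v\<in>nb E u. x v)"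
      using x(3) nbV[of w] by (intro sum.cong) auto
    also have "\<dots> \<le> (\<Sum>u\<in>nb E w - {a}. (if u \<in> nb E a then x a else 0) + card (nb E u - {a}) * M)"
      by (intro sum_mono row)
    also have "\<dots> = (\<Sum>u\<in>nb E w - {a}. if u \<in> nb E a then x a else 0) + (\<Sum>u\<in>nb E w - {a}. real (card (nb E u - {a}))) * M"
      by (simp add: sum.distrib sum_distrib_right)
    also have "(\<Sum>u\<in>nb E w - {a}. if u \<in> nb E a then x a else 0) \<le> (4 * K - 3) * x a"
    proof -
      have "(\<Sum>u\<in>nb E w - {a}. if u \<in> nb E a then x a else 0) = card ((nb E w - {a}) \<inter> nb E a) * x a"
        using finE by (simp add: sum.If_cases)
      also have "\<dots> \<le> (1 + 2 * d) * x a"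
      proof (rule mult_right_mono)
        have "card ((nb E w - {a}) \<inter> nb E a) \<le> card (nb E w \<inter> nb E a)" using finE by (intro card_mono) auto
        then show "real (card ((nb E w - {a}) \<inter> nb E a)) \<le> real (1 + 2 * d)" using common[OF wa(1)] by linarith
      qed (rule x(1))
      finally show ?thesis using dK by (simp add: algebra_simps)
    qed
    also have "(\<Sum>u\<in>nb E w - {a}. real (card (nb E u - {a}))) * M \<le> (2 * r + d * (r + d)) * M"
    proof (rule mult_right_mono[OF _ M0])
      have "(\<Sum>u\<in>nb E w - {a}. real (card (nb E u - {a}))) \<le> (\<Sum>u\<in>nb E w - {a}. real (card (nb F' u)) + d)"
        using degE by (intro sum_mono) (metis Diff_iff insertI1 of_nat_add of_nat_le_iff)
      also have "\<dots> = real (\<Sum>u\<in>nb E w - {a}. card (nb F' u)) + d * real (card (nb E w - {a}))"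
        by (simp add: sum.distrib)
      also have "real (\<Sum>u\<in>nb E w - {a}. card (nb F' u)) \<le> real (2 * card F')"
        using sum_card_incident_le[OF F'E, of "nb E w - {a}"] finE by (simp del: of_nat_sum)
      also have "real (2 * card F') \<le> 2 * r" using F'r by simp
      also have "real (card (nb E w - {a})) \<le> r + d"
        using degE[OF wa(1)] card_nb_le[OF F'E, of w] F'r by linarith
      finally show "(\<Sum>u\<in>nb E w - {a}. real (card (nb E u - {a}))) \<le> 2 * r + d * (r + d)"
        by (simp add: mult_left_mono)
    qed
    finally have "\<rho>\<^sup>2 * M \<le> \<rho> * x a + ((4 * K - 3) * x a + (2 * r + d * (r + d)) * M)" by simp
    then show ?thesis using dK by (simp add: algebra_simps)
  qed
  define R where "R = V - {a} - nb E a"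
  have aR: "a \<notin> nb E a" using edge_set_neq[OF E, of a a] by (auto simp: nb_def)
  have finR: "finite R" using V(1) by (simp add: R_def)
  have cardR: "real (card V) - 1 = card (nb E a) + card R"
  proof -
    have "V = insert a (nb E a \<union> R)" using a nbV[of a] by (auto simp: R_def)
    then have "card V = card (insert a (nb E a \<union> R))" by simp
    also have "\<dots> = 1 + card (nb E a \<union> R)" using aR finE finR by (subst card_insert_disjoint) (auto simp: R_def)
    also have "card (nb E a \<union> R) = card (nb E a) + card R" using finE finR by (intro card_Un_disjoint) (auto simp: R_def)
    finally show ?thesis by simp
  qed
  \<comment> \<open>At most \<open>3 * (k - 1)\<close> edges inside the neighbourhood are counted
    from both ends, and each vertex of \<open>R\<close> has at most \<open>1 + 2 * d\<close>
    neighbours there.\<close>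
  have inner: "(\<Sum>u\<in>nb E a. card (nb E u - {a})) \<le> 6 * (k - 1) + (1 + 2 * d) * card R"
  proof -
    define EA where "EA = {e \<in> E. e \<subseteq> nb E a}"
    have EA: "edge_set EA" using E by (rule edge_set_subset) (auto simp: EA_def)
    have sp: "card (nb E u - {a}) = card (nb EA u) + card (nb E u \<inter> R)" if u: "u \<in> nb E a" for u
    proof -
      have eq: "nb E u - {a} = nb EA u \<union> (nb E u \<inter> R)"
        using u nbV[of u] aR by (auto simp: EA_def nb_def R_def)
      have dj: "nb EA u \<inter> (nb E u \<inter> R) = {}" by (auto simp: EA_def nb_def R_def)
      show ?thesis unfolding eq using finite_nb[OF EA] finE dj by (intro card_Un_disjoint) auto
    qed
    have "(\<Sum>u\<in>nb E a. card (nb E u - {a})) = (\<Sum>u\<in>nb E a. card (nb EA u)) + (\<Sum>u\<in>nb E a. card (nb E u \<inter> R))"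
      using sp by (simp add: sum.distrib)
    also have "(\<Sum>u\<in>nb E a. card (nb EA u)) \<le> 2 * card EA" using sum_card_incident_le[OF EA] finE by blast
    also have "(\<Sum>u\<in>nb E a. card (nb E u \<inter> R)) = (\<Sum>v\<in>R. card (nb E v \<inter> nb E a))"
      using sum_nb_swap[of "nb E a" R "\<lambda>u v. 1::nat" E] finE finR by simp
    also have "\<dots> \<le> (\<Sum>v\<in>R. 1 + 2 * d)"
      by (intro sum_mono common) (auto simp: R_def)
    finally show ?thesis using loc[OF a] by (simp add: EA_def algebra_simps)
  qed
  have Rbound: "card R * x a \<le> M * (6 * (K - 1) + (4 * K - 3) * card R)"
  proof -
    have "\<rho>\<^sup>2 * x a = \<rho> * (\<Sum>u\<in>nb E a. x u)" using x(3)[OF a] by (simp add: power2_eq_square)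
    also have "\<dots> = (\<Sum>u\<in>nb E a. \<Sum>v\<in>nb E u. x v)"
      using x(3) nbV[of a] by (simp add: sum_distrib_left subset_eq)
    also have "\<dots> \<le> (\<Sum>u\<in>nb E a. (if u \<in> nb E a then x a else 0) + card (nb E u - {a}) * M)"
      by (intro sum_mono row)
    also have "\<dots> = card (nb E a) * x a + real (\<Sum>u\<in>nb E a. card (nb E u - {a})) * M"
      by (simp add: sum.distrib sum_distrib_right)
    also have "\<dots> \<le> card (nb E a) * x a + real (6 * (k - 1) + (1 + 2 * d) * card R) * M"
      by (intro add_left_mono mult_right_mono of_nat_mono inner M0)
    also have "real (6 * (k - 1) + (1 + 2 * d) * card R) = 6 * (K - 1) + (4 * K - 3) * card R"
    proof -
      have "real (1 + 2 * d) = 4 * K - 3" using dK by simp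
      moreover have "real (6 * (k - 1)) = 6 * (K - 1)" using k by (simp add: K_def of_nat_diff)
      ultimately show ?thesis by (metis of_nat_add of_nat_mult)
    qed
    finally have up: "\<rho>\<^sup>2 * x a \<le> card (nb E a) * x a + (6 * (K - 1) + (4 * K - 3) * card R) * M" .
    \<comment> \<open>This is where a non-neighbour costs a full \<open>x a\<close>: the lower bound
      on \<open>\<rho>\<^sup>2\<close> counts it, whereas no walk from \<open>a\<close> returns
      through it.\<close>
    have "(card (nb E a) + card R) * x a \<le> \<rho>\<^sup>2 * x a"
      using \<rho>n cardR x(1) by (intro mult_right_mono) auto
    then show ?thesis using up by (simp add: algebra_simps)
  qed
  have "R = {}"
  proof (rule ccontr)
    assume "R \<noteq> {}"
    then have "card R \<noteq> 0" using finR by simp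
    then have R1: "real (card R) \<ge> 1" by simp
    show False
      using hub_final_contradiction[OF k _ _ M0 _ R1 _ pos, of \<rho> r] \<rho>b r Mbound Rbound unfolding K_def by blast
  qed
  then have "nb E a = V - {a}" using nbV[of a] aR by (auto simp: R_def)
  then show ?thesis using a by blast
qed

section \<open>Comparison with the extremal graph\<close>

text \<open>With the entry at \<open>a\<close> scaled to 1, every other vertex satisfies
  \<open>\<rho> * z v = 1 + (\<Sum>u\<in>nb H v. z u)\<close>. Iteration expands the excess
  \<open>q\<close> over a star in powers of 1/\<rho>, where \<open>S1\<close> and \<open>S2\<close>
  count the walks with one and two edges in \<open>H\<close>. The lower bound drops longer walks and
  is meant for the extremal graph; the upper bounds control them and are meant for
  \<open>G\<close>.\<close>

lemma dominating_vertex_expansion: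
  fixes V :: "'a set"
  assumes V: "finite V" "\<Union>E \<subseteq> V" "2 \<le> card V" and E: "edge_set E" and a: "a \<in> V" "nb E a = V - {a}"
  defines "\<rho> \<equiv> spectral_radius (V, E)"
  defines "H \<equiv> {e \<in> E. a \<notin> e}"
  defines "q \<equiv> \<rho>\<^sup>2 - (real (card V) - 1)"
  defines "S1 \<equiv> \<Sum>v\<in>V - {a}. real (card (nb H v))"
  defines "S2 \<equiv> \<Sum>v\<in>V - {a}. (real (card (nb H v)))\<^sup>2"
  shows "\<rho> > 0" "q \<ge> 0" "\<rho> * S1 + S2 \<le> \<rho>\<^sup>2 * q" "\<rho>\<^sup>2 * q \<le> \<rho> * S1 + S2 + S1 * q"
    "(\<rho> - card H) * q \<le> S1"
proof -
  have Vne: "V \<noteq> {}" using a by blast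
  define V' where "V' = V - {a}"
  have V': "finite V'" using V by (simp add: V'_def)
  have cV': "real (card V') = real (card V) - 1" using V a by (simp add: V'_def of_nat_diff)
  have V'ne: "V' \<noteq> {}"
  proof
    assume "V' = {}"
    then show False using cV' V(3) by simp
  qed
  have HE: "edge_set H" using E by (rule edge_set_subset) (auto simp: H_def)
  have HV: "\<Union>H \<subseteq> V'" using V(2) by (auto simp: H_def V'_def)
  obtain x where x: "\<And>v. 0 \<le> x v" "\<exists>v\<in>V. x v \<noteq> 0" "\<And>u. u \<in> V \<Longrightarrow> (\<Sum>v\<in>nb E u. x v) = \<rho> * x u"
    by (rule perron_nb[OF V(1) Vne V(2), folded \<rho>_def]) (rule that; assumption)
  have xa: "x a > 0"
  proof (rule ccontr)
    assume "\<not> x a > 0"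
    then have xa0: "x a = 0" using x(1)[of a] by simp
    have "(\<Sum>v\<in>V'. x v) = 0" using x(3)[OF a(1)] a(2) xa0 by (simp add: V'_def)
    then have "\<forall>v\<in>V'. x v = 0" using V' x(1) by (simp add: sum_nonneg_eq_0_iff)
    then show False using x(2) xa0 by (auto simp: V'_def)
  qed
  define z where "z = (\<lambda>v. x v / x a)"
  have z0: "0 \<le> z v" for v using x(1) xa by (simp add: z_def)
  have Z1: "(\<Sum>v\<in>V'. z v) = \<rho>"
    using x(3)[OF a(1)] a(2) xa by (simp add: z_def V'_def sum_divide_distrib[symmetric])
  have Z2: "\<rho> * z v = 1 + (\<Sum>u\<in>nb H v. z u)" if v: "v \<in> V'" for v
  proof -
    have va: "v \<noteq> a" "v \<in> V" using v by (auto simp: V'_def)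
    have "v \<in> nb E a" using va a(2) by blast
    then have "a \<in> nb E v" by (simp add: nb_sym)
    moreover have "nb H v = nb E v - {a}" unfolding H_def by (rule nb_avoiding[OF va(1)])
    ultimately have "(\<Sum>u\<in>nb E v. x u) = x a + (\<Sum>u\<in>nb H v. x u)"
      using finite_nb[OF E] by (simp add: sum.remove)
    then have "\<rho> * x v = x a + (\<Sum>u\<in>nb H v. x u)" using x(3)[OF va(2)] by simp
    then show ?thesis using xa by (simp add: z_def sum_divide_distrib[symmetric] field_simps)
  qed
  have \<rho>0: "\<rho> \<ge> 0" using Z1 z0 by (metis sum_nonneg)
  obtain v0 where v0: "v0 \<in> V'" using V'ne by blast
  have "(\<Sum>u\<in>nb H v0. z u) \<ge> 0" using z0 by (intro sum_nonneg) auto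
  then have "\<rho> * z v0 \<ge> 1" using Z2[OF v0] by simp
  then have "\<rho> \<noteq> 0" by auto
  then show \<rho>: "\<rho> > 0" using \<rho>0 by simp
  \<comment> \<open>Symmetry moves the neighbour sum from \<open>z\<close> to the weight. The
    weights 1, \<open>h\<close> and \<open>D\<close> give the successive terms of the
    expansion.\<close>
  have weighted: "\<rho> * (\<Sum>v\<in>V'. g v * z v) = (\<Sum>v\<in>V'. g v) + (\<Sum>u\<in>V'. (\<Sum>v\<in>nb H u. g v) * z u)" for g
  proof -
    have "\<rho> * (\<Sum>v\<in>V'. g v * z v) = (\<Sum>v\<in>V'. g v * (\<rho> * z v))" by (simp add: sum_distrib_left mult_ac)
    also have "\<dots> = (\<Sum>v\<in>V'. g v + (\<Sum>u\<in>nb H v. g v * z u))"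
      by (intro sum.cong refl) (simp add: Z2 distrib_left sum_distrib_left)
    also have "\<dots> = (\<Sum>v\<in>V'. g v) + (\<Sum>v\<in>V'. \<Sum>u\<in>nb H v. g v * z u)" by (simp add: sum.distrib)
    also have "(\<Sum>v\<in>V'. \<Sum>u\<in>nb H v. g v * z u) = (\<Sum>u\<in>V'. \<Sum>v\<in>nb H u. g v * z u)"
      by (rule sum_nb_sym[OF V' HV])
    finally show ?thesis by (simp add: sum_distrib_right)
  qed
  define h where "h = (\<lambda>v. real (card (nb H v)))"
  define D where "D = (\<lambda>u. \<Sum>v\<in>nb H u. h v)"
  have h0: "h v \<ge> 0" for v by (simp add: h_def)
  have D0: "D v \<ge> 0" for v using h0 by (simp add: D_def sum_nonneg)
  have S1: "S1 = (\<Sum>v\<in>V'. h v)" and S2: "S2 = (\<Sum>v\<in>V'. (h v)\<^sup>2)" by (simp_all add: S1_def S2_def h_def V'_def)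
  have q: "q = (\<Sum>u\<in>V'. h u * z u)"
  proof -
    have "\<rho> * \<rho> = card V' + (\<Sum>u\<in>V'. h u * z u)"
      using weighted[of "\<lambda>v. 1"] Z1 by (simp add: h_def)
    then show ?thesis using cV' by (simp add: q_def power2_eq_square)
  qed
  show q0: "q \<ge> 0" unfolding q using h0 z0 by (intro sum_nonneg) simp
  define P where "P = (\<Sum>u\<in>V'. D u * z u)"
  have q1: "\<rho> * q = S1 + P" using weighted[of h] by (simp add: q S1 P_def D_def)
  have sumD: "(\<Sum>u\<in>V'. D u) = S2"
  proof -
    have "(\<Sum>u\<in>V'. D u) = (\<Sum>v\<in>V'. \<Sum>u\<in>nb H v. h v)"
      unfolding D_def by (rule sum_nb_sym[OF V' HV])
    then show ?thesis by (simp add: S2 h_def power2_eq_square)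
  qed
  have P1: "\<rho> * P = S2 + (\<Sum>u\<in>V'. (\<Sum>v\<in>nb H u. D v) * z u)"
    using weighted[of D] by (simp add: P_def sumD)
  have "0 \<le> (\<Sum>u\<in>V'. (\<Sum>v\<in>nb H u. D v) * z u)" using D0 z0 by (intro sum_nonneg mult_nonneg_nonneg) auto
  then have Plow: "\<rho> * P \<ge> S2" using P1 by simp
  have D2: "D v \<le> S1" if "v \<in> V'" for v
    unfolding D_def S1 using nb_subset[OF HV] V' h0 by (intro sum_mono2) auto
  have "(\<Sum>u\<in>V'. (\<Sum>v\<in>nb H u. D v) * z u) \<le> (\<Sum>u\<in>V'. (h u * S1) * z u)"
  proof (intro sum_mono mult_right_mono)
    fix u
    have "(\<Sum>v\<in>nb H u. D v) \<le> (\<Sum>v\<in>nb H u. S1)" using D2 nb_subset[OF HV] by (intro sum_mono) blast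
    then show "(\<Sum>v\<in>nb H u. D v) \<le> h u * S1" by (simp add: h_def)
  qed (rule z0)
  also have "\<dots> = S1 * q" by (simp add: q sum_distrib_left mult_ac)
  finally have Pup: "\<rho> * P \<le> S2 + S1 * q" using P1 by simp
  have qq: "\<rho>\<^sup>2 * q = \<rho> * S1 + \<rho> * P"
  proof -
    have "\<rho>\<^sup>2 * q = \<rho> * (\<rho> * q)" by (simp add: power2_eq_square)
    then show ?thesis unfolding q1 by (simp add: distrib_left)
  qed
  show "\<rho> * S1 + S2 \<le> \<rho>\<^sup>2 * q" using qq Plow by simp
  show "\<rho>\<^sup>2 * q \<le> \<rho> * S1 + S2 + S1 * q" using qq Pup by simp
  \<comment> \<open>The expansion does not bound \<open>q\<close> itself. At the largest entry,
    \<open>\<rho> * z m \<le> 1 + card H * z m\<close>, which bounds all entries and hence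
    \<open>q\<close>.\<close>
  obtain m where m: "m \<in> V'" "\<And>v. v \<in> V' \<Longrightarrow> z v \<le> z m" using Max_entry[OF V' V'ne] by metis
  have "(\<Sum>u\<in>nb H m. z u) \<le> (\<Sum>u\<in>nb H m. z m)" using m(2) nb_subset[OF HV] by (intro sum_mono) blast
  also have "\<dots> = card (nb H m) * z m" by simp
  also have "\<dots> \<le> card H * z m" using card_nb_le[OF HE] z0 by (intro mult_right_mono) auto
  finally have zm: "(\<rho> - card H) * z m \<le> 1" using Z2[OF m(1)] by (simp add: algebra_simps)
  have S10: "S1 \<ge> 0" unfolding S1 using h0 by (intro sum_nonneg) auto
  show "(\<rho> - card H) * q \<le> S1"
  proof (cases "\<rho> \<ge> card H")
    case True
    have "q \<le> (\<Sum>u\<in>V'. h u * z m)" unfolding q using m(2) h0 by (intro sum_mono mult_left_mono) auto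
    then have "q \<le> S1 * z m" by (simp add: S1 sum_distrib_right)
    then have "(\<rho> - card H) * q \<le> (\<rho> - card H) * (S1 * z m)" using True by (intro mult_left_mono) auto
    also have "\<dots> = S1 * ((\<rho> - card H) * z m)" by (simp add: mult_ac)
    also have "\<dots> \<le> S1 * 1" using zm S10 by (intro mult_left_mono) auto
    finally show ?thesis by simp
  next
    case False
    then have "(\<rho> - card H) * q \<le> 0" using q0 by (simp add: mult_nonpos_nonneg)
    then show ?thesis using S10 by linarith
  qed
qed

text \<open>Here \<open>n\<close> stands for the number of vertices minus one; \<open>e\<close> and
  \<open>S2\<close> belong to the graph around the hub of \<open>G\<close>. With
  \<open>e = 3 * t\<close> the deficit 8 would have to be made up by \<open>6 * t * q\<close>, where
  \<open>q\<close> is about \<open>6 * t / \<rho>\<close> at most; with fewer edges the deficit is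
  of order \<rho>. Both fail when \<rho> is at least
  \<open>119/10 * (t + 1)\<^sup>2\<close>.\<close>

lemma extremal_comparison:
  fixes \<rho> \<sigma> n S2 :: real and k e :: nat
  assumes k: "k \<ge> 1" and le: "0 < \<sigma>" "\<sigma> \<le> \<rho>" and big: "\<rho> \<ge> 119/10 * (real k)\<^sup>2"
  defines "t \<equiv> real (k - 1)"
  assumes ext: "6 * t * \<sigma> + (4 * t\<^sup>2 + 8 * t) \<le> \<sigma>\<^sup>2 * (\<sigma>\<^sup>2 - n)"
    and G: "0 \<le> \<rho>\<^sup>2 - n" "\<rho>\<^sup>2 * (\<rho>\<^sup>2 - n) \<le> \<rho> * (2 * e) + S2 + (2 * e) * (\<rho>\<^sup>2 - n)"
      "(\<rho> - e) * (\<rho>\<^sup>2 - n) \<le> 2 * e"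
    and e: "e \<le> 3 * (k - 1)" "e = 3 * (k - 1) \<Longrightarrow> S2 + 8 \<le> 4 * t\<^sup>2 + 8 * t"
  shows False
proof -
  define q where "q = \<rho>\<^sup>2 - n"
  have t0: "t \<ge> 0" by (simp add: t_def)
  have tk: "t + 1 = real k" using k by (simp add: t_def of_nat_diff)
  have big': "\<rho> \<ge> 119/10 * (t + 1)\<^sup>2" using big tk by simp
  then have big'': "\<rho> \<ge> 119/10 * t\<^sup>2 + 119/5 * t + 119/10" by (simp add: power2_eq_square algebra_simps)
  have t2: "0 \<le> t\<^sup>2" by simp
  have rt: "\<rho> - 3 * t > 0" using big'' t0 t2 by linarith
  have \<rho>0: "\<rho> > 0" using le by linarith
  have q0: "q \<ge> 0" using G(1) by (simp add: q_def)
  have qs: "\<sigma>\<^sup>2 - n \<le> q" unfolding q_def using le by (simp add: power_mono)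
  \<comment> \<open>Rescales \<open>ext\<close> from \<sigma> to \<rho>: its left side grows by at
    most \<open>s\<^sup>2\<close>, exactly the factor between \<open>\<sigma>\<^sup>2\<close> and
    \<open>\<rho>\<^sup>2\<close>.\<close>
  define s where "s = \<rho> / \<sigma>"
  have s: "s \<ge> 1" "\<rho> = s * \<sigma>" using le by (auto simp: s_def)
  define c where "c = 4 * t\<^sup>2 + 8 * t"
  have c0: "c \<ge> 0" using t0 by (simp add: c_def)
  have low: "6 * t * \<rho> + c \<le> \<rho>\<^sup>2 * q"
  proof -
    have "6 * t * \<rho> + c \<le> s\<^sup>2 * (6 * t * \<sigma> + c)"
    proof -
      have "s \<le> s\<^sup>2" "1 \<le> s\<^sup>2" using s(1) by (simp_all add: power2_eq_square mult_ge1_I)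
      then have "s * (6 * t * \<sigma>) \<le> s\<^sup>2 * (6 * t * \<sigma>)" "1 * c \<le> s\<^sup>2 * c"
        using t0 le c0 by (intro mult_right_mono; simp)+
      then show ?thesis using s(2) by (simp add: algebra_simps)
    qed
    also have "\<dots> \<le> s\<^sup>2 * (\<sigma>\<^sup>2 * (\<sigma>\<^sup>2 - n))" using ext by (intro mult_left_mono) (auto simp: c_def)
    also have "\<dots> = \<rho>\<^sup>2 * (\<sigma>\<^sup>2 - n)" by (simp add: s(2) power_mult_distrib)
    also have "\<dots> \<le> \<rho>\<^sup>2 * q" using qs by (intro mult_left_mono) auto
    finally show ?thesis .
  qed
  have e3: "real e \<le> 3 * t" using e(1) by (simp add: t_def)
  show False
  proof (cases "e = 3 * (k - 1)")
    case True
    then have ee: "real e = 3 * t" by (simp add: t_def)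
    have "\<rho>\<^sup>2 * q \<le> \<rho> * (6 * t) + S2 + (6 * t) * q" using G(2) ee by (simp add: q_def)
    moreover have "\<rho> * (6 * t) = 6 * t * \<rho>" by simp
    ultimately have "8 \<le> 6 * t * q" using low e(2)[OF True] unfolding c_def by linarith
    then have "8 * (\<rho> - 3 * t) \<le> 6 * t * q * (\<rho> - 3 * t)" using rt by (intro mult_right_mono) auto
    also have "\<dots> = 6 * t * ((\<rho> - 3 * t) * q)" by (simp add: mult_ac)
    also have "\<dots> \<le> 6 * t * (6 * t)" using G(3) ee t0 by (intro mult_left_mono) (auto simp: q_def)
    finally have "8 * \<rho> \<le> 36 * t\<^sup>2 + 24 * t" by (simp add: power2_eq_square algebra_simps)
    then show False using big'' t0 t2 by linarith
  next
    case False
    then have "e + 1 \<le> 3 * (k - 1)" using e(1) by simp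
    then have "real (e + 1) \<le> real (3 * (k - 1))" by (rule of_nat_mono)
    then have e1: "real e \<le> 3 * t - 1" by (simp add: t_def)
    have "(\<rho> - 3 * t) * q \<le> (\<rho> - e) * q" using e3 q0 by (intro mult_right_mono) auto
    also have "\<dots> \<le> 6 * t - 2" using G(3) e1 by (simp add: q_def)
    finally have up: "(\<rho> - 3 * t) * q \<le> 6 * t - 2" .
    have "\<rho> * (6 * t) \<le> \<rho> * (\<rho> * q)" using low c0 by (simp add: power2_eq_square mult_ac)
    then have "6 * t \<le> \<rho> * q" using \<rho>0 by simp
    then have "(\<rho> - 3 * t) * (6 * t) \<le> (\<rho> - 3 * t) * (\<rho> * q)" using rt by (intro mult_left_mono) auto
    also have "\<dots> = \<rho> * ((\<rho> - 3 * t) * q)" by (simp add: mult_ac)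
    also have "\<dots> \<le> \<rho> * (6 * t - 2)" using up \<rho>0 by (intro mult_left_mono) auto
    finally have "2 * \<rho> \<le> 18 * t\<^sup>2" by (simp add: power2_eq_square algebra_simps)
    then show False using big'' t0 t2 by linarith
  qed
qed

section \<open>Neighbourhoods in planar graphs\<close>

lemma simple_graph_edge_set:
  assumes "simple_graph G" shows "edge_set (edges G)" "\<Union>(edges G) \<subseteq> verts G" "finite (verts G)"
proof -
  have fin: "finite (verts G)" and e: "\<And>e. e \<in> edges G \<Longrightarrow> \<exists>u v. e = {u, v} \<and> u \<noteq> v \<and> u \<in> verts G \<and> v \<in> verts G"
    using assms unfolding simple_graph_def by simp_all
  show sub: "\<Union>(edges G) \<subseteq> verts G" using e by fastforce
  then have "edges G \<subseteq> Pow (verts G)" by blast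
  then have "finite (edges G)" using fin by (simp add: finite_subset)
  then show "edge_set (edges G)" unfolding edge_set_def using e by metis
  show "finite (verts G)" by (rule fin)
qed

lemma linked_path:
  assumes "links E x y A" and T: "\<Union>E \<subseteq> T"
  obtains P where "P \<noteq> []" "distinct P" "successively (\<lambda>u v. {u, v} \<in> E) P" "set P \<subseteq> A" "set P \<subseteq> T"
    "{x, hd P} \<in> E" "{y, last P} \<in> E"
proof -
  obtain u v where uv: "u \<in> A" "v \<in> A" "{x, u} \<in> E" "{y, v} \<in> E" and c: "conn E A"
    using assms(1) unfolding links_def by metis
  let ?R = "\<lambda>x y. x \<in> A \<and> y \<in> A \<and> {x, y} \<in> E"
  have "?R\<^sup>*\<^sup>* u v" using c uv unfolding conn_def by simp
  then obtain P where P: "P \<noteq> []" "hd P = u" "last P = v" "distinct P" "successively ?R P" "\<forall>z\<in>set P. ?R\<^sup>*\<^sup>* u z"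
    using rtranclp_distinct_path by meson
  have z: "z \<in> A \<and> z \<in> T" if "?R\<^sup>*\<^sup>* u z" for z
    using that
  proof (cases rule: rtranclp.cases)
    case rtrancl_refl
    then show ?thesis using uv(1,3) T by auto
  next
    case (rtrancl_into_rtrancl w)
    then show ?thesis using T by auto
  qed
  have "successively (\<lambda>u v. {u, v} \<in> E) P" using P(5) by (rule successively_mono) simp
  then show thesis using that[of P] P z uv by blast
qed

text \<open>A theta among the neighbours of \<open>a\<close>, together with the edges from
  \<open>a\<close> to the first vertex of each of its three paths, is a subdivided K_{3,3}.\<close>

lemma planar_neighbourhood_no_long_theta:
  assumes G: "simple_graph G" "planar G"
  defines "E \<equiv> edges G"
  shows "\<not> long_theta {e \<in> E. e \<subseteq> nb E a}"
proof
  define EA where "EA = {e \<in> E. e \<subseteq> nb E a}"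
  assume "long_theta {e \<in> E. e \<subseteq> nb E a}"
  then obtain x y A1 A2 A3 where xy: "x \<noteq> y" and L: "links EA x y A1" "links EA x y A2" "links EA x y A3"
    and dis: "A1 \<inter> A2 = {}" "A1 \<inter> A3 = {}" "A2 \<inter> A3 = {}"
    unfolding long_theta_def EA_def by blast
  have E: "edge_set E" using simple_graph_edge_set(1)[OF G(1)] by (simp add: E_def)
  have T: "\<Union>EA \<subseteq> nb E a" by (auto simp: EA_def)
  have ana: "a \<notin> nb E a" using edge_set_neq[OF E, of a a] by (auto simp: nb_def)
  obtain P1 where P1: "P1 \<noteq> []" "distinct P1" "successively (\<lambda>u v. {u, v} \<in> EA) P1" "set P1 \<subseteq> A1" "set P1 \<subseteq> nb E a"
    "{x, hd P1} \<in> EA" "{y, last P1} \<in> EA" by (rule linked_path[OF L(1) T])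
  obtain P2 where P2: "P2 \<noteq> []" "distinct P2" "successively (\<lambda>u v. {u, v} \<in> EA) P2" "set P2 \<subseteq> A2" "set P2 \<subseteq> nb E a"
    "{x, hd P2} \<in> EA" "{y, last P2} \<in> EA" by (rule linked_path[OF L(2) T])
  obtain P3 where P3: "P3 \<noteq> []" "distinct P3" "successively (\<lambda>u v. {u, v} \<in> EA) P3" "set P3 \<subseteq> A3" "set P3 \<subseteq> nb E a"
    "{x, hd P3} \<in> EA" "{y, last P3} \<in> EA" by (rule linked_path[OF L(3) T])
  have xyA: "x \<notin> A1" "y \<notin> A1" "x \<notin> A2" "y \<notin> A2" "x \<notin> A3" "y \<notin> A3" using L by (auto simp: links_def)
  have xa: "x \<noteq> a" "y \<noteq> a" using P1(6,7) T ana by auto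
  have suc: "successively (adj G) P" if "successively (\<lambda>u v. {u, v} \<in> EA) P" for P
    using that by (rule successively_mono) (simp add: adj_def EA_def E_def)
  show False
  proof (rule planar_no_subdivided_K33[OF G, of a x y P1 P2 P3])
    show "distinct [a, x, y]" using xa xy by auto
    have "set P1 \<inter> set P2 = {}" "set P1 \<inter> set P3 = {}" "set P2 \<inter> set P3 = {}" using P1(4) P2(4) P3(4) dis by blast+
    then show "distinct (P1 @ P2 @ P3)" using P1(2) P2(2) P3(2) by auto
    have "a \<notin> set (P1 @ P2 @ P3)" using P1(5) P2(5) P3(5) ana by auto
    moreover have "x \<notin> set (P1 @ P2 @ P3)" "y \<notin> set (P1 @ P2 @ P3)" using P1(4) P2(4) P3(4) xyA by auto
    ultimately show "{a, x, y} \<inter> set (P1 @ P2 @ P3) = {}" by simp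
    show "P1 \<noteq> []" "P2 \<noteq> []" "P3 \<noteq> []" using P1(1) P2(1) P3(1) by auto
    show "successively (adj G) P1" "successively (adj G) P2" "successively (adj G) P3"
      using suc P1(3) P2(3) P3(3) by auto
    have one: "adj G x (hd P) \<and> adj G a (hd P) \<and> adj G (last P) y"
      if "P \<noteq> []" "set P \<subseteq> nb E a" "{x, hd P} \<in> EA" "{y, last P} \<in> EA" for P
    proof -
      have "hd P \<in> nb E a" using that(1,2) by auto
      then show ?thesis using that(3,4) by (simp add: adj_def EA_def E_def nb_def insert_commute)
    qed
    fix P assume "P \<in> {P1, P2, P3}"
    then show "adj G x (hd P) \<and> adj G a (hd P) \<and> adj G (last P) y"
      using one[OF P1(1,5,6,7)] one[OF P2(1,5,6,7)] one[OF P3(1,5,6,7)] by auto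
  qed
qed

text \<open>The cone over \<open>EA\<close> with apex \<open>a\<close> lies in the graph, so
  packings there are packings in \<open>G\<close>. The last claim is rigidity: it speaks of every
  triangle family with triangle-free remainder, as the exchange of triangles requires.\<close>

lemma planar_neighbourhood_edges:
  fixes a :: 'a
  assumes G: "simple_graph G" "planar G" and np: "\<not> packs (edges G) k"
  defines "E \<equiv> edges G" and "EA \<equiv> {e \<in> edges G. e \<subseteq> nb (edges G) a}"
  shows "edge_set EA" "card EA \<le> 3 * (k - 1)"
    "\<And>\<T>. triangle_family EA \<T> \<Longrightarrow> triangle_free (EA - tri_edges \<T>) \<Longrightarrow> card EA = 3 * (k - 1) \<Longrightarrow> EA = tri_edges \<T>"
proof -
  have E: "edge_set E" using simple_graph_edge_set(1)[OF G(1)] by (simp add: E_def)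
  show EA: "edge_set EA" using E by (rule edge_set_subset) (auto simp: E_def EA_def)
  have ana: "a \<notin> nb E a" using edge_set_neq[OF E, of a a] by (auto simp: nb_def)
  then have aEA: "a \<notin> \<Union>EA" by (auto simp: EA_def E_def)
  have nt: "\<not> long_theta EA" using planar_neighbourhood_no_long_theta[OF G] by (simp add: EA_def)
  have "apex a EA \<subseteq> E"
  proof
    fix e assume e: "e \<in> apex a EA"
    then consider "e \<in> EA" | v where "v \<in> \<Union>EA" "e = {a, v}" unfolding apex_def by blast
    then show "e \<in> E"
    proof cases
      case 1 then show ?thesis by (simp add: EA_def E_def)
    next
      case 2
      then have "v \<in> nb E a" by (auto simp: EA_def E_def)
      then show ?thesis using 2 by (simp add: nb_def)
    qed
  qed
  then have np': "\<not> packs (apex a EA) k" using np packs_mono unfolding E_def by blast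
  obtain \<T> where T: "triangle_family EA \<T>" "triangle_free (EA - tri_edges \<T>)" using maximal_triangle_family[OF EA] by blast
  show "card EA \<le> 3 * (k - 1)" using triangle_family_bound(1)[OF EA aEA nt np' T] .
  show "EA = tri_edges \<T>" if "triangle_family EA \<T>" "triangle_free (EA - tri_edges \<T>)" "card EA = 3 * (k - 1)" for \<T>
    using triangle_family_bound(2)[OF EA aEA nt np' that] .
qed

section \<open>The extremal graph\<close>

abbreviation (input) fan_extremal :: "nat \<Rightarrow> nat \<Rightarrow> (unit + (nat + nat)) graph" where
  "fan_extremal t m \<equiv> graph_join K1 (disj_union (friendship t) (empty_graph m))"

lemma fan_extremal_verts:
  "verts (fan_extremal t m) = insert (Inl ()) (Inr ` (Inl ` {0..2*t} \<union> Inr ` {0..<m}))"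
  by (auto simp: graph_join_def disj_union_def K1_def friendship_def empty_graph_def verts_def)

definition friend_adj :: "nat \<Rightarrow> nat \<Rightarrow> nat \<Rightarrow> bool" where
  "friend_adj t i j \<longleftrightarrow> {i, j} \<in> edges (friendship t)"

text \<open>Lying in a common triangle is symmetric in \<open>i\<close> and \<open>j\<close>, and it
  is the form in which the edges of a triangle family appear.\<close>

lemma friend_adj_iff:
  "friend_adj t i j \<longleftrightarrow> i \<noteq> j \<and> (\<exists>l\<in>{1..t}. {i, j} \<subseteq> {0, 2*l - 1, 2*l})"
proof
  assume "friend_adj t i j"
  then consider h where "{i, j} = {0, h}" "1 \<le> h" "h \<le> 2*t" | l where "{i, j} = {2*l - 1, 2*l}" "1 \<le> l" "l \<le> t"
    unfolding friend_adj_def friendship_def edges_def by auto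
  then show "i \<noteq> j \<and> (\<exists>l\<in>{1..t}. {i, j} \<subseteq> {0, 2*l - 1, 2*l})"
  proof cases
    case 1
    have "h = 2 * ((h + 1) div 2) - 1 \<or> h = 2 * ((h + 1) div 2)" "(h + 1) div 2 \<in> {1..t}" using 1 by auto
    moreover have "i \<noteq> j" using 1 by (auto simp: doubleton_eq_iff)
    ultimately show ?thesis unfolding 1(1) by blast
  next
    case 2
    then have "i \<noteq> j" by (auto simp: doubleton_eq_iff)
    moreover have "{i, j} \<subseteq> {0, 2*l - 1, 2*l}" unfolding 2(1) by simp
    ultimately show ?thesis using 2 by auto
  qed
next
  assume R: "i \<noteq> j \<and> (\<exists>l\<in>{1..t}. {i, j} \<subseteq> {0, 2*l - 1, 2*l})"
  then obtain l where "l \<in> {1..t}" "{i, j} \<subseteq> {0, 2*l - 1, 2*l}" by blast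
  then have l: "1 \<le> l" "l \<le> t" "i \<in> {0, 2*l - 1, 2*l}" "j \<in> {0, 2*l - 1, 2*l}" by auto
  have A: "{0, h} \<in> edges (friendship t)" "{h, 0} \<in> edges (friendship t)" if "1 \<le> h" "h \<le> 2*t" for h
    using that by (auto simp: friendship_def edges_def insert_commute)
  have B: "{2*l - 1, 2*l} \<in> edges (friendship t)" "{2*l, 2*l - 1} \<in> edges (friendship t)"
    using l by (auto simp: friendship_def edges_def insert_commute)
  show "friend_adj t i j"
    unfolding friend_adj_def using R l A[of "2*l - 1"] A[of "2*l"] B by auto
qed

lemma Inr_edge_iff: "{Inr u, Inr v} \<in> (\<lambda>e. Inr ` e) ` E \<longleftrightarrow> {u, v} \<in> E"
proof -
  have "{Inr u, Inr v} = Inr ` {u, v}" by simp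
  then show ?thesis by (metis (no_types, lifting) image_iff inj_Inr inj_image_eq_iff)
qed

lemma Inl_edge_iff: "{Inl u, Inl v} \<in> (\<lambda>e. Inl ` e) ` E \<longleftrightarrow> {u, v} \<in> E"
proof -
  have "{Inl u, Inl v} = Inl ` {u, v}" by simp
  then show ?thesis by (metis (no_types, lifting) image_iff inj_Inl inj_image_eq_iff)
qed

lemma edges_disj_union_empty:
  "edges (disj_union (friendship t) (empty_graph m)) = (\<lambda>e. Inl ` e) ` edges (friendship t)"
  by (simp add: disj_union_def empty_graph_def edges_def)

lemma disj_union_empty_edges:
  "{Inl i, Inl j} \<in> edges (disj_union (friendship t) (empty_graph m)) \<longleftrightarrow> friend_adj t i j"
  "{Inr p, w} \<notin> edges (disj_union (friendship t) (empty_graph m))"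
  "{w, Inr p} \<notin> edges (disj_union (friendship t) (empty_graph m))"
proof -
  note e = edges_disj_union_empty
  show "{Inl i, Inl j} \<in> edges (disj_union (friendship t) (empty_graph m)) \<longleftrightarrow> friend_adj t i j"
    unfolding e friend_adj_def by (rule Inl_edge_iff)
  show "{Inr p, w} \<notin> edges (disj_union (friendship t) (empty_graph m))"
    "{w, Inr p} \<notin> edges (disj_union (friendship t) (empty_graph m))"
    unfolding e by auto
qed

lemma fan_extremal_edges:
  "edges (fan_extremal t m) = (\<lambda>e. Inr ` e) ` edges (disj_union (friendship t) (empty_graph m)) \<union>
     {{Inl (), Inr v} | v. v \<in> Inl ` {0..2*t} \<union> Inr ` {0..<m}}"
  by (simp add: graph_join_def K1_def edges_def verts_def disj_union_def friendship_def empty_graph_def)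

lemma fan_extremal_adj:
  "{Inl (), Inl ()} \<notin> edges (fan_extremal t m)"
  "{Inr w, Inr w'} \<in> edges (fan_extremal t m) \<longleftrightarrow> {w, w'} \<in> edges (disj_union (friendship t) (empty_graph m))"
  "{Inl (), Inr w} \<in> edges (fan_extremal t m) \<longleftrightarrow> w \<in> Inl ` {0..2*t} \<union> Inr ` {0..<m}"
  "{Inr w, Inl ()} \<in> edges (fan_extremal t m) \<longleftrightarrow> w \<in> Inl ` {0..2*t} \<union> Inr ` {0..<m}"
proof -
  show "{Inl (), Inl ()} \<notin> edges (fan_extremal t m)"
    unfolding fan_extremal_edges by (auto simp: doubleton_eq_iff)
  show "{Inr w, Inr w'} \<in> edges (fan_extremal t m) \<longleftrightarrow> {w, w'} \<in> edges (disj_union (friendship t) (empty_graph m))"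
    unfolding fan_extremal_edges Un_iff Inr_edge_iff by (auto simp: doubleton_eq_iff)
  show "{Inl (), Inr w} \<in> edges (fan_extremal t m) \<longleftrightarrow> w \<in> Inl ` {0..2*t} \<union> Inr ` {0..<m}"
    unfolding fan_extremal_edges by (auto simp: doubleton_eq_iff)
  then show "{Inr w, Inl ()} \<in> edges (fan_extremal t m) \<longleftrightarrow> w \<in> Inl ` {0..2*t} \<union> Inr ` {0..<m}"
    by (simp add: insert_commute)
qed

lemma fan_extremal_edge_set:
  "edge_set (edges (fan_extremal t m))" "\<Union>(edges (fan_extremal t m)) \<subseteq> verts (fan_extremal t m)"
proof -
  let ?X = "fan_extremal t m"
  have *: "\<exists>u v. u \<noteq> v \<and> e = {u, v} \<and> u \<in> verts ?X \<and> v \<in> verts ?X" if "e \<in> edges ?X" for e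
  proof -
    have "(\<exists>v. v \<in> Inl ` {0..2*t} \<union> Inr ` {0..<m} \<and> e = {Inl (), Inr v}) \<or> (\<exists>f. f \<in> edges (friendship t) \<and> e = Inr ` Inl ` f)"
      using that unfolding fan_extremal_edges edges_disj_union_empty
    proof (elim UnE)
      assume "e \<in> (\<lambda>e. Inr ` e) ` (\<lambda>e. Inl ` e) ` edges (friendship t)"
      then show ?thesis by (elim imageE) (intro disjI2 exI conjI; simp)
    next
      assume "e \<in> {{Inl (), Inr v} | v. v \<in> Inl ` {0..2*t} \<union> Inr ` {0..<m}}"
      then show ?thesis unfolding mem_Collect_eq by metis
    qed
    then consider v where "v \<in> Inl ` {0..2*t} \<union> Inr ` {0..<m}" "e = {Inl (), Inr v}"
      | f where "f \<in> edges (friendship t)" "e = Inr ` Inl ` f"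
      by metis
    then show ?thesis
    proof cases
      case 1
      then have "(Inl () :: unit + (nat + nat)) \<noteq> Inr v" "Inl () \<in> verts ?X" "Inr v \<in> verts ?X"
        unfolding fan_extremal_verts by simp_all
      then show ?thesis using 1(2) by - (rule exI[of _ "Inl ()"], rule exI[of _ "Inr v"], simp)
    next
      case 2
      have "\<exists>i j. f = {i, j} \<and> i \<noteq> j \<and> i \<le> 2*t \<and> j \<le> 2*t"
      proof -
        consider i where "f = {0, i}" "1 \<le> i" "i \<le> 2*t" | j where "f = {2*j - 1, 2*j}" "1 \<le> j" "j \<le> t"
          using 2(1) unfolding friendship_def edges_def snd_conv by blast
        then show ?thesis
        proof cases
          case (1 i) then show ?thesis by - (rule exI[of _ 0], rule exI[of _ i], simp)
        next
          case (2 j) then show ?thesis by - (rule exI[of _ "2*j - 1"], rule exI[of _ "2*j"], simp, arith)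
        qed
      qed
      then obtain i j where "f = {i, j}" "i \<noteq> j" "i \<le> 2*t" "j \<le> 2*t" by (elim exE conjE) (rule that; assumption)
      then have "(Inr (Inl i) :: unit + (nat + nat)) \<noteq> Inr (Inl j)" "e = {Inr (Inl i), Inr (Inl j)}"
        "Inr (Inl i) \<in> verts ?X" "Inr (Inl j) \<in> verts ?X"
        using 2(2) unfolding fan_extremal_verts by simp_all
      then show ?thesis by - (rule exI[of _ "Inr (Inl i)"], rule exI[of _ "Inr (Inl j)"], simp)
    qed
  qed
  show sub: "\<Union>(edges ?X) \<subseteq> verts ?X"
  proof
    fix x assume "x \<in> \<Union>(edges ?X)"
    then obtain e where e: "e \<in> edges ?X" "x \<in> e" by (elim UnionE) (rule that; assumption)
    show "x \<in> verts ?X" using *[OF e(1)] e(2) by (elim exE conjE) (simp, elim disjE; simp)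
  qed
  then have "edges ?X \<subseteq> Pow (verts ?X)" by blast
  moreover have "finite (verts ?X)" unfolding fan_extremal_verts by simp
  ultimately have "finite (edges ?X)" by (simp add: finite_subset)
  then show "edge_set (edges ?X)" unfolding edge_set_def using * by metis
qed

text \<open>For \<open>t = k - 1\<close> and \<open>m = n - 2 * k\<close> this is n.\<close>

lemma card_fan_extremal: "card (verts (fan_extremal t m)) = 2 * t + 2 + m"
proof -
  have "card (Inl ` {0..2*t} \<union> Inr ` {0..<m}) = 2 * t + 1 + m"
    by (subst card_Un_disjoint) (auto simp: card_image)
  then show ?thesis unfolding fan_extremal_verts by (subst card_insert_disjoint) (auto simp: card_image)
qed

section \<open>Degrees and spectral radius of the extremal graph\<close>

lemma friend_degrees:
  "card {j. friend_adj t 0 j} = 2 * t" "i \<in> {1..2*t} \<Longrightarrow> card {j. friend_adj t i j} = 2"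
proof -
  have "{j. friend_adj t 0 j} = {1..2*t}"
  proof
    show "{j. friend_adj t 0 j} \<subseteq> {1..2*t}" by (auto simp: friend_adj_iff)
    show "{1..2*t} \<subseteq> {j. friend_adj t 0 j}"
    proof
      fix h :: nat assume h: "h \<in> {1..2*t}"
      have "h = 2 * ((h + 1) div 2) - 1 \<or> h = 2 * ((h + 1) div 2)" "(h + 1) div 2 \<in> {1..t}" using h by auto
      then show "h \<in> {j. friend_adj t 0 j}" using h unfolding friend_adj_iff mem_Collect_eq
        by (intro conjI bexI[of _ "(h + 1) div 2"]) auto
    qed
  qed
  then show "card {j. friend_adj t 0 j} = 2 * t" by simp
  assume i: "i \<in> {1..2*t}"
  define l where "l = (i + 1) div 2"
  have l: "i = 2 * l - 1 \<or> i = 2 * l" "l \<in> {1..t}" using i by (auto simp: l_def)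
  \<comment> \<open>The condition \<open>l' \<ge> 1\<close> keeps the truncated
    \<open>2 * l' - 1\<close> odd.\<close>
  have uniq: "l' = l" if "l' \<ge> 1" "i = 2 * l' - 1 \<or> i = 2 * l'" for l' using that l by auto
  have "{j. friend_adj t i j} = {0, 2*l - 1, 2*l} - {i}"
  proof
    show "{j. friend_adj t i j} \<subseteq> {0, 2*l - 1, 2*l} - {i}"
    proof
      fix j assume "j \<in> {j. friend_adj t i j}"
      then obtain l' where l': "l' \<in> {1..t}" "i \<in> {0, 2*l' - 1, 2*l'}" "j \<in> {0, 2*l' - 1, 2*l'}" "i \<noteq> j"
        unfolding friend_adj_iff by blast
      then have "l' = l" using uniq[of l'] i by auto
      then show "j \<in> {0, 2*l - 1, 2*l} - {i}" using l' by simp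
    qed
    show "{0, 2*l - 1, 2*l} - {i} \<subseteq> {j. friend_adj t i j}" using l unfolding friend_adj_iff by auto
  qed
  moreover have "card ({0, 2*l - 1, 2*l} - {i}) = 2"
  proof -
    have "card {0, 2*l - 1, 2*l} = 3" using l by auto
    then show ?thesis using l by (simp add: card_Diff_singleton_if)
  qed
  ultimately show "card {j. friend_adj t i j} = 2" by simp
qed

text \<open>The lower bound of the expansion with \<open>S1 = 6 * t\<close> and
  \<open>S2 = 4 * t\<^sup>2 + 8 * t\<close>, which come from one vertex of degree
  \<open>2 * t\<close> and \<open>2 * t\<close> vertices of degree two.\<close>

lemma fan_extremal_spectral_radius:
  fixes t m :: nat and \<sigma> q :: real
  defines "\<sigma> \<equiv> spectral_radius (fan_extremal t m)"
  defines "q \<equiv> \<sigma>\<^sup>2 - (2 * real t + 1 + real m)"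
  shows "\<sigma> > 0" "q \<ge> 0" "6 * real t * \<sigma> + (4 * (real t)\<^sup>2 + 8 * real t) \<le> \<sigma>\<^sup>2 * q"
proof -
  define X where "X = fan_extremal t m"
  define V where "V = verts X"
  define E where "E = edges X"
  define a :: "unit + (nat + nat)" where "a = Inl ()"
  define H where "H = {e \<in> E. a \<notin> e}"
  have XVE: "(V, E) = X" by (simp add: V_def E_def verts_def edges_def)
  have finV: "finite V" unfolding V_def X_def fan_extremal_verts by simp
  have cV: "card V = 2 * t + 2 + m" unfolding V_def X_def by (rule card_fan_extremal)
  have E: "edge_set E" "\<Union>E \<subseteq> V" using fan_extremal_edge_set[of t m] by (simp_all add: E_def V_def X_def)
  have V': "V - {a} = Inr ` (Inl ` {0..2*t} \<union> Inr ` {0..<m})"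
    unfolding V_def X_def fan_extremal_verts a_def by auto
  have nba: "nb E a = V - {a}"
  proof (rule set_eqI)
    fix w :: "unit + (nat + nat)"
    show "w \<in> nb E a \<longleftrightarrow> w \<in> V - {a}"
    proof (cases w)
      case (Inl u)
      then have "w = a" by (simp add: a_def)
      then show ?thesis using fan_extremal_adj(1) by (simp add: nb_def E_def X_def a_def)
    next
      case (Inr u)
      then show ?thesis unfolding V' unfolding nb_def E_def X_def a_def mem_Collect_eq Inr fan_extremal_adj(3) by auto
    qed
  qed
  have aV: "a \<in> V" unfolding V_def X_def fan_extremal_verts a_def by simp
  have nbH: "nb H w = nb E w - {a}" if "w \<noteq> a" for w unfolding H_def by (rule nb_avoiding[OF that])
  have d1: "card (nb H (Inr (Inl i))) = card {j. friend_adj t i j}" for i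
  proof -
    have "nb H (Inr (Inl i)) = (\<lambda>j. Inr (Inl j)) ` {j. friend_adj t i j}"
    proof (rule set_eqI)
      fix w :: "unit + (nat + nat)"
      have "w \<in> nb H (Inr (Inl i)) \<longleftrightarrow> w \<in> nb E (Inr (Inl i)) \<and> w \<noteq> a"
        using nbH[of "Inr (Inl i)"] by (simp add: a_def)
      also have "\<dots> \<longleftrightarrow> w \<in> (\<lambda>j. Inr (Inl j)) ` {j. friend_adj t i j}"
      proof (cases w)
        case (Inl u)
        then show ?thesis by (auto simp: a_def)
      next
        case (Inr u)
        show ?thesis
        proof (cases u)
          case (Inl j)
          then show ?thesis unfolding \<open>w = Inr u\<close> Inl nb_def E_def X_def mem_Collect_eq fan_extremal_adj(2) disj_union_empty_edges(1)
            by (auto simp: a_def)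
        next
          case (Inr j)
          then show ?thesis unfolding \<open>w = Inr u\<close> Inr nb_def E_def X_def mem_Collect_eq fan_extremal_adj(2)
            using disj_union_empty_edges(3) by auto
        qed
      qed
      finally show "w \<in> nb H (Inr (Inl i)) \<longleftrightarrow> w \<in> (\<lambda>j. Inr (Inl j)) ` {j. friend_adj t i j}" .
    qed
    then show ?thesis by (simp add: card_image inj_on_def)
  qed
  have d2: "card (nb H (Inr (Inr p))) = 0" for p
  proof -
    have "w \<notin> nb H (Inr (Inr p))" for w
    proof (cases w)
      case (Inl u)
      then show ?thesis using nbH[of "Inr (Inr p)"] by (simp add: a_def)
    next
      case (Inr u)
      then have "w \<notin> nb E (Inr (Inr p))" unfolding nb_def E_def X_def mem_Collect_eq Inr fan_extremal_adj(2)
        by (simp add: disj_union_empty_edges(2))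
      then show ?thesis using nbH[of "Inr (Inr p)"] by (simp add: a_def)
    qed
    then have "nb H (Inr (Inr p)) = {}" by blast
    then show ?thesis by simp
  qed
  \<comment> \<open>\<open>g 0 = 0\<close> removes the isolated vertices. The identity gives
    \<open>S1\<close> and the square gives \<open>S2\<close>.\<close>
  have sumV: "(\<Sum>v\<in>V - {a}. g (card (nb H v))) = g (2 * t) + (2 * real t) * g 2" if "g 0 = 0" for g :: "nat \<Rightarrow> real"
  proof -
    have "(\<Sum>v\<in>V - {a}. g (card (nb H v))) = (\<Sum>u\<in>Inl ` {0..2*t} \<union> Inr ` {0..<m}. g (card (nb H (Inr u))))"
      unfolding V' by (subst sum.reindex) auto
    also have "\<dots> = (\<Sum>u\<in>Inl ` {0..2*t}. g (card (nb H (Inr u)))) + (\<Sum>u\<in>Inr ` {0..<m}. g (card (nb H (Inr u))))"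
      by (rule sum.union_disjoint) auto
    also have "(\<Sum>u\<in>Inr ` {0..<m}. g (card (nb H (Inr u)))) = 0"
      using that d2 by (subst sum.reindex) auto
    also have "(\<Sum>u\<in>Inl ` {0..2*t}. g (card (nb H (Inr u)))) = (\<Sum>i\<in>{0..2*t}. g (card {j. friend_adj t i j}))"
      by (subst sum.reindex) (auto simp: d1)
    also have "\<dots> = g (card {j. friend_adj t 0 j}) + (\<Sum>i\<in>{0..2*t} - {0}. g (card {j. friend_adj t i j}))"
      by (rule sum.remove) auto
    also have "(\<Sum>i\<in>{0..2*t} - {0}. g (card {j. friend_adj t i j})) = (\<Sum>i\<in>{1..2*t}. g 2)"
      using friend_degrees(2) by (intro sum.cong) auto
    also have "\<dots> = (2 * real t) * g 2" by simp
    finally show ?thesis by (simp add: friend_degrees(1))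
  qed
  have S1: "(\<Sum>v\<in>V - {a}. real (card (nb H v))) = 6 * t" using sumV[of real] by simp
  have S2: "(\<Sum>v\<in>V - {a}. (real (card (nb H v)))\<^sup>2) = 4 * (real t)\<^sup>2 + 8 * t"
    using sumV[of "\<lambda>x. (real x)\<^sup>2"] by (simp add: power2_eq_square)
  have V2: "2 \<le> card V" using cV by simp
  note dve = dominating_vertex_expansion[OF finV E(2) V2 E(1) aV nba, folded H_def]
  have \<sigma>: "spectral_radius (V, E) = \<sigma>" by (simp add: XVE \<sigma>_def X_def)
  have q: "(spectral_radius (V, E))\<^sup>2 - (real (card V) - 1) = q" unfolding \<sigma> q_def cV by simp
  show "\<sigma> > 0" using dve(1) \<sigma> by simp
  show "q \<ge> 0" using dve(2) q by simp
  show "6 * real t * \<sigma> + (4 * (real t)\<^sup>2 + 8 * real t) \<le> \<sigma>\<^sup>2 * q"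
    using dve(3) unfolding q unfolding \<sigma> S1 S2 by (simp add: mult_ac)
qed

section \<open>Isomorphism with the extremal graph\<close>

lemma fan_labelling:
  fixes b :: 'a
  assumes "finite \<T>" "\<And>T. T \<in> \<T> \<Longrightarrow> card T = 3 \<and> b \<in> T"
    "\<And>T T'. T \<in> \<T> \<Longrightarrow> T' \<in> \<T> \<Longrightarrow> T \<noteq> T' \<Longrightarrow> T \<inter> T' = {b}"
  shows "\<exists>g. inj_on g {1..2 * card \<T>} \<and> g ` {1..2 * card \<T>} = \<Union>\<T> - {b} \<and>
    \<T> = (\<lambda>l. {b, g (2*l - 1), g (2*l)}) ` {1..card \<T>}"
  using assms
proof (induction rule: finite_induct)
  case empty
  then show ?case by simp
next
  case (insert T \<T>)
  define c where "c = card \<T>"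
  obtain g where g: "inj_on g {1..2 * c}" "g ` {1..2 * c} = \<Union>\<T> - {b}" "\<T> = (\<lambda>l. {b, g (2*l - 1), g (2*l)}) ` {1..c}"
  proof -
    have 1: "card S = 3 \<and> b \<in> S" if "S \<in> \<T>" for S using insert.prems(1)[of S] that by simp
    have 2: "S \<inter> S' = {b}" if "S \<in> \<T>" "S' \<in> \<T>" "S \<noteq> S'" for S S' using insert.prems(2)[of S S'] that by simp
    have "\<exists>g. inj_on g {1..2 * card \<T>} \<and> g ` {1..2 * card \<T>} = \<Union>\<T> - {b} \<and>
        \<T> = (\<lambda>l. {b, g (2*l - 1), g (2*l)}) ` {1..card \<T>}"
      by (rule insert.IH) (fact 1, fact 2)
    then show thesis unfolding c_def[symmetric] by (elim exE conjE) (rule that; assumption)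
  qed
  have T: "card T = 3" "b \<in> T" using insert.prems(1)[of T] by auto
  then have "card (T - {b}) = 2" by simp
  then obtain p q where pq: "T - {b} = {p, q}" "p \<noteq> q" by (meson card_2_iff)
  then have Teq: "T = {b, p, q}" "p \<noteq> b" "q \<noteq> b" using T by auto
  have new: "T \<inter> T' = {b}" if "T' \<in> \<T>" for T'
    using insert.prems(2)[of T T'] insert.hyps(2) that by auto
  have pqn: "p \<notin> \<Union>\<T>" "q \<notin> \<Union>\<T>" using new Teq by blast+
  \<comment> \<open>The new triangle takes the next two labels, so the l-th triangle always occupies
    \<open>2*l - 1\<close> and \<open>2*l\<close>, as in \<open>friendship\<close>.\<close>
  define g' where "g' = (\<lambda>i. if i = 2 * c + 1 then p else if i = 2 * c + 2 then q else g i)"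
  have iv: "{1..2 * Suc c} = {1..2 * c} \<union> {2 * c + 1, 2 * c + 2}" by auto
  have gg: "g' i = g i" if "i \<in> {1..2 * c}" for i using that by (auto simp: g'_def)
  have img: "g' ` {1..2 * c} = \<Union>\<T> - {b}" using gg g(2) by (metis image_cong)
  have g'pq: "g' (2 * c + 1) = p" "g' (2 * c + 2) = q" by (auto simp: g'_def)
  have cardS: "card (insert T \<T>) = Suc c" using insert.hyps by (simp add: c_def)
  have "inj_on g' ({1..2 * c} \<union> {2 * c + 1, 2 * c + 2})"
  proof (subst inj_on_Un, intro conjI)
    show "inj_on g' {1..2 * c}" using g(1) gg by (metis inj_on_cong)
    show "inj_on g' {2 * c + 1, 2 * c + 2}" using g'pq pq(2) by simp
    show "g' ` ({1..2 * c} - {2 * c + 1, 2 * c + 2}) \<inter> g' ` ({2 * c + 1, 2 * c + 2} - {1..2 * c}) = {}"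
      using img pqn g'pq by auto
  qed
  moreover have "g' ` {1..2 * Suc c} = \<Union>(insert T \<T>) - {b}"
    unfolding iv image_Un img using g'pq Teq by auto
  moreover have "insert T \<T> = (\<lambda>l. {b, g' (2*l - 1), g' (2*l)}) ` {1..Suc c}"
  proof -
    have "(\<lambda>l. {b, g' (2*l - 1), g' (2*l)}) ` {1..c} = \<T>"
    proof -
      have "(\<lambda>l. {b, g' (2*l - 1), g' (2*l)}) ` {1..c} = (\<lambda>l. {b, g (2*l - 1), g (2*l)}) ` {1..c}"
      proof (rule image_cong[OF refl])
        fix l assume "l \<in> {1..c}"
        then have "2 * l - 1 \<in> {1..2 * c}" "2 * l \<in> {1..2 * c}" by auto
        then show "{b, g' (2*l - 1), g' (2*l)} = {b, g (2*l - 1), g (2*l)}" by (simp only: gg)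
      qed
      then show ?thesis using g(3) by simp
    qed
    moreover have "{b, g' (2 * Suc c - 1), g' (2 * Suc c)} = T" using g'pq Teq by simp
    moreover have "{1..Suc c} = insert (Suc c) {1..c}" by auto
    ultimately show ?thesis by simp
  qed
  ultimately show ?case unfolding cardS iv by blast
qed

text \<open>The triangles through \<open>b\<close> become the blades of the friendship graph: 0 goes
  to \<open>b\<close>, the labels of \<open>fan_labelling\<close> go to the other vertices of
  triangles, and the uncovered vertices are numbered arbitrarily.\<close>

lemma fan_graph_iso:
  fixes V :: "'a set"
  assumes V: "finite V" "card V = 2 * t + 2 + m" and E: "edge_set E" "\<Union>E \<subseteq> V"
    and ab: "a \<in> V" "b \<in> V - {a}" and nba: "nb E a = V - {a}"
    and T: "triangle_family H \<T>" "H = tri_edges \<T>" "card \<T> = t" "\<And>T. T \<in> \<T> \<Longrightarrow> b \<in> T"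
    and H: "H = {e \<in> E. a \<notin> e}"
  shows "graph_iso (fan_extremal t m) (V, E)"
proof -
  have T3: "card T = 3" if "T \<in> \<T>" for T using T(1) that by (simp add: triangle_family_def)
  have finT: "finite \<T>" using T(1) by (simp add: triangle_family_def)
  have meet: "T \<inter> T' = {b}" if "T \<in> \<T>" "T' \<in> \<T>" "T \<noteq> T'" for T T'
  proof -
    have "card (T \<inter> T') \<le> 1" using T(1) that unfolding triangle_family_def by simp
    moreover have "finite (T \<inter> T')" using T3[OF that(1)] by (simp add: card_ge_0_finite)
    ultimately have eq: "\<forall>x\<in>T \<inter> T'. \<forall>y\<in>T \<inter> T'. x = y" using card_le_Suc0_iff_eq[of "T \<inter> T'"] by simp
    have "b \<in> T \<inter> T'" using T(4) that by simp
    then show ?thesis using eq by blast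
  qed
  obtain g where g: "inj_on g {1..2 * t}" "g ` {1..2 * t} = \<Union>\<T> - {b}" "\<T> = (\<lambda>l. {b, g (2*l - 1), g (2*l)}) ` {1..t}"
  proof -
    have "\<exists>g. inj_on g {1..2 * card \<T>} \<and> g ` {1..2 * card \<T>} = \<Union>\<T> - {b} \<and>
        \<T> = (\<lambda>l. {b, g (2*l - 1), g (2*l)}) ` {1..card \<T>}"
      by (rule fan_labelling[OF finT]) (simp add: T3 T(4), rule meet)
    then show thesis unfolding T(3) by (elim exE conjE) (rule that; assumption)
  qed
  have UT: "\<Union>\<T> \<subseteq> V - {a}"
  proof
    fix v assume "v \<in> \<Union>\<T>"
    then obtain T where T': "T \<in> \<T>" "v \<in> T" by blast
    then have "card (T - {v}) = 2" using T3[OF T'(1)] by simp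
    then have "T - {v} \<noteq> {}" by (metis card.empty zero_neq_numeral)
    then obtain u where "u \<in> T - {v}" by blast
    then have "{v, u} \<in> tri T" using T' by (auto simp: tri_def card_insert_if)
    then have "{v, u} \<in> H" using T(2) T' by (auto simp: tri_edges_def)
    then show "v \<in> V - {a}" using E(2) by (auto simp: H)
  qed
  define G where "G = (\<lambda>i::nat. if i = 0 then b else g i)"
  have G0: "{0..2*t} = insert 0 {1..2*t}" by auto
  have Gg: "G ` {1..2*t} = \<Union>\<T> - {b}"
  proof -
    have "G ` {1..2*t} = g ` {1..2*t}" by (rule image_cong) (auto simp: G_def)
    then show ?thesis using g(2) by simp
  qed
  have Ginj: "inj_on G {0..2*t}"
  proof -
    have "inj_on G {1..2*t} \<longleftrightarrow> inj_on g {1..2*t}" by (rule inj_on_cong) (simp add: G_def)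
    then have "inj_on G {1..2*t}" using g(1) by simp
    moreover have "G 0 \<notin> G ` {1..2*t}" unfolding Gg by (simp add: G_def)
    ultimately show ?thesis unfolding G0 by simp
  qed
  have Gimg: "G ` {0..2*t} = insert b (\<Union>\<T>)" unfolding G0 image_insert Gg by (simp add: G_def)
  have GV: "G ` {0..2*t} \<subseteq> V - {a}" unfolding Gimg using UT ab by auto
  have GT: "\<T> = (\<lambda>l. G ` {0, 2*l - 1, 2*l}) ` {1..t}"
    unfolding g(3)
  proof (rule image_cong[OF refl])
    fix l assume "l \<in> {1..t}"
    then have "2 * l - 1 \<noteq> 0" "2 * l \<noteq> 0" by auto
    then show "{b, g (2*l - 1), g (2*l)} = G ` {0, 2*l - 1, 2*l}" unfolding image_insert image_empty G_def by simp
  qed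
  define Rest where "Rest = V - {a} - G ` {0..2*t}"
  have "card (G ` {0..2*t}) = 2 * t + 1" using card_image[OF Ginj] by simp
  then have "card Rest = m"
    unfolding Rest_def using V ab GV by (subst card_Diff_subset) (auto simp: finite_subset)
  moreover have "finite Rest" using V(1) by (simp add: Rest_def)
  ultimately obtain rr where rr: "bij_betw rr {0..<m} Rest" using ex_bij_betw_nat_finite by blast
  define f :: "unit + (nat + nat) \<Rightarrow> 'a" where
    "f = (\<lambda>w. case w of Inl _ \<Rightarrow> a | Inr w \<Rightarrow> (case w of Inl i \<Rightarrow> G i | Inr j \<Rightarrow> rr j))"
  have f: "f (Inl u) = a" "f (Inr (Inl i)) = G i" "f (Inr (Inr j)) = rr j" for u i j by (auto simp: f_def)
  define X where "X = fan_extremal t m"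
  have Xv: "verts X = insert (Inl ()) (Inr ` (Inl ` {0..2*t} \<union> Inr ` {0..<m}))" unfolding X_def by (rule fan_extremal_verts)
  have rrim: "rr ` {0..<m} = Rest" using rr by (simp add: bij_betw_def)
  have bij: "bij_betw f (verts X) V"
    unfolding bij_betw_def
  proof
    have "f ` verts X = {a} \<union> (G ` {0..2*t} \<union> rr ` {0..<m})"
      unfolding Xv by (simp add: image_Un image_image f)
    also have "\<dots> = V" unfolding rrim Rest_def using ab GV by auto
    finally show "f ` verts X = V" .
    \<comment> \<open>Equal cardinalities turn surjectivity into injectivity, which saves a case
      distinction.\<close>
    then show "inj_on f (verts X)"
      using V(2) card_fan_extremal[of t m] by (intro eq_card_imp_inj_on) (auto simp: X_def fan_extremal_verts)
  qed
  have GE: "{G i, G j} \<in> E \<longleftrightarrow> friend_adj t i j" if ij: "i \<in> {0..2*t}" "j \<in> {0..2*t}" for i j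
  proof -
    have "G i \<noteq> a" "G j \<noteq> a" using GV imageI[OF ij(1), of G] imageI[OF ij(2), of G] by blast+
    then have "{G i, G j} \<in> E \<longleftrightarrow> {G i, G j} \<in> tri_edges \<T>" unfolding T(2)[symmetric] H by auto
    also have "\<dots> \<longleftrightarrow> (\<exists>T\<in>\<T>. G i \<in> T \<and> G j \<in> T \<and> G i \<noteq> G j)"
      by (auto simp: tri_edges_def tri_def card_insert_if)
    also have "\<dots> \<longleftrightarrow> (\<exists>l\<in>{1..t}. G i \<in> G ` {0, 2*l - 1, 2*l} \<and> G j \<in> G ` {0, 2*l - 1, 2*l} \<and> G i \<noteq> G j)"
      unfolding GT by blast
    also have "\<dots> \<longleftrightarrow> (\<exists>l\<in>{1..t}. i \<in> {0, 2*l - 1, 2*l} \<and> j \<in> {0, 2*l - 1, 2*l} \<and> i \<noteq> j)"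
    proof (intro bex_cong refl)
      fix l assume l: "l \<in> {1..t}"
      have sub: "{0, 2*l - 1, 2*l} \<subseteq> {0..2*t}" using l by auto
      have "G h \<in> G ` {0, 2*l - 1, 2*l} \<longleftrightarrow> h \<in> {0, 2*l - 1, 2*l}" if "h \<in> {0..2*t}" for h
        by (rule inj_on_image_mem_iff[OF Ginj that sub])
      moreover have "G i = G j \<longleftrightarrow> i = j" using inj_on_eq_iff[OF Ginj ij] .
      ultimately show "(G i \<in> G ` {0, 2*l - 1, 2*l} \<and> G j \<in> G ` {0, 2*l - 1, 2*l} \<and> G i \<noteq> G j) \<longleftrightarrow>
        (i \<in> {0, 2*l - 1, 2*l} \<and> j \<in> {0, 2*l - 1, 2*l} \<and> i \<noteq> j)" using ij by metis
    qed
    also have "\<dots> \<longleftrightarrow> friend_adj t i j" unfolding friend_adj_iff by blast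
    finally show ?thesis .
  qed
  have restE: "{rr j, w} \<notin> E" if "j \<in> {0..<m}" "w \<noteq> a" for j w
  proof
    assume e: "{rr j, w} \<in> E"
    have rj: "rr j \<in> Rest" using rrim that(1) by blast
    then have "{rr j, w} \<in> H" using e that(2) by (auto simp: H Rest_def)
    then obtain T where "T \<in> \<T>" "rr j \<in> T" unfolding T(2) tri_edges_def tri_def by blast
    then have "rr j \<in> G ` {0..2*t}" unfolding Gimg by blast
    then show False using rj by (simp add: Rest_def)
  qed
  have aE: "{a, w} \<in> E \<longleftrightarrow> w \<in> V - {a}" for w using nba by (auto simp: nb_def)
  have Sub: "G i \<in> V - {a}" "rr j \<in> V - {a}" if "i \<in> {0..2*t}" "j \<in> {0..<m}" for i j
    using GV rrim that unfolding Rest_def by blast+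
  have adjX: "adj X u v \<longleftrightarrow> {u, v} \<in> edges X" for u v by (simp add: adj_def)
  have "adj X u v \<longleftrightarrow> {f u, f v} \<in> E" if uv: "u \<in> verts X" "v \<in> verts X" for u v
  proof -
    have case_a: "adj X (Inl ()) v \<longleftrightarrow> {f (Inl ()), f v} \<in> E" if v: "v \<in> verts X" for v
    proof -
      consider "v = Inl ()" | w where "v = Inr w" "w \<in> Inl ` {0..2*t} \<union> Inr ` {0..<m}" using v unfolding Xv by blast
      then show ?thesis
      proof cases
        case 1
        then show ?thesis using fan_extremal_adj(1)[of t m] aE[of a] unfolding 1 adjX unfolding X_def f by simp
      next
        case 2
        have "f v \<in> V - {a}" using 2 Sub[of _ ] GV rrim unfolding Rest_def by (auto simp: f)
        then show ?thesis using 2 aE[of "f v"] unfolding adjX unfolding X_def 2(1) fan_extremal_adj(3) f by simp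
      qed
    qed
    consider "u = Inl ()" | "v = Inl ()" | w w' where "u = Inr w" "w \<in> Inl ` {0..2*t} \<union> Inr ` {0..<m}"
        "v = Inr w'" "w' \<in> Inl ` {0..2*t} \<union> Inr ` {0..<m}"
      using uv unfolding Xv by blast
    then show ?thesis
    proof cases
      case 1 then show ?thesis using case_a uv by simp
    next
      case 2 then show ?thesis using case_a[OF uv(1)] by (simp add: adj_def insert_commute)
    next
      case (3 w w')
      have na: "f u \<noteq> a" "f v \<noteq> a" using 3 GV rrim unfolding Rest_def by (auto simp: f)
      consider i j where "w = Inl i" "w' = Inl j" "i \<in> {0..2*t}" "j \<in> {0..2*t}" | j where "w = Inr j" "j \<in> {0..<m}"
        | j where "w' = Inr j" "j \<in> {0..<m}" using 3 by blast
      then show ?thesis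
      proof cases
        case (1 i j)
        show ?thesis unfolding adjX unfolding X_def 3(1,3) fan_extremal_adj(2) 1(1,2) disj_union_empty_edges(1) f
          using GE[OF 1(3,4)] by simp
      next
        case (2 j)
        have "{f u, f v} \<notin> E" using restE[OF 2(2) na(2)] 3 2 by (simp add: f)
        then show ?thesis unfolding adjX unfolding X_def 3(1,3) fan_extremal_adj(2) 2(1) using disj_union_empty_edges(2) by simp
      next
        case r: (3 j)
        have "{f v, f u} \<notin> E" using restE[OF r(2) na(1)] 3 r by (simp add: f)
        then have "{f u, f v} \<notin> E" by (simp add: insert_commute)
        then show ?thesis unfolding adjX unfolding X_def 3(1,3) fan_extremal_adj(2) r(1) using disj_union_empty_edges(3) by simp
      qed
    qed
  qed
  then show ?thesis
    unfolding graph_iso_def using bij by (intro exI[of _ f]) (auto simp: X_def verts_def adj_def edges_def)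
qed

lemma extremal_graph_iso:
  fixes G :: "'a graph" and k n :: nat
  assumes k: "k \<ge> 1" and n: "n \<ge> 144 * k ^ 4"
    and G: "simple_graph G" "planar G" "card (verts G) = n" "\<not> has_k_edge_disjoint_cycles G k"
    and le: "spectral_radius (fan_extremal (k - 1) (n - 2 * k)) \<le> spectral_radius G"
  shows "graph_iso G (fan_extremal (k - 1) (n - 2 * k))"
proof -
  define V where "V = verts G"
  define E where "E = edges G"
  define t where "t = k - 1"
  define m where "m = n - 2 * k"
  define \<rho> where "\<rho> = spectral_radius (V, E)"
  define \<sigma> where "\<sigma> = spectral_radius (fan_extremal t m)"
  have GVE: "(V, E) = G" by (simp add: V_def E_def verts_def edges_def)
  have E: "edge_set E" "\<Union>E \<subseteq> V" "finite V" using simple_graph_edge_set[OF G(1)] by (simp_all add: V_def E_def)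
  have np: "\<not> packs E k" using packs_imp_has_k[OF G(1)] G(4) unfolding E_def by blast
  have "k ^ 1 \<le> k ^ 4" using k by (intro power_increasing) auto
  then have nk: "144 * k \<le> n" using n by simp
  then have cV: "card V = 2 * t + 2 + m" "card V = n" using G(3) k by (simp_all add: V_def t_def m_def)
  have rn: "2 * real t + 1 + real m = real (card V) - 1" using cV(1) by simp
  note X = fan_extremal_spectral_radius[of t m, folded \<sigma>_def, unfolded rn]
  have \<sigma>\<rho>: "\<sigma> \<le> \<rho>" using le by (simp add: \<sigma>_def \<rho>_def GVE t_def m_def)
  have \<rho>0: "0 \<le> \<rho>" using X(1) \<sigma>\<rho> by linarith
  have "\<sigma>\<^sup>2 \<le> \<rho>\<^sup>2" using X(1) \<sigma>\<rho> by (intro power_mono) auto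
  \<comment> \<open>The lower bound is inherited from the extremal graph, whose excess over a star
    is nonnegative.\<close>
  then have \<rho>n: "real (card V) - 1 \<le> \<rho>\<^sup>2" using X(2) by linarith
  have loc: "card {e \<in> E. e \<subseteq> nb E a} \<le> 3 * (k - 1)" for a
    using planar_neighbourhood_edges(2)[OF G(1,2) np[unfolded E_def], of a] by (simp add: E_def)
  have "144 * k ^ 4 \<le> card V" using n cV(2) by simp
  then obtain a where a: "a \<in> V" "nb E a = V - {a}"
    using hub_dominates[OF E(3,2,1) k _ np loc] \<rho>0 \<rho>n unfolding \<rho>_def by blast
  define H where "H = {e \<in> E. a \<notin> e}"
  have HE: "edge_set H" using E(1) by (rule edge_set_subset) (auto simp: H_def)
  have HV: "\<Union>H \<subseteq> V - {a}" using E(2) by (auto simp: H_def)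
  \<comment> \<open>As \<open>a\<close> is adjacent to all other vertices, deleting it is the same
    as restricting to its neighbourhood, so the planar bounds apply to \<open>H\<close>.\<close>
  have H: "H = {e \<in> E. e \<subseteq> nb E a}"
  proof
    show "H \<subseteq> {e \<in> E. e \<subseteq> nb E a}" unfolding a(2) using HV by (auto simp: H_def)
    show "{e \<in> E. e \<subseteq> nb E a} \<subseteq> H" unfolding a(2) by (auto simp: H_def)
  qed
  have cH: "card H \<le> 3 * (k - 1)" using loc[of a] H by simp
  have rigid: "H = tri_edges \<T>" if "triangle_family H \<T>" "triangle_free (H - tri_edges \<T>)" "card H = 3 * (k - 1)" for \<T>
    using planar_neighbourhood_edges(3)[OF G(1,2) np[unfolded E_def], of a \<T>] that unfolding H E_def by blast
  obtain \<T> where T: "triangle_family H \<T>" "triangle_free (H - tri_edges \<T>)" using maximal_triangle_family[OF HE] by blast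
  have V2: "2 \<le> card V" using nk k cV(2) by simp
  have finV': "finite (V - {a})" using E(3) by simp
  have S1: "(\<Sum>v\<in>V - {a}. real (card (nb H v))) = 2 * real (card H)"
    using sum_card_nb[OF HE finV' HV] by (metis of_nat_mult of_nat_numeral of_nat_sum)
  define S2 where "S2 = (\<Sum>v\<in>V - {a}. (real (card (nb H v)))\<^sup>2)"
  note dve = dominating_vertex_expansion[OF E(3,2) V2 E(1) a, folded H_def \<rho>_def S2_def, unfolded S1]
  have nR: "144 * real k ^ 4 \<le> real (card V)"
    using n cV(2) by (metis of_nat_le_iff of_nat_mult of_nat_numeral of_nat_power)
  have big: "\<rho> \<ge> 119/10 * (real k)\<^sup>2" by (rule hub_radius_bound[OF k nR \<rho>n \<rho>0])
  \<comment> \<open>Too few edges and a missing common vertex are the two cases of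
    \<open>extremal_comparison\<close>.\<close>
  have good: "card H = 3 * (k - 1) \<and> (\<exists>b. \<forall>T\<in>\<T>. b \<in> T)"
  proof (rule ccontr)
    assume neg: "\<not> ?thesis"
    have S2b: "S2 + 8 \<le> 4 * (real (k - 1))\<^sup>2 + 8 * real (k - 1)" if e: "card H = 3 * (k - 1)"
    proof -
      have HT: "H = tri_edges \<T>" using rigid[OF T e] .
      have cT: "card \<T> = k - 1" using card_tri_edges[OF T(1)] HT e by simp
      have nob: "\<not> (\<exists>b. \<forall>T\<in>\<T>. b \<in> T)" using neg e by blast
      have "triangle_family H \<T>' \<Longrightarrow> triangle_free (H - tri_edges \<T>') \<Longrightarrow> H = tri_edges \<T>'" for \<T>'
        using rigid e by blast
      from triangle_structure[OF HE T(1) HT this finV' HV] nob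
      have "(\<Sum>v\<in>V - {a}. (card (nb H v))\<^sup>2) + 8 \<le> 4 * (k - 1)\<^sup>2 + 8 * (k - 1)" unfolding cT by blast
      then have "real ((\<Sum>v\<in>V - {a}. (card (nb H v))\<^sup>2) + 8) \<le> real (4 * (k - 1)\<^sup>2 + 8 * (k - 1))" by (rule of_nat_mono)
      then show ?thesis by (simp add: S2_def)
    qed
    show False
    proof (rule extremal_comparison[OF k X(1) \<sigma>\<rho> big])
      show "6 * real (k - 1) * \<sigma> + (4 * (real (k - 1))\<^sup>2 + 8 * real (k - 1)) \<le> \<sigma>\<^sup>2 * (\<sigma>\<^sup>2 - (real (card V) - 1))"
        using X(3) unfolding t_def .
      show "0 \<le> \<rho>\<^sup>2 - (real (card V) - 1)" using \<rho>n by simp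
      show "\<rho>\<^sup>2 * (\<rho>\<^sup>2 - (real (card V) - 1)) \<le> \<rho> * real (2 * card H) + S2 + real (2 * card H) * (\<rho>\<^sup>2 - (real (card V) - 1))"
        using dve(4) by (simp add: S2_def)
      show "(\<rho> - real (card H)) * (\<rho>\<^sup>2 - (real (card V) - 1)) \<le> real (2 * card H)" using dve(5) by simp
    qed (use cH S2b in auto)
  qed
  then have e: "card H = 3 * (k - 1)" by blast
  have HT: "H = tri_edges \<T>" using rigid[OF T e] .
  have cT: "card \<T> = t" using card_tri_edges[OF T(1)] HT e by (simp add: t_def)
  obtain b where b: "b \<in> V - {a}" "\<And>T. T \<in> \<T> \<Longrightarrow> b \<in> T"
  \<comment> \<open>The family is empty exactly for \<open>k = 1\<close>. Then the friendship graph
    is a single vertex, and any vertex other than \<open>a\<close> serves as its centre.\<close>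
  proof (cases "\<T> = {}")
    case True
    have "card (V - {a}) = card V - 1" using a(1) E(3) by simp
    then have "V - {a} \<noteq> {}" using V2 by (metis card.empty diff_is_0_eq not_one_le_zero numeral_le_one_iff one_le_numeral order_trans semiring_norm(69) zero_neq_one)
    then obtain b where "b \<in> V - {a}" by blast
    then show thesis using that[of b] True by simp
  next
    case False
    obtain b where b: "\<And>T. T \<in> \<T> \<Longrightarrow> b \<in> T" using good by blast
    obtain T0 where T0: "T0 \<in> \<T>" using False by blast
    have "card T0 = 3" using T(1) T0 by (simp add: triangle_family_def)
    then have "card (T0 - {b}) = 2" using b[OF T0] by simp
    then have "T0 - {b} \<noteq> {}" by (metis card.empty zero_neq_numeral)
    then obtain u where "u \<in> T0 - {b}" by blast
    then have "{b, u} \<in> tri T0" using b[OF T0] by (auto simp: tri_def card_insert_if)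
    then have "{b, u} \<in> H" using HT T0 by (auto simp: tri_edges_def)
    then have "b \<in> V - {a}" using HV by blast
    then show thesis using that b by blast
  qed
  have "graph_iso (fan_extremal t m) (V, E)"
    by (rule fan_graph_iso[OF E(3) cV(1) E(1,2) a(1) b(1) a(2) T(1) HT cT b(2) H_def])
  then show ?thesis unfolding GVE t_def m_def by (rule graph_iso_sym)
qed

theorem theorem1p2:
  fixes G :: "'a graph" and k n :: nat
  assumes "k \<ge> 1" and "n \<ge> 144 * k ^ 4"
    and "simple_graph G" and "planar G" and "card (verts G) = n"
    and "\<not> has_k_edge_disjoint_cycles G k"
  shows "spectral_radius G \<le>
           spectral_radius (graph_join K1 (disj_union (friendship (k - 1)) (empty_graph (n - 2 * k))))
    \<and> (spectral_radius G =
           spectral_radius (graph_join K1 (disj_union (friendship (k - 1)) (empty_graph (n - 2 * k))))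
       \<longleftrightarrow> graph_iso G (graph_join K1 (disj_union (friendship (k - 1)) (empty_graph (n - 2 * k)))))"
  \<comment> \<open>If the claimed inequality failed, the reverse one would give an isomorphism and
    hence equality of the radii.\<close>
  using extremal_graph_iso[OF assms] graph_iso_spectral_radius[of G "fan_extremal (k - 1) (n - 2 * k)"]
  by (metis linorder_le_cases order_refl)

end
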